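(* Let $n=2$ and let $(r,s)$ be a signature, i.e. $(r,s)\in\{(2,0),(0,1)\}$. (1) Let $E$ be a $1$-dimensional subspace of $\mathbb R^2$ such that $E\neq\ell_{\overline 1}$ and $E\ne V_0$. Then $$\frac{1}{|\mathcal F^s_2(T)|}\sum_{\mathbb F\in \mathcal F^s_2(T)}\delta_{q_E(\mathbb F)}\longrightarrow m_{Y_1^{\ell_{\overline 1}}}\quad\text{weakly as }T\to\infty.$$ (2) When $E=V_0$, there exist a periodic orbit $\{p_1,p_2\}\subset Y_1^{\ell_{\overline 1}}$ and $t\in(0,1)$ such that $$\frac{1}{|\mathcal F^s_2(T)|}\sum_{\mathbb F\in \mathcal F^s_2(T)}\delta_{q_{V_0}(\mathbb F)}\longrightarrow t\,\delta_{p_1}+(1-t)\,\delta_{p_2}\quad\text{weakly as }T\to\infty.$$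
   Context: **Number fields.** For $T>0$, $\mathcal F_2^s(T)$ is the finite set of isomorphism classes of quadratic number fields of signature $(2-2s,s)$ (real quadratic if $s=0$, imaginary quadratic if $s=1$) with discriminant at most $T$ in absolute value (the condition that the Galois group of the normal closure be $S_2$ is automatic). **Lattices.** For a quadratic field $\mathbb F$ with ring of integers $\mathcal O_{\mathbb F}$: if $s=0$ with real embeddings $\sigma_1,\sigma_2$ (in a fixed order), $\Lambda(\mathbb F)=\{(\sigma_1(\alpha),\sigma_2(\alpha)):\alpha\in\mathcal O_{\mathbb F}\}\subset\mathbb R^2$; if $s=1$ with complex embeddings $\tau,\overline\tau$, $\Lambda(\mathbb F)=\tau(\mathcal O_{\mathbb F})\subset\mathbb C\cong\mathbb R^2$ via $z\mapsto(\mathrm{Re}\,z,\mathrm{Im}\,z)$. $\Lambda(\mathbb F)$ is a lattice. For a lattice $\Lambda\subset\mathbb R^2$, $\langle\Lambda\rangle=\mathrm{cov}(\Lambda)^{-1/2}\Lambda$. $X_2\cong\mathrm{SL}_2(\mathbb R)/\mathrm{SL}_2(\mathbb Z)$ is the space of unimodular (covolume $1$) lattices in $\mathbb R^2$ with the quotient topology. **The line and its orthogonal complement.** $\overline 1=(1,1)$ if $s=0$ and $\overline 1=(1,0)$ if $s=1$; $\ell_{\overline 1}=\mathbb R\cdot\overline 1$; $V_0=\ell_{\overline 1}^{\perp}$ for the standard inner product. **The space $Y_1^{\ell_{\overline 1}}$.** $Y_1^{\ell_{\overline 1}}=\{\Lambda\in X_2:\Lambda\cap\ell_{\overline 1}\text{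 is a unimodular lattice in }\ell_{\overline 1}\}$ (i.e. $\Lambda\cap\ell_{\overline 1}$ is generated by a vector of Euclidean norm $1$). It is a closed orbit of the group $\{g\in\mathrm{SL}_2(\mathbb R):gv=v\ \forall v\in\ell_{\overline 1}\}$ and carries a unique Borel probability measure invariant under this group, denoted $m_{Y_1^{\ell_{\overline 1}}}$. A periodic orbit is an orbit of a closed subgroup $H\le\mathrm{SL}_2(\mathbb R)$ in $X_2$ that supports an $H$-invariant Borel probability measure. **The deformation.** For $1$-dimensional $E$ with $E\neq\ell_{\overline 1}$ and $t\in\mathbb R$, $g^t_{E,\ell_{\overline 1}}\in\mathrm{SL}_2(\mathbb R)$ is multiplication by $e^{t}$ on $E$ and by $e^{-t}$ on $\ell_{\overline 1}$. $q_E(\mathbb F)=g^t_{E,\ell_{\overline 1}}\langle\Lambda(\mathbb F)\rangle$, where $t$ is the unique real number for which this lattice belongs to $Y_1^{\ell_{\overline 1}}$. **Weak convergence.** $\mu_T\to\mu$ weakly if $\int f\,d\mu_T\to\int f\,d\mu$ for every continuous compactly supported real function $f$. $\delta_x$ is the Dirac measure at $x$. *)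

theory Defs
  imports "HOL-Probability.Probability" "HOL-Computational_Algebra.Polynomial"
begin

section \<open>Quadratic number fields\<close>

text \<open>Every number field is isomorphic to a subfield of \<open>\<complex>\<close>; number fields are therefore
  taken to be subfields of \<open>\<complex>\<close>, and isomorphism classes are formed explicitly below.\<close>

definition is_subfield :: "complex set \<Rightarrow> bool" where
  "is_subfield K \<longleftrightarrow> 1 \<in> K \<and> (\<forall>x\<in>K. \<forall>y\<in>K. x - y \<in> K \<and> x * y \<in> K) \<and> (\<forall>x\<in>K. inverse x \<in> K)"

interpretation rat_cplx: vector_space "\<lambda>(q::rat) (z::complex). of_rat q * z"
  by unfold_locales (simp_all add: algebra_simps of_rat_add of_rat_mult)

definition quadratic_field :: "complex set \<Rightarrow> bool" where
  "quadratic_field K \<longleftrightarrow> is_subfield K \<and> rat_cplx.dim K = 2"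

definition field_hom :: "complex set \<Rightarrow> (complex \<Rightarrow> complex) \<Rightarrow> bool" where
  "field_hom K \<sigma> \<longleftrightarrow> \<sigma> 1 = 1 \<and> (\<forall>x\<in>K. \<forall>y\<in>K. \<sigma> (x + y) = \<sigma> x + \<sigma> y \<and> \<sigma> (x * y) = \<sigma> x * \<sigma> y)"

text \<open>Restricting to extensional functions makes each embedding \<open>K \<rightarrow> \<complex>\<close> correspond to exactly
  one HOL function.\<close>

definition embeddings :: "complex set \<Rightarrow> (complex \<Rightarrow> complex) set" where
  "embeddings K = {\<sigma> \<in> extensional K. field_hom K \<sigma>}"

definition signature :: "complex set \<Rightarrow> nat \<times> nat" where
  "signature K = (card {\<sigma> \<in> embeddings K. \<sigma> ` K \<subseteq> \<real>}, card {\<sigma> \<in> embeddings K. \<not> \<sigma> ` K \<subseteq> \<real>} div 2)"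

definition ring_of_integers :: "complex set \<Rightarrow> complex set" where
  "ring_of_integers K = {x \<in> K. algebraic_int x}"

definition integral_basis :: "complex set \<Rightarrow> complex \<Rightarrow> complex \<Rightarrow> bool" where
  "integral_basis K a b \<longleftrightarrow> a \<in> ring_of_integers K \<and> b \<in> ring_of_integers K \<and>
     (\<forall>x \<in> ring_of_integers K. \<exists>!(m, n). x = of_int m * a + of_int n * b)"

text \<open>\<open>det (\<sigma>\<^sub>i \<omega>\<^sub>j)\<^sup>2\<close> for an integral basis \<open>\<omega>\<^sub>1, \<omega>\<^sub>2\<close>.\<close>

definition field_disc :: "complex set \<Rightarrow> int" where
  "field_disc K = (THE D. \<exists>a b \<sigma>\<^sub>1 \<sigma>\<^sub>2. integral_basis K a b \<and> \<sigma>\<^sub>1 \<noteq> \<sigma>\<^sub>2 \<and> embeddings K = {\<sigma>\<^sub>1, \<sigma>\<^sub>2} \<and>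
     of_int D = (\<sigma>\<^sub>1 a * \<sigma>\<^sub>2 b - \<sigma>\<^sub>1 b * \<sigma>\<^sub>2 a)\<^sup>2)"

definition field_iso :: "(complex set \<times> complex set) set" where
  "field_iso = {(K, L). quadratic_field K \<and> quadratic_field L \<and> (\<exists>\<phi>. field_hom K \<phi> \<and> bij_betw \<phi> K L)}"

definition F2 :: "nat \<Rightarrow> real \<Rightarrow> complex set set set" where
  "F2 s T = {K. quadratic_field K \<and> signature K = (2 - 2 * s, s) \<and> \<bar>real_of_int (field_disc K)\<bar> \<le> T} // field_iso"

text \<open>The two arbitrary choices made in the construction of \<open>\<Lambda>(F)\<close>: a field in each isomorphism
  class, and an ordering of the two embeddings of each field (in the imaginary case, the choice
  of \<open>\<tau>\<close> among \<open>\<tau>\<close>, \<open>\<tau>\<close>-bar).\<close>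

definition class_representatives :: "(complex set set \<Rightarrow> complex set) \<Rightarrow> bool" where
  "class_representatives rep \<longleftrightarrow> (\<forall>C \<in> {K. quadratic_field K} // field_iso. rep C \<in> C)"

definition ordered_embeddings ::
  "(complex set \<Rightarrow> (complex \<Rightarrow> complex) \<times> (complex \<Rightarrow> complex)) \<Rightarrow> bool" where
  "ordered_embeddings em \<longleftrightarrow> (\<forall>K. quadratic_field K \<longrightarrow>
     fst (em K) \<noteq> snd (em K) \<and> embeddings K = {fst (em K), snd (em K)})"

section \<open>Lattices in the plane\<close>

definition lattice_of_mat :: "real^2^2 \<Rightarrow> (real^2) set" where
  "lattice_of_mat g = {g *v x | x. \<forall>i. x $ i \<in> \<int>}"

definition is_lattice :: "(real^2) set \<Rightarrow> bool" where
  "is_lattice \<Lambda> \<longleftrightarrow> (\<exists>g. invertible g \<and> \<Lambda> = lattice_of_mat g)"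

definition covol :: "(real^2) set \<Rightarrow> real" where
  "covol \<Lambda> = (THE c. \<exists>g. invertible g \<and> \<Lambda> = lattice_of_mat g \<and> c = \<bar>det g\<bar>)"

definition normalize_lattice :: "(real^2) set \<Rightarrow> (real^2) set" where
  "normalize_lattice \<Lambda> = (\<lambda>v. (covol \<Lambda> powr (-1/2)) *\<^sub>R v) ` \<Lambda>"

definition field_lattice ::
  "nat \<Rightarrow> (complex set \<Rightarrow> (complex \<Rightarrow> complex) \<times> (complex \<Rightarrow> complex)) \<Rightarrow> complex set \<Rightarrow> (real^2) set" where
  "field_lattice s em K = (let (\<sigma>\<^sub>1, \<sigma>\<^sub>2) = em K in
     if s = 0 then (\<lambda>\<alpha>. vector [Re (\<sigma>\<^sub>1 \<alpha>), Re (\<sigma>\<^sub>2 \<alpha>)]) ` ring_of_integers K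
     else (\<lambda>\<alpha>. vector [Re (\<sigma>\<^sub>1 \<alpha>), Im (\<sigma>\<^sub>1 \<alpha>)]) ` ring_of_integers K)"

definition SL2 :: "(real^2^2) set" where
  "SL2 = {g. det g = 1}"

definition act :: "real^2^2 \<Rightarrow> (real^2) set \<Rightarrow> (real^2) set" where
  "act g \<Lambda> = (\<lambda>v. g *v v) ` \<Lambda>"

definition unimodular_lattices :: "(real^2) set set" where
  "unimodular_lattices = {\<Lambda>. is_lattice \<Lambda> \<and> covol \<Lambda> = 1}"

text \<open>The quotient topology along \<open>g \<mapsto> g \<int>\<^sup>2\<close> (see \<open>quotient_map_X2\<close> below).\<close>

definition X2 :: "(real^2) set topology" where
  "X2 = topology (\<lambda>U. U \<subseteq> unimodular_lattices \<and>
          openin (top_of_set SL2) {g \<in> SL2. lattice_of_mat g \<in> U})"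

definition borel_X2 :: "(real^2) set measure" where
  "borel_X2 = sigma (topspace X2) {U. openin X2 U}"

lemma int_matrix_det:
  fixes A :: "real^2^2"
  assumes "\<And>i j. A $ i $ j \<in> \<int>"
  shows "det A \<in> \<int>"
  unfolding det_2 using assms by (intro Ints_diff Ints_mult)

lemma lattice_subset_factor:
  fixes g h :: "real^2^2"
  assumes "lattice_of_mat g \<subseteq> lattice_of_mat h"
  shows "\<exists>A. g = h ** A \<and> (\<forall>i j. A $ i $ j \<in> \<int>)"
proof -
  have "\<exists>x. column j g = h *v x \<and> (\<forall>i. x $ i \<in> \<int>)" for j
  proof -
    have "column j g = g *v axis j 1"
      by (simp add: matrix_vector_mul_component vec_eq_iff column_def matrix_vector_mult_basis)
    moreover have "\<forall>i. axis j (1::real) $ i \<in> \<int>"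
      by (simp add: axis_def)
    ultimately have "column j g \<in> lattice_of_mat g"
      unfolding lattice_of_mat_def by blast
    then show ?thesis
      using assms unfolding lattice_of_mat_def by blast
  qed
  then obtain X where X: "\<And>j. column j g = h *v X j" "\<And>j i. X j $ i \<in> \<int>"
    by metis
  define A :: "real^2^2" where "A = (\<chi> i j. X j $ i)"
  have "g = h ** A"
    using X(1) by (simp add: vec_eq_iff matrix_matrix_mult_def matrix_vector_mult_def column_def A_def)
  then show ?thesis
    using X(2) by (auto simp: A_def)
qed

lemma lattice_eq_det:
  fixes g h :: "real^2^2"
  assumes "lattice_of_mat g = lattice_of_mat h" "invertible g"
  shows "\<bar>det g\<bar> = \<bar>det h\<bar>"
proof -
  obtain A B where A: "g = h ** A" "\<And>i j. A $ i $ j \<in> \<int>" and B: "h = g ** B" "\<And>i j. B $ i $ j \<in> \<int>"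
    using lattice_subset_factor[of g h] lattice_subset_factor[of h g] assms(1) by blast
  have dets: "det g = det h * det A" "det h = det g * det B"
    using arg_cong[OF A(1), of det] arg_cong[OF B(1), of det] by (simp_all only: det_mul)
  have "det g \<noteq> 0"
    using assms(2) by (simp add: invertible_det_nz)
  then have nz: "det A \<noteq> 0" "det B \<noteq> 0"
    by (metis dets mult_eq_0_iff)+
  have ge: "\<bar>det A\<bar> \<ge> 1" "\<bar>det B\<bar> \<ge> 1"
    using nz int_matrix_det[of A, OF A(2)] int_matrix_det[of B, OF B(2)]
    by (simp_all only: Ints_nonzero_abs_ge1 not_False_eq_True)
  have "\<bar>det h\<bar> * 1 \<le> \<bar>det h\<bar> * \<bar>det A\<bar>" "\<bar>det g\<bar> * 1 \<le> \<bar>det g\<bar> * \<bar>det B\<bar>"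
    using ge by (intro mult_left_mono; simp)+
  then have "\<bar>det h\<bar> \<le> \<bar>det g\<bar>" "\<bar>det g\<bar> \<le> \<bar>det h\<bar>"
    unfolding abs_mult[symmetric] dets[symmetric] by simp_all
  then show ?thesis by simp
qed

lemma covol_lattice_of_mat:
  assumes "invertible g"
  shows "covol (lattice_of_mat g) = \<bar>det g\<bar>"
  unfolding covol_def
proof (rule the_equality)
  show "\<exists>h. invertible h \<and> lattice_of_mat g = lattice_of_mat h \<and> \<bar>det g\<bar> = \<bar>det h\<bar>"
    using assms by blast
next
  fix c assume "\<exists>h. invertible h \<and> lattice_of_mat g = lattice_of_mat h \<and> c = \<bar>det h\<bar>"
  then obtain h where "lattice_of_mat g = lattice_of_mat h" "c = \<bar>det h\<bar>" by blast
  then show "c = \<bar>det g\<bar>" using lattice_eq_det[of g h] assms by simp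
qed

lemma unimodular_lattices_eq: "unimodular_lattices = lattice_of_mat ` SL2"
proof (intro equalityI subsetI)
  fix \<Lambda> assume "\<Lambda> \<in> unimodular_lattices"
  then obtain g where g: "invertible g" "\<Lambda> = lattice_of_mat g" "\<bar>det g\<bar> = 1"
    unfolding unimodular_lattices_def is_lattice_def using covol_lattice_of_mat by fastforce
  show "\<Lambda> \<in> lattice_of_mat ` SL2"
  proof (cases "det g = 1")
    case True
    then show ?thesis using g by (auto simp: SL2_def)
  next
    case False
    then have "det g = -1" using g(3) by linarith
    define J :: "real^2^2" where "J = (\<chi> i j. if i = j then (if i = 1 then -1 else 1) else 0)"
    have Jv: "(J *v x) $ i = (if i = 1 then - x $ 1 else x $ i)" for x i
      using exhaust_2[of i] by (auto simp: J_def matrix_vector_mult_def UNIV_2)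
    have JJ: "J *v (J *v x) = x" for x
      unfolding vec_eq_iff using Jv by simp
    have Jint: "\<forall>i. (J *v x) $ i \<in> \<int>" if "\<forall>i. x $ i \<in> \<int>" for x
      using that Jv by simp
    have "det J = -1" by (simp add: J_def det_2)
    then have "det (g ** J) = 1" using \<open>det g = -1\<close> by (simp add: det_mul)
    moreover have "lattice_of_mat (g ** J) = \<Lambda>"
    proof (intro equalityI subsetI)
      fix v assume "v \<in> lattice_of_mat (g ** J)"
      then obtain x where "v = g *v (J *v x)" "\<forall>i. x $ i \<in> \<int>"
        unfolding lattice_of_mat_def by (auto simp: matrix_vector_mul_assoc)
      then show "v \<in> \<Lambda>" unfolding g(2) lattice_of_mat_def using Jint by blast
    next
      fix v assume "v \<in> \<Lambda>"
      then obtain x where "v = g *v x" "\<forall>i. x $ i \<in> \<int>"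
        unfolding g(2) lattice_of_mat_def by auto
      then have "v = (g ** J) *v (J *v x)" "\<forall>i. (J *v x) $ i \<in> \<int>"
        using JJ Jint by (auto simp flip: matrix_vector_mul_assoc)
      then show "v \<in> lattice_of_mat (g ** J)" unfolding lattice_of_mat_def by blast
    qed
    ultimately show ?thesis by (auto simp: SL2_def)
  qed
next
  fix \<Lambda> assume "\<Lambda> \<in> lattice_of_mat ` SL2"
  then obtain g where g: "det g = 1" "\<Lambda> = lattice_of_mat g"
    by (auto simp: SL2_def)
  then have "invertible g" by (simp add: invertible_det_nz)
  then show "\<Lambda> \<in> unimodular_lattices"
    unfolding unimodular_lattices_def is_lattice_def using g covol_lattice_of_mat by auto
qed

lemma openin_X2:
  "openin X2 U \<longleftrightarrow> U \<subseteq> unimodular_lattices \<and>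
     openin (top_of_set SL2) {g \<in> SL2. lattice_of_mat g \<in> U}" (is "_ \<longleftrightarrow> ?P U")
proof -
  have "istopology ?P"
    unfolding istopology_def
  proof (intro conjI allI impI)
    fix S T assume "?P S" "?P T"
    moreover have "{g \<in> SL2. lattice_of_mat g \<in> S \<inter> T} =
        {g \<in> SL2. lattice_of_mat g \<in> S} \<inter> {g \<in> SL2. lattice_of_mat g \<in> T}" by blast
    ultimately show "S \<inter> T \<subseteq> unimodular_lattices"
      "openin (top_of_set SL2) {g \<in> SL2. lattice_of_mat g \<in> S \<inter> T}"
      by (auto intro: openin_Int)
  next
    fix \<K> assume K: "\<forall>S\<in>\<K>. ?P S"
    then show "\<Union>\<K> \<subseteq> unimodular_lattices" by blast
    have "{g \<in> SL2. lattice_of_mat g \<in> \<Union>\<K>} = (\<Union>S\<in>\<K>. {g \<in> SL2. lattice_of_mat g \<in> S})" by blast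
    then show "openin (top_of_set SL2) {g \<in> SL2. lattice_of_mat g \<in> \<Union>\<K>}"
      using K by (auto intro: openin_Union)
  qed
  then show ?thesis unfolding X2_def by (simp add: topology_inverse')
qed

lemma topspace_X2: "topspace X2 = unimodular_lattices"
proof -
  have "{g \<in> SL2. lattice_of_mat g \<in> unimodular_lattices} = SL2"
    unfolding unimodular_lattices_eq by blast
  then have "openin X2 unimodular_lattices"
    unfolding openin_X2 by simp
  then show ?thesis
    by (meson openin_X2 openin_subset openin_topspace subset_antisym)
qed

lemma quotient_map_X2: "quotient_map (top_of_set SL2) X2 lattice_of_mat"
  unfolding quotient_map_def topspace_X2 openin_X2
  by (auto simp: unimodular_lattices_eq)

section \<open>The space \<open>Y\<^sub>1\<close>, periodic orbits and the deformation\<close>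

definition one_bar :: "nat \<Rightarrow> real^2" where
  "one_bar s = (if s = 0 then vector [1, 1] else vector [1, 0])"

definition ell :: "nat \<Rightarrow> (real^2) set" where
  "ell s = span {one_bar s}"

definition V0 :: "nat \<Rightarrow> (real^2) set" where
  "V0 s = (ell s)\<^sup>\<bottom>"

definition Y1 :: "nat \<Rightarrow> (real^2) set set" where
  "Y1 s = {\<Lambda> \<in> topspace X2. \<exists>v. norm v = 1 \<and> \<Lambda> \<inter> ell s = {of_int k *\<^sub>R v | k :: int. True}}"

text \<open>Borel probability measures on an orbit \<open>P\<close> are regarded as Borel measures on \<open>X\<^sub>2\<close>
  concentrated on \<open>P\<close>.\<close>

definition invariant_prob_on :: "(real^2^2) set \<Rightarrow> (real^2) set set \<Rightarrow> (real^2) set measure \<Rightarrow> bool" where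
  "invariant_prob_on H P \<mu> \<longleftrightarrow> sets \<mu> = sets borel_X2 \<and> prob_space \<mu> \<and> (AE \<Lambda> in \<mu>. \<Lambda> \<in> P) \<and>
     (\<forall>h\<in>H. distr \<mu> borel_X2 (act h) = \<mu>)"

definition closed_subgroup_SL2 :: "(real^2^2) set \<Rightarrow> bool" where
  "closed_subgroup_SL2 H \<longleftrightarrow> H \<subseteq> SL2 \<and> closedin (top_of_set SL2) H \<and> mat 1 \<in> H \<and>
     (\<forall>g\<in>H. \<forall>h\<in>H. g ** h \<in> H) \<and> (\<forall>g\<in>H. matrix_inv g \<in> H)"

definition periodic_orbit :: "(real^2) set set \<Rightarrow> bool" where
  "periodic_orbit P \<longleftrightarrow> (\<exists>H. closed_subgroup_SL2 H \<and> (\<exists>\<Lambda> \<in> topspace X2. P = (\<lambda>h. act h \<Lambda>) ` H) \<and>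
     (\<exists>\<mu>. invariant_prob_on H P \<mu>))"

definition m_Y1 :: "nat \<Rightarrow> (real^2) set measure" where
  "m_Y1 s = (THE \<mu>. invariant_prob_on {g \<in> SL2. \<forall>v \<in> ell s. g *v v = v} (Y1 s) \<mu>)"

definition deform :: "nat \<Rightarrow> (real^2) set \<Rightarrow> real \<Rightarrow> real^2^2" where
  "deform s E t = (THE g. (\<forall>v\<in>E. g *v v = exp t *\<^sub>R v) \<and> (\<forall>v\<in>ell s. g *v v = exp (- t) *\<^sub>R v))"

definition q_E ::
  "nat \<Rightarrow> (complex set \<Rightarrow> (complex \<Rightarrow> complex) \<times> (complex \<Rightarrow> complex)) \<Rightarrow> (real^2) set \<Rightarrow>
     complex set \<Rightarrow> (real^2) set" where
  "q_E s em E K = (let \<Lambda> = normalize_lattice (field_lattice s em K) in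
     act (deform s E (THE t. act (deform s E t) \<Lambda> \<in> Y1 s)) \<Lambda>)"

section \<open>Combinations of measures and weak convergence\<close>

definition sum_measure :: "'a measure \<Rightarrow> 'i set \<Rightarrow> ('i \<Rightarrow> 'a measure) \<Rightarrow> 'a measure" where
  "sum_measure M I \<mu> = measure_of (space M) (sets M) (\<lambda>A. \<Sum>i\<in>I. emeasure (\<mu> i) A)"

definition add_measure :: "'a measure \<Rightarrow> 'a measure \<Rightarrow> 'a measure" where
  "add_measure \<mu> \<nu> = measure_of (space \<mu>) (sets \<mu>) (\<lambda>A. emeasure \<mu> A + emeasure \<nu> A)"

lemma emeasure_sum_measure:
  assumes "\<And>i. i \<in> I \<Longrightarrow> sets (\<mu> i) = sets M" "A \<in> sets M"
  shows "emeasure (sum_measure M I \<mu>) A = (\<Sum>i\<in>I. emeasure (\<mu> i) A)"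
  unfolding sum_measure_def
proof (rule emeasure_measure_of_sigma[OF sets.sigma_algebra_axioms _ _ assms(2)])
  show "positive (sets M) (\<lambda>A. \<Sum>i\<in>I. emeasure (\<mu> i) A)"
    by (simp add: positive_def)
  show "countably_additive (sets M) (\<lambda>A. \<Sum>i\<in>I. emeasure (\<mu> i) A)"
  proof (rule countably_additiveI)
    fix B :: "nat \<Rightarrow> _" assume "range B \<subseteq> sets M" "disjoint_family B"
    then have "(\<Sum>n. emeasure (\<mu> i) (B n)) = emeasure (\<mu> i) (\<Union> (range B))" if "i \<in> I" for i
      using assms(1)[OF that] by (intro suminf_emeasure) auto
    then show "(\<Sum>n. \<Sum>i\<in>I. emeasure (\<mu> i) (B n)) = (\<Sum>i\<in>I. emeasure (\<mu> i) (\<Union> (range B)))"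
      by (subst suminf_sum) auto
  qed
qed

lemma emeasure_add_measure:
  assumes "sets \<nu> = sets \<mu>" "A \<in> sets \<mu>"
  shows "emeasure (add_measure \<mu> \<nu>) A = emeasure \<mu> A + emeasure \<nu> A"
  unfolding add_measure_def
proof (rule emeasure_measure_of_sigma[OF sets.sigma_algebra_axioms _ _ assms(2)])
  show "positive (sets \<mu>) (\<lambda>A. emeasure \<mu> A + emeasure \<nu> A)"
    by (simp add: positive_def)
  show "countably_additive (sets \<mu>) (\<lambda>A. emeasure \<mu> A + emeasure \<nu> A)"
  proof (rule countably_additiveI)
    fix B :: "nat \<Rightarrow> _" assume B: "range B \<subseteq> sets \<mu>" "disjoint_family B"
    then have "(\<Sum>n. emeasure \<mu> (B n)) = emeasure \<mu> (\<Union> (range B))"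
      "(\<Sum>n. emeasure \<nu> (B n)) = emeasure \<nu> (\<Union> (range B))"
      using assms(1) by (auto intro!: suminf_emeasure)
    then show "(\<Sum>n. emeasure \<mu> (B n) + emeasure \<nu> (B n)) = emeasure \<mu> (\<Union> (range B)) + emeasure \<nu> (\<Union> (range B))"
      by (subst suminf_add[symmetric]) auto
  qed
qed

definition weakly_converges :: "'a topology \<Rightarrow> ('b \<Rightarrow> 'a measure) \<Rightarrow> 'a measure \<Rightarrow> 'b filter \<Rightarrow> bool" where
  "weakly_converges X \<mu> \<nu> F \<longleftrightarrow> (\<forall>f. continuous_map X euclideanreal f \<longrightarrow>
     compactin X (X closure_of {x \<in> topspace X. f x \<noteq> 0}) \<longrightarrow>
     ((\<lambda>T. integral\<^sup>L (\<mu> T) f) \<longlongrightarrow> integral\<^sup>L \<nu> f) F)"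

definition q_average ::
  "nat \<Rightarrow> (complex set set \<Rightarrow> complex set) \<Rightarrow>
   (complex set \<Rightarrow> (complex \<Rightarrow> complex) \<times> (complex \<Rightarrow> complex)) \<Rightarrow> (real^2) set \<Rightarrow> real \<Rightarrow> (real^2) set measure" where
  "q_average s rep em E T = scale_measure (ennreal (1 / card (F2 s T)))
     (sum_measure borel_X2 (F2 s T) (\<lambda>C. return borel_X2 (q_E s em E (rep C))))"

end

theory Submission
  imports Defs "HOL-Computational_Algebra.Squarefree" "HOL-Real_Asymp.Real_Asymp"
begin

text \<open>Every quadratic field inside \<open>\<complex>\<close> is \<open>\<rat>(\<surd>d)\<close> for a squarefree \<open>d \<noteq> 1\<close>, and isomorphic ones are
  equal, so the averages are averages over such \<open>d\<close>.  Use the unit vector on the line and the unit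
  vector orthogonal to it as coordinates.  In both signatures the lattice of the field of discriminant
  \<open>D\<close> is, up to a scalar, spanned by \<open>(1, 0)\<close> and \<open>(b, h)\<close>, where \<open>h = \<surd>\<bar>D\<bar> / 2\<close> and \<open>b\<close> is
  \<open>1/2\<close> or \<open>0\<close> according as \<open>D\<close> is odd or even (\<open>field_lattice_qfield\<close>).

  In the same coordinates \<open>Y\<^sub>1\<close> is the circle of the lattices \<open>L(x)\<close> spanned by \<open>(1, 0)\<close> and
  \<open>(x, 1)\<close>, with \<open>x\<close> modulo \<open>1\<close> (\<open>Y1_eq\<close>), and its invariant measure is Lebesgue measure in \<open>x\<close>
  (\<open>m_Y1_eq\<close>).  A line \<open>E\<close> other than the given one is spanned by a vector \<open>(c, 1)\<close>, with \<open>c = 0\<close>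
  exactly for the orthogonal complement.  The deformation along \<open>E\<close> takes the normalized lattice
  to \<open>L(b + c - c h)\<close> (\<open>q_E_eq\<close>).

  If \<open>c = 0\<close>, this is \<open>L(0)\<close> or \<open>L(1/2)\<close> according to the parity of \<open>D\<close>, and what has to be known is
  that odd and even discriminants occur with positive limiting frequencies.  If \<open>c \<noteq> 0\<close>, the
  numbers \<open>c \<surd>\<bar>D\<bar> / 2\<close> have to be equidistributed modulo \<open>1\<close> along the discriminants of either
  parity.  Both follow from \<open>sqrt_squarefree_equidistributed\<close>: for continuous \<open>F\<close> of period \<open>1\<close> and
  \<open>\<alpha> \<noteq> 0\<close>, the sum of \<open>F (\<alpha> \<surd>n)\<close> over the squarefree \<open>n < N\<close> in a nonzero class modulo \<open>4\<close> is
  asymptotic to \<open>\<delta> N \<integral>F\<close> with some \<open>\<delta> > 0\<close>.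

  For all \<open>n\<close> in a residue class this holds because \<open>\<surd>n\<close> varies slowly: the sum is compared with a
  telescoping sum built from a periodic primitive (\<open>sqrt_equidistributed\<close>).  Squarefree numbers
  are sieved: the numbers without a square divisor \<open>m\<^sup>2\<close>, \<open>2 \<le> m \<le> M\<close>, form a periodic set, and at most
  \<open>N / M\<close> further numbers below \<open>N\<close> are removed (\<open>squarefree_sieve_error\<close>), uniformly in \<open>N\<close>.  The
  density is positive because squares of odd \<open>m \<ge> 3\<close> remove at most a quarter of each class
  (\<open>squarefree_residue_class_count\<close>).\<close>

section \<open>Quadratic subfields of the complex numbers\<close>

definition rt :: "int \<Rightarrow> complex" where
  "rt d = csqrt (of_int d)"

definition qfield :: "int \<Rightarrow> complex set" where
  "qfield d = {of_rat a + of_rat b * rt d | a b. True}"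

text \<open>These integers, of either sign, parametrize the quadratic fields; \<open>0\<close> is not squarefree.\<close>

definition radicand :: "int \<Rightarrow> bool" where
  "radicand d \<longleftrightarrow> squarefree d \<and> d \<noteq> 1"

lemma rt_square: "rt d * rt d = of_int d"
  unfolding rt_def by (metis power2_csqrt power2_eq_square)

lemma radicand_nonzero: "radicand d \<Longrightarrow> d \<noteq> 0"
  unfolding radicand_def by auto

lemma rt_irrational:
  assumes "radicand d"
  shows "rt d \<notin> \<rat>"
proof
  assume "rt d \<in> \<rat>"
  moreover have "algebraic_int (rt d)" unfolding rt_def by auto
  ultimately have "rt d \<in> \<int>" by (rule rational_algebraic_int_is_int[rotated])
  then obtain k where k: "rt d = of_int k" by (elim Ints_cases)
  then have "of_int (k * k) = (of_int d :: complex)" using rt_square[of d] by simp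
  then have kd: "k * k = d" by (simp only: of_int_eq_iff)
  then have "is_unit k" using assms unfolding radicand_def squarefree_def power2_eq_square by auto
  then have "k * k = 1" by (metis zdvd1_eq abs_mult_self_eq mult_1)
  then show False using kd assms unfolding radicand_def by simp
qed

lemma qfield_coords_unique:
  assumes "radicand d" "of_rat a + of_rat b * rt d = of_rat a' + of_rat b' * rt d"
  shows "a = a'" "b = b'"
proof -
  have e: "of_rat (b - b') * rt d = of_rat (a' - a)"
    using assms(2) by (simp add: of_rat_diff algebra_simps)
  show "b = b'"
  proof (rule ccontr)
    assume "b \<noteq> b'"
    then have "rt d = of_rat ((a' - a) / (b - b'))"
      using e by (simp add: of_rat_divide field_simps)
    then show False using rt_irrational[OF assms(1)] by simp
  qed
  then show "a = a'" using assms(2) by simp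
qed

lemma qfieldI: "of_rat a + of_rat b * rt d \<in> qfield d"
  unfolding qfield_def by blast

lemma qfieldE:
  assumes "x \<in> qfield d"
  obtains a b where "x = of_rat a + of_rat b * rt d"
  using assms unfolding qfield_def by blast

lemma qfield_mult:
  "(of_rat a + of_rat b * rt d) * (of_rat a' + of_rat b' * rt d) =
   of_rat (a * a' + of_int d * (b * b')) + of_rat (a * b' + b * a') * rt d"
proof -
  have "(A + B * s) * (A' + B' * s) = A * A' + (s * s) * (B * B') + (A * B' + B * A') * s"
    for A B A' B' s :: complex
    by (simp add: algebra_simps)
  from this[of _ _ "rt d"] show ?thesis
    by (simp only: rt_square of_rat_mult of_rat_add of_rat_of_int_eq)
qed

lemma is_subfield_qfield:
  assumes "radicand d"
  shows "is_subfield (qfield d)"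
  unfolding is_subfield_def
proof (intro conjI ballI)
  show "1 \<in> qfield d" using qfieldI[of 1 0 d] by simp
next
  fix x y assume "x \<in> qfield d" "y \<in> qfield d"
  then obtain a b a' b' where x: "x = of_rat a + of_rat b * rt d" "y = of_rat a' + of_rat b' * rt d"
    by (meson qfieldE)
  have "x - y = of_rat (a - a') + of_rat (b - b') * rt d"
    unfolding x by (simp add: of_rat_diff algebra_simps)
  then show "x - y \<in> qfield d" by (simp only: qfieldI)
  show "x * y \<in> qfield d" unfolding x qfield_mult by (rule qfieldI)
next
  fix x assume "x \<in> qfield d"
  then obtain a b where x: "x = of_rat a + of_rat b * rt d" by (meson qfieldE)
  show "inverse x \<in> qfield d"
  proof (cases "x = 0")
    case True
    then show ?thesis using qfieldI[of 0 0 d] by simp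
  next
    case False
    define n where "n = a * a - of_int d * (b * b)"
    \<comment> \<open>The conjugate, nonzero because \<open>rt d\<close> is irrational.\<close>
    define y where "y = of_rat a + of_rat (-b) * rt d"
    have xy: "x * y = of_rat n"
      unfolding x y_def qfield_mult n_def by (simp add: of_rat_mult of_rat_diff)
    have "y \<noteq> 0"
    proof
      assume "y = 0"
      then have "a = 0 \<and> -b = 0"
        using qfield_coords_unique[OF assms, of a "-b" 0 0] unfolding y_def by simp
      then show False using False unfolding x by simp
    qed
    then have "n \<noteq> 0" using xy False by auto
    then have "x * (of_rat (a / n) + of_rat (- b / n) * rt d) = 1"
      using xy unfolding y_def by (simp add: of_rat_divide of_rat_minus field_simps)
    then have "inverse x = of_rat (a / n) + of_rat (- b / n) * rt d"
      by (rule inverse_unique)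
    then show ?thesis by (simp only: qfieldI)
  qed
qed

lemma span_one_rt: "rat_cplx.span {1, rt d} = qfield d"
proof (intro equalityI subsetI)
  fix x assume "x \<in> rat_cplx.span {1, rt d}"
  then obtain a where "x - of_rat a * 1 \<in> rat_cplx.span {rt d}"
    unfolding rat_cplx.span_insert by blast
  then obtain b where "x - of_rat a * 1 = of_rat b * rt d"
    unfolding rat_cplx.span_singleton by blast
  then have "x = of_rat a + of_rat b * rt d" by (metis add.commute diff_add_cancel mult_1_right)
  then show "x \<in> qfield d" by (simp only: qfieldI)
next
  fix x assume "x \<in> qfield d"
  then obtain a b where "x = of_rat a + of_rat b * rt d" by (rule qfieldE)
  moreover have "of_rat a * 1 + of_rat b * rt d \<in> rat_cplx.span {1, rt d}"
    by (intro rat_cplx.span_add rat_cplx.span_scale rat_cplx.span_base) auto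
  ultimately show "x \<in> rat_cplx.span {1, rt d}" by simp
qed

lemma independent_one_rt:
  assumes "rt d \<notin> \<rat>"
  shows "rat_cplx.independent {1, rt d}" "1 \<noteq> rt d"
proof -
  show ne: "1 \<noteq> rt d" using assms by (metis Rats_1)
  have "rt d \<notin> rat_cplx.span {1}"
    using assms by (auto simp: rat_cplx.span_singleton)
  moreover have "rat_cplx.independent {1}" by (simp add: rat_cplx.dependent_single)
  ultimately have "rat_cplx.independent (insert (rt d) {1})"
    by (simp add: rat_cplx.independent_insert)
  then show "rat_cplx.independent {1, rt d}" by (simp add: insert_commute)
qed

lemma quadratic_qfield:
  assumes "radicand d"
  shows "quadratic_field (qfield d)"
proof -
  have i: "rat_cplx.independent {1, rt d}" "1 \<noteq> rt d"
    using independent_one_rt rt_irrational[OF assms] by blast+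
  have "rat_cplx.dim (qfield d) = card {1, rt d}"
    unfolding span_one_rt[symmetric] by (rule rat_cplx.dim_span_eq_card_independent[OF i(1)])
  then show ?thesis
    unfolding quadratic_field_def using is_subfield_qfield[OF assms] i(2) by simp
qed

lemma subfield_closed:
  assumes "is_subfield K"
  shows "x \<in> K \<Longrightarrow> y \<in> K \<Longrightarrow> x + y \<in> K" "x \<in> K \<Longrightarrow> y \<in> K \<Longrightarrow> x * y \<in> K"
    "x \<in> K \<Longrightarrow> y \<in> K \<Longrightarrow> x - y \<in> K" "of_rat q \<in> K"
proof -
  have one: "1 \<in> K" and diff: "\<And>x y. x \<in> K \<Longrightarrow> y \<in> K \<Longrightarrow> x - y \<in> K"
    and mult: "\<And>x y. x \<in> K \<Longrightarrow> y \<in> K \<Longrightarrow> x * y \<in> K"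
    and inv: "\<And>x. x \<in> K \<Longrightarrow> inverse x \<in> K"
    using assms unfolding is_subfield_def by blast+
  have zero: "0 \<in> K" using diff[OF one one] by simp
  have add: "x + y \<in> K" if "x \<in> K" "y \<in> K" for x y
    using diff[OF that(1) diff[OF zero that(2)]] by simp
  have nat: "of_nat n \<in> K" for n
    by (induction n) (simp_all add: zero add one)
  have int: "of_int n \<in> K" for n
  proof (cases n rule: int_cases2)
    case (nonneg m)
    then show ?thesis by (simp add: nat)
  next
    case (nonpos m)
    then show ?thesis using diff[OF zero nat[of m]] by simp
  qed
  show "x \<in> K \<Longrightarrow> y \<in> K \<Longrightarrow> x + y \<in> K" "x \<in> K \<Longrightarrow> y \<in> K \<Longrightarrow> x * y \<in> K"
    "x \<in> K \<Longrightarrow> y \<in> K \<Longrightarrow> x - y \<in> K"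
    using add mult diff by blast+
  obtain a b where "q = of_int a / of_int b"
    by (metis quotient_of_div surj_pair)
  then have "of_rat q = of_int a * inverse (of_int b :: complex)"
    by (simp add: of_rat_divide flip: divide_inverse)
  then show "of_rat q \<in> K" using mult[OF int inv[OF int]] by simp
qed

text \<open>Completing the square in a generator and clearing denominators makes its square an integer;
  dividing by the square part leaves a squarefree one.\<close>

lemma quadratic_field_cases:
  assumes "quadratic_field K"
  obtains d where "radicand d" "K = qfield d"
proof -
  have sub: "is_subfield K" and dim: "rat_cplx.dim K = 2"
    using assms unfolding quadratic_field_def by auto
  have "{1} \<subseteq> K" using sub unfolding is_subfield_def by simp
  moreover have "rat_cplx.independent {1}" by (simp add: rat_cplx.dependent_single)
  ultimately obtain B where B: "{1} \<subseteq> B" "B \<subseteq> K" "rat_cplx.independent B" "K \<subseteq> rat_cplx.span B"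
    by (rule rat_cplx.maximal_independent_subset_extend)
  have "card B = 2" using rat_cplx.basis_card_eq_dim[OF B(2,4,3)] dim by simp
  then obtain x where x: "B = {1, x}" "x \<noteq> 1"
    using B(1) by (metis card_2_iff insert_commute insert_subset singletonD insertE empty_iff)
  have xK: "x \<in> K" using B(2) x by simp
  have Kx: "\<exists>p q. y = of_rat p + of_rat q * x" if "y \<in> K" for y
  proof -
    have "y \<in> rat_cplx.span (insert x {1})" using B(4) that x by (auto simp: insert_commute)
    then obtain q where "y - of_rat q * x \<in> rat_cplx.span {1}"
      unfolding rat_cplx.span_insert by blast
    then obtain p where "y - of_rat q * x = of_rat p" by (auto simp: rat_cplx.span_singleton)
    then show ?thesis by (metis diff_add_cancel add.commute)
  qed
  have xirr: "x \<notin> \<rat>"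
  proof
    assume "x \<in> \<rat>"
    then have "x \<in> rat_cplx.span {1}" by (auto simp: rat_cplx.span_singleton elim!: Rats_cases)
    moreover have "x \<notin> {1}" using x by simp
    moreover have "rat_cplx.independent (insert x {1})" using B(3) x by (simp add: insert_commute)
    ultimately show False by (metis rat_cplx.independent_insert)
  qed
  obtain p q where pq: "x * x = of_rat p + of_rat q * x"
    using Kx[OF subfield_closed(2)[OF sub xK xK]] by blast
  define r where "r = p + q * q / 4"
  obtain m n where mn: "r = of_int m / of_int n" "n > 0"
    by (metis quotient_of_div quotient_of_denom_pos surj_pair)
  define y where "y = of_int n * (x - of_rat (q / 2))"
  have "(x - of_rat (q / 2)) * (x - of_rat (q / 2)) = x * x - of_rat q * x + of_rat (q * q / 4)"
    by (simp add: of_rat_divide of_rat_mult algebra_simps)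
  then have "(x - of_rat (q / 2)) * (x - of_rat (q / 2)) = of_rat r"
    unfolding pq r_def by (simp add: of_rat_add)
  then have sq: "(x - of_rat (q / 2)) * (x - of_rat (q / 2)) = of_int m / of_int n"
    unfolding mn(1) by (simp add: of_rat_divide)
  have "y * y = of_int n * of_int n * ((x - of_rat (q / 2)) * (x - of_rat (q / 2)))"
    unfolding y_def by (simp only: mult_ac)
  then have "y * y = of_int n * of_int n * (of_int m / of_int n)"
    unfolding sq .
  then have yy: "y * y = of_int (m * n)"
    using mn(2) by simp
  have yirr: "y \<notin> \<rat>"
  proof
    assume "y \<in> \<rat>"
    moreover have "x = y / of_int n + of_rat (q / 2)"
      unfolding y_def using mn(2) by simp
    ultimately show False using xirr by simp
  qed
  define e where "e = m * n"
  have e0: "e \<noteq> 0" using yy yirr unfolding e_def by auto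
  define d where "d = squarefree_part e"
  define k where "k = square_part e"
  have ed: "e = d * (k * k)" unfolding d_def k_def by (metis squarefree_decompose power2_eq_square)
  then have k0: "k \<noteq> 0" using e0 by auto
  define z where "z = y / of_int k"
  have "z * z = of_int d"
    using yy k0 unfolding z_def e_def[symmetric] ed by simp
  then have "z * z = rt d * rt d" by (simp only: rt_square)
  then have zrt: "z = rt d \<or> z = - rt d" by (simp add: square_eq_iff)
  have zirr: "z \<notin> \<rat>"
  proof
    assume "z \<in> \<rat>"
    moreover have "y = z * of_int k" unfolding z_def using k0 by simp
    ultimately show False using yirr by simp
  qed
  have "rt 1 = 1" by (simp add: rt_def)
  then have "d \<noteq> 1" using zrt zirr by auto
  then have rad: "radicand d" unfolding radicand_def d_def using squarefree_squarefree_part e0 by auto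
  have xz: "x = of_rat (q / 2) + of_rat (of_int k / of_int n) * z"
    unfolding z_def y_def using mn(2) k0 by (simp add: of_rat_divide)
  then have "x = of_rat (q / 2) + of_rat (of_int k / of_int n) * rt d \<or>
      x = of_rat (q / 2) + of_rat (- of_int k / of_int n) * rt d"
    using zrt by (auto simp: of_rat_minus)
  then obtain q' k' where xrt: "x = of_rat q' + of_rat k' * rt d" by blast
  have "z \<in> K"
  proof -
    have "z = of_rat (of_int n / of_int k) * (x - of_rat (q / 2))"
      unfolding z_def y_def by (simp add: of_rat_divide)
    then show ?thesis using subfield_closed[OF sub] xK by simp
  qed
  then have rtK: "rt d \<in> K"
    using zrt subfield_closed(2)[OF sub subfield_closed(4)[OF sub, of "-1"], of z] by auto
  have "K = qfield d"
  proof (intro equalityI subsetI)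
    fix v assume "v \<in> K"
    then obtain p q where "v = of_rat p + of_rat q * x" using Kx by blast
    then have "v = of_rat (p + q * q') + of_rat (q * k') * rt d"
      unfolding xrt by (simp only: of_rat_add of_rat_mult distrib_left mult.assoc add.assoc)
    then show "v \<in> qfield d" by (simp only: qfieldI)
  next
    fix v assume "v \<in> qfield d"
    then obtain a b where "v = of_rat a + of_rat b * rt d" by (rule qfieldE)
    then show "v \<in> K" using subfield_closed[OF sub] rtK by simp
  qed
  then show ?thesis using that rad by blast
qed

text \<open>The fraction \<open>b\<close> in lowest terms has unit numerator and denominator: the square of either one
  divides a squarefree integer.\<close>

lemma squarefree_ratio_square:
  fixes d e :: int and b :: rat
  assumes "squarefree d" "squarefree e" "of_int d = b * b * of_int e"
  shows "d = e"
proof -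
  obtain p q where pq: "b = of_int p / of_int q" "q > 0" "coprime p q"
    by (metis quotient_of_coprime quotient_of_denom_pos quotient_of_div surj_pair)
  have "rat_of_int (d * (q * q)) = of_int (p * p * e)"
    using assms(3) pq by (simp add: field_simps)
  then have e: "d * (q * q) = p * p * e" by (simp only: of_int_eq_iff)
  have cop: "coprime (p * p) (q * q)" using pq(3) by simp
  have "q * q dvd p * p * e" unfolding e[symmetric] by simp
  then have "q * q dvd e" using cop by (simp add: coprime_commute coprime_dvd_mult_right_iff)
  then have "is_unit q" using assms(2) unfolding squarefree_def power2_eq_square by blast
  moreover have "p * p dvd d * (q * q)" unfolding e by simp
  then have "p * p dvd d" using cop by (simp add: coprime_dvd_mult_left_iff)
  then have "is_unit p" using assms(1) unfolding squarefree_def power2_eq_square by blast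
  ultimately have "q * q = 1" "p * p = 1" by (metis zdvd1_eq abs_mult_self_eq mult_1)+
  then show ?thesis using e by simp
qed

text \<open>Squaring \<open>\<surd>d = a + b \<surd>e\<close> leaves no \<open>\<surd>e\<close>-term on the left, so \<open>a b = 0\<close>; as \<open>\<surd>d\<close> is irrational,
  \<open>a = 0\<close> and \<open>d / e\<close> is the square of \<open>b\<close>.\<close>

lemma radicand_eqI:
  assumes "radicand d" "radicand e" "rt d \<in> qfield e"
  shows "d = e"
proof -
  obtain a b where ab: "rt d = of_rat a + of_rat b * rt e" using assms(3) by (rule qfieldE)
  have "of_rat (of_int d) = (of_rat a + of_rat b * rt e) * (of_rat a + of_rat b * rt e)"
    using rt_square[of d] unfolding ab by simp
  then have "of_rat (of_int d) + of_rat 0 * rt e =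
      of_rat (a * a + of_int e * (b * b)) + of_rat (a * b + b * a) * rt e"
    unfolding qfield_mult by simp
  then have "of_int d = a * a + of_int e * (b * b)" "0 = a * b + b * a"
    using qfield_coords_unique[OF assms(2)] by blast+
  moreover have "b \<noteq> 0" using ab rt_irrational[OF assms(1)] by auto
  ultimately have "of_int d = b * b * of_int e" by (auto simp: mult.commute)
  then show ?thesis using squarefree_ratio_square assms unfolding radicand_def by blast
qed

lemma field_hom_of_rat:
  assumes "is_subfield K" "field_hom K \<sigma>"
  shows "\<sigma> (of_rat q) = of_rat q"
proof -
  have add: "\<sigma> (x + y) = \<sigma> x + \<sigma> y" and mult: "\<sigma> (x * y) = \<sigma> x * \<sigma> y"
    if "x \<in> K" "y \<in> K" for x y
    using assms(2) that unfolding field_hom_def by blast+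
  have one: "\<sigma> 1 = 1" using assms(2) unfolding field_hom_def by blast
  note rat = subfield_closed(4)[OF assms(1)]
  have zero: "\<sigma> 0 = 0" using add[OF rat[of 0] rat[of 0]] by simp
  have nat: "\<sigma> (of_nat n) = of_nat n" for n
  proof (induction n)
    case (Suc n)
    have "\<sigma> (of_rat (of_nat n) + of_rat 1) = \<sigma> (of_rat (of_nat n)) + \<sigma> (of_rat 1)"
      by (rule add[OF rat rat])
    then show ?case using Suc one by (simp add: add.commute)
  qed (simp add: zero)
  have neg: "\<sigma> (- of_rat x) = - \<sigma> (of_rat x)" for x
    using add[OF rat[of x] rat[of "-x"]] zero by (simp add: of_rat_minus eq_neg_iff_add_eq_0 add.commute)
  have int: "\<sigma> (of_int n) = of_int n" for n
  proof (cases n rule: int_cases2)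
    case (nonneg m)
    then show ?thesis by (simp add: nat)
  next
    case (nonpos m)
    then show ?thesis using neg[of "of_nat m"] nat[of m] by simp
  qed
  obtain a b where ab: "q = of_int a / of_int b" "b > 0"
    by (metis quotient_of_div quotient_of_denom_pos surj_pair)
  have "\<sigma> (of_rat q * of_rat (of_int b)) = \<sigma> (of_rat q) * \<sigma> (of_rat (of_int b))"
    by (rule mult[OF rat rat])
  moreover have "of_rat q * of_rat (of_int b) = (of_int a :: complex)"
    using ab by (simp add: of_rat_divide)
  ultimately have "of_int a = \<sigma> (of_rat q) * of_int b" by (simp add: int)
  moreover have "(of_int b :: complex) \<noteq> 0" using ab by simp
  ultimately have "\<sigma> (of_rat q) = of_int a / of_int b" by (metis nonzero_mult_div_cancel_right)
  then show ?thesis using ab by (simp add: of_rat_divide)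
qed

text \<open>A homomorphism fixes the rationals and permutes the two roots of \<open>X\<^sup>2 - d\<close>.\<close>

lemma field_hom_qfield:
  assumes "radicand d" "field_hom (qfield d) \<sigma>"
  shows "\<exists>\<epsilon>\<in>{1, -1}. \<forall>a b. \<sigma> (of_rat a + of_rat b * rt d) = of_rat a + \<epsilon> * of_rat b * rt d"
proof -
  note sub = is_subfield_qfield[OF assms(1)]
  have rt: "rt d \<in> qfield d" using qfieldI[of 0 1 d] by simp
  have rat: "of_rat q \<in> qfield d" for q using subfield_closed(4)[OF sub] .
  have \<sigma>: "\<sigma> (x + y) = \<sigma> x + \<sigma> y" "\<sigma> (x * y) = \<sigma> x * \<sigma> y"
    if "x \<in> qfield d" "y \<in> qfield d" for x y
    using assms(2) that unfolding field_hom_def by blast+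
  have "\<sigma> (rt d) * \<sigma> (rt d) = \<sigma> (of_rat (of_int d))"
    using \<sigma>(2)[OF rt rt] rt_square[of d] by simp
  also have "\<dots> = rt d * rt d"
    unfolding field_hom_of_rat[OF sub assms(2)] by (simp add: rt_square)
  finally have "\<sigma> (rt d) = rt d \<or> \<sigma> (rt d) = - rt d" by (simp add: square_eq_iff)
  moreover have "\<sigma> (of_rat a + of_rat b * rt d) = of_rat a + of_rat b * \<sigma> (rt d)" for a b
    using \<sigma>(1)[OF rat subfield_closed(2)[OF sub rat rt]] \<sigma>(2)[OF rat rt]
      field_hom_of_rat[OF sub assms(2)] by simp
  ultimately show ?thesis by auto
qed

text \<open>Quadratic fields are normal over \<open>\<rat>\<close>, so isomorphic ones inside \<open>\<complex>\<close> are equal.\<close>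

lemma field_iso_eq:
  assumes "(K, L) \<in> field_iso"
  shows "K = L"
proof -
  obtain \<phi> where *: "quadratic_field K" "quadratic_field L" "field_hom K \<phi>" "bij_betw \<phi> K L"
    using assms unfolding field_iso_def by auto
  obtain d e where d: "radicand d" "K = qfield d" and e: "radicand e" "L = qfield e"
    using *(1,2) by (meson quadratic_field_cases)
  obtain \<epsilon> where \<epsilon>: "\<epsilon> \<in> {1, -1}"
      "\<And>a b. \<phi> (of_rat a + of_rat b * rt d) = of_rat a + \<epsilon> * of_rat b * rt d"
    using field_hom_qfield[OF d(1)] *(3) unfolding d(2) by blast
  have "rt d \<in> K" unfolding d(2) using qfieldI[of 0 1 d] by simp
  then have "\<phi> (rt d) \<in> L" using *(4) by (auto simp: bij_betw_def)
  moreover have "\<phi> (rt d) = \<epsilon> * rt d" using \<epsilon>(2)[of 0 1] by simp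
  ultimately have L: "\<epsilon> * rt d \<in> L" by simp
  have "of_rat (-1) * (\<epsilon> * rt d) \<in> L"
    using subfield_closed(2,4) *(2) L unfolding quadratic_field_def by blast
  then have "rt d \<in> L" using \<epsilon>(1) L by auto
  then show ?thesis using radicand_eqI[OF d(1) e(1)] d e by simp
qed

lemma field_iso_Image:
  assumes "quadratic_field K"
  shows "field_iso `` {K} = {K}"
proof -
  have "field_hom K (\<lambda>x. x)" "bij_betw (\<lambda>x. x) K K"
    by (simp_all add: field_hom_def bij_betw_def)
  then have "(K, K) \<in> field_iso" unfolding field_iso_def using assms by blast
  then show ?thesis using field_iso_eq by auto
qed


section \<open>Embeddings and signature\<close>

text \<open>The embedding sending \<open>\<surd>d\<close> to \<open>\<epsilon> \<surd>d\<close>, for \<open>\<epsilon> = 1\<close> or \<open>-1\<close>; the description operator reads off the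
  unique rational coordinates.\<close>

definition qemb :: "int \<Rightarrow> complex \<Rightarrow> complex \<Rightarrow> complex" where
  "qemb d \<epsilon> = (\<lambda>z\<in>qfield d. THE w. \<exists>a b. z = of_rat a + of_rat b * rt d \<and>
     w = of_rat a + \<epsilon> * of_rat b * rt d)"

lemma qemb_eq:
  assumes "radicand d"
  shows "qemb d \<epsilon> (of_rat a + of_rat b * rt d) = of_rat a + \<epsilon> * of_rat b * rt d"
proof -
  have "(THE w. \<exists>a' b'. of_rat a + of_rat b * rt d = of_rat a' + of_rat b' * rt d \<and>
     w = of_rat a' + \<epsilon> * of_rat b' * rt d) = of_rat a + \<epsilon> * of_rat b * rt d"
    by (rule the_equality) (use qfield_coords_unique[OF assms] in blast)+
  then show ?thesis unfolding qemb_def by (simp add: qfieldI)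
qed

lemma field_hom_qemb:
  assumes "radicand d" "\<epsilon> * \<epsilon> = 1"
  shows "field_hom (qfield d) (qemb d \<epsilon>)"
  unfolding field_hom_def
proof (intro conjI ballI)
  show "qemb d \<epsilon> 1 = 1" using qemb_eq[OF assms(1), of \<epsilon> 1 0] by simp
next
  fix x y assume "x \<in> qfield d" "y \<in> qfield d"
  then obtain a b a' b' where x: "x = of_rat a + of_rat b * rt d" "y = of_rat a' + of_rat b' * rt d"
    by (meson qfieldE)
  have sum: "x + y = of_rat (a + a') + of_rat (b + b') * rt d"
    unfolding x by (simp add: of_rat_add algebra_simps)
  show "qemb d \<epsilon> (x + y) = qemb d \<epsilon> x + qemb d \<epsilon> y"
    unfolding sum qemb_eq[OF assms(1)] unfolding x qemb_eq[OF assms(1)]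
    by (simp add: of_rat_add algebra_simps)
  have "(A + \<epsilon> * B * s) * (A' + \<epsilon> * B' * s) =
      A * A' + (\<epsilon> * \<epsilon>) * (s * s) * (B * B') + \<epsilon> * (A * B' + B * A') * s" for A B A' B' s :: complex
    by (simp add: algebra_simps)
  from this[of _ _ "rt d"] show "qemb d \<epsilon> (x * y) = qemb d \<epsilon> x * qemb d \<epsilon> y"
    unfolding x qfield_mult qemb_eq[OF assms(1)]
    by (simp only: rt_square assms(2) of_rat_mult of_rat_add of_rat_of_int_eq mult_1)
qed

lemma embeddings_qfield:
  assumes "radicand d"
  shows "embeddings (qfield d) = {qemb d 1, qemb d (-1)}" "qemb d 1 \<noteq> qemb d (-1)"
proof -
  have "qemb d \<epsilon> \<in> embeddings (qfield d)" if "\<epsilon> * \<epsilon> = 1" for \<epsilon>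
    using field_hom_qemb[OF assms that] unfolding embeddings_def by (simp add: qemb_def)
  moreover have "\<sigma> \<in> {qemb d 1, qemb d (-1)}" if "\<sigma> \<in> embeddings (qfield d)" for \<sigma>
  proof -
    have \<sigma>: "\<sigma> \<in> extensional (qfield d)" "field_hom (qfield d) \<sigma>"
      using that unfolding embeddings_def by auto
    obtain \<epsilon> where \<epsilon>: "\<epsilon> \<in> {1, -1}"
        "\<And>a b. \<sigma> (of_rat a + of_rat b * rt d) = of_rat a + \<epsilon> * of_rat b * rt d"
      using field_hom_qfield[OF assms \<sigma>(2)] by blast
    have "\<sigma> = qemb d \<epsilon>"
    proof (rule extensionalityI[OF \<sigma>(1)])
      show "qemb d \<epsilon> \<in> extensional (qfield d)" by (simp add: qemb_def)
      show "\<sigma> x = qemb d \<epsilon> x" if "x \<in> qfield d" for x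
        using that \<epsilon>(2) qemb_eq[OF assms] by (auto elim!: qfieldE)
    qed
    then show ?thesis using \<epsilon>(1) by auto
  qed
  ultimately show "embeddings (qfield d) = {qemb d 1, qemb d (-1)}"
    by (intro equalityI subsetI) auto
  have "qemb d 1 (rt d) = rt d" "qemb d (-1) (rt d) = - rt d"
    using qemb_eq[OF assms, of 1 0 1] qemb_eq[OF assms, of "-1" 0 1] by simp_all
  moreover have "rt d \<noteq> 0" using rt_irrational[OF assms] by auto
  ultimately show "qemb d 1 \<noteq> qemb d (-1)" by auto
qed

lemma rt_pos: "d > 0 \<Longrightarrow> rt d = of_real (sqrt (of_int d))"
  unfolding rt_def using csqrt_of_real_nonneg[of "of_int d"] by simp

lemma rt_neg: "d < 0 \<Longrightarrow> rt d = \<i> * of_real (sqrt (of_int \<bar>d\<bar>))"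
  unfolding rt_def using csqrt_of_real_nonpos[of "of_int d"] by simp

lemma signature_qfield:
  assumes "radicand d"
  shows "signature (qfield d) = (if d > 0 then (2, 0) else (0, 1))"
proof -
  have real: "qemb d \<epsilon> ` qfield d \<subseteq> \<real> \<longleftrightarrow> d > 0" if "\<epsilon> \<in> {1, -1}" for \<epsilon>
  proof
    assume "d > 0"
    have R: "(of_rat q :: complex) \<in> \<real>" for q by (cases q) (simp add: of_rat_rat)
    have "rt d \<in> \<real>" unfolding rt_pos[OF \<open>d > 0\<close>] by simp
    then have "of_rat a + \<epsilon> * of_rat b * rt d \<in> \<real>" for a b
      using that R by auto
    then show "qemb d \<epsilon> ` qfield d \<subseteq> \<real>"
      using qemb_eq[OF assms] by (auto elim!: qfieldE)
  next
    assume *: "qemb d \<epsilon> ` qfield d \<subseteq> \<real>"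
    have "rt d \<in> qfield d" using qfieldI[of 0 1 d] by simp
    then have "qemb d \<epsilon> (rt d) \<in> \<real>" using * by blast
    then have "\<epsilon> * rt d \<in> \<real>" using qemb_eq[OF assms, of \<epsilon> 0 1] by simp
    then have "rt d \<in> \<real>" using that by auto
    show "d > 0"
    proof (rule ccontr)
      assume "\<not> d > 0"
      then have "d < 0" using radicand_nonzero[OF assms] by simp
      then show False using \<open>rt d \<in> \<real>\<close> rt_neg[of d] by (simp add: complex_is_Real_iff)
    qed
  qed
  show ?thesis
  proof (cases "d > 0")
    case True
    then have "{\<sigma> \<in> embeddings (qfield d). \<sigma> ` qfield d \<subseteq> \<real>} = {qemb d 1, qemb d (-1)}"
      "{\<sigma> \<in> embeddings (qfield d). \<not> \<sigma> ` qfield d \<subseteq> \<real>} = {}"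
      using real embeddings_qfield[OF assms] by auto
    then show ?thesis using True embeddings_qfield(2)[OF assms] by (simp only: signature_def) simp
  next
    case False
    then have "{\<sigma> \<in> embeddings (qfield d). \<sigma> ` qfield d \<subseteq> \<real>} = {}"
      "{\<sigma> \<in> embeddings (qfield d). \<not> \<sigma> ` qfield d \<subseteq> \<real>} = {qemb d 1, qemb d (-1)}"
      using real embeddings_qfield[OF assms] by auto
    then show ?thesis using False embeddings_qfield(2)[OF assms] by (simp only: signature_def) simp
  qed
qed

section \<open>Rings of integers and discriminants\<close>

lemma map_poly_of_int_hom:
  fixes p q :: "int poly"
  shows "map_poly of_int (p + q) = (map_poly of_int p + map_poly of_int q :: 'a :: comm_ring_1 poly)"
    "map_poly of_int (p * q) = (map_poly of_int p * map_poly of_int q :: 'a :: comm_ring_1 poly)"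
    "map_poly of_int (smult c p) = (smult (of_int c) (map_poly of_int p) :: 'a :: comm_ring_1 poly)"
  by (simp_all add: poly_eq_iff coeff_map_poly coeff_mult)

text \<open>Gauss's lemma in the quadratic case.  Let \<open>g\<close> be the primitive integer multiple of the quadratic
  polynomial of \<open>x\<close>.  A monic integer polynomial \<open>p\<close> with root \<open>x\<close> leaves a linear remainder modulo
  \<open>g\<close> that vanishes at the irrational \<open>x\<close>, so \<open>g\<close> divides a multiple of \<open>p\<close>; comparing contents, \<open>g\<close>
  divides \<open>p\<close> itself, and its leading coefficient is a unit.\<close>

lemma algebraic_int_quadratic_integral:
  fixes x :: complex and t n :: rat
  assumes "algebraic_int x" "x \<notin> \<rat>" "x * x = of_rat t * x - of_rat n"
  shows "t \<in> \<int>" "n \<in> \<int>"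
proof -
  obtain t1 t2 where t: "t = of_int t1 / of_int t2" "t2 > 0"
    by (metis quotient_of_div quotient_of_denom_pos surj_pair)
  obtain n1 n2 where n: "n = of_int n1 / of_int n2" "n2 > 0"
    by (metis quotient_of_div quotient_of_denom_pos surj_pair)
  define g0 where "g0 = [:t2 * n1, - (t1 * n2), t2 * n2:]"
  define g where "g = primitive_part g0"
  define c where "c = content g0"
  have g0: "smult c g = g0" unfolding c_def g_def by simp
  have g0_nz: "g0 \<noteq> 0" unfolding g0_def using t n by simp
  then have c: "c \<noteq> 0" unfolding c_def by simp
  have cg: "content g = 1" unfolding g_def using g0_nz by simp
  have deg: "degree g = 2"
    using arg_cong[OF g0, of degree] c t n by (simp add: g0_def)
  have "poly (map_poly of_int g0) x = of_int (t2 * n2) * (x * x - of_rat t * x + of_rat n)"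
    unfolding g0_def t n using t n
    by (simp add: map_poly_pCons of_rat_divide field_simps)
  then have "poly (map_poly of_int (smult c g)) x = 0"
    unfolding g0 using assms(3) by simp
  then have gx: "poly (map_poly of_int g) x = 0" using c by (simp add: map_poly_of_int_hom)
  obtain p where p: "poly (map_poly of_int p) x = 0" "lead_coeff p = (1 :: int)"
    using assms(1) unfolding algebraic_int_altdef_ipoly by blast
  have cp: "content p = 1"
    using content_dvd_coeff[of p "degree p"] p(2) by (metis is_unit_content_iff)
  obtain a q where aq: "a \<noteq> 0" "smult a p = g * q + pseudo_mod p g"
    using pseudo_mod(1)[of g p] deg by fastforce
  have "degree (pseudo_mod p g) < 2"
    using pseudo_mod(2)[of g p] deg by fastforce
  define r0 where "r0 = coeff (pseudo_mod p g) 0"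
  define r1 where "r1 = coeff (pseudo_mod p g) 1"
  have r: "pseudo_mod p g = [:r0, r1:]"
    using \<open>degree _ < 2\<close> by (intro poly_eqI) (auto simp: r0_def r1_def coeff_pCons coeff_eq_0 split: nat.split)
  have "poly (map_poly of_int (smult a p)) x = poly (map_poly of_int (g * q + [:r0, r1:])) x"
    unfolding aq(2) r ..
  then have "of_int r0 + x * of_int r1 = 0"
    using p(1) gx by (simp add: map_poly_of_int_hom map_poly_pCons)
  have "r1 = 0"
  proof (rule ccontr)
    assume "r1 \<noteq> 0"
    then have "x = - (of_int r0 / of_int r1)"
      using \<open>of_int r0 + x * of_int r1 = 0\<close> by (simp add: field_simps eq_neg_iff_add_eq_0)
    then show False using assms(2) by simp
  qed
  then have "smult a p = g * q" using aq(2) r \<open>of_int r0 + x * of_int r1 = 0\<close> by simp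
  have "content q = \<bar>a\<bar>"
    using arg_cong[OF \<open>smult a p = g * q\<close>, of content] cp cg by (simp add: content_mult)
  then have "smult \<bar>a\<bar> (g * primitive_part q) = smult a p"
    using \<open>smult a p = g * q\<close> by (metis content_times_primitive_part mult_smult_right)
  then have "smult a (g * smult (sgn a) (primitive_part q)) = smult a p"
    by (simp add: mult_sgn_abs abs_sgn)
  then have "g * smult (sgn a) (primitive_part q) = p"
    by (metis aq(1) coeff_smult mult_left_cancel poly_eqI)
  then have "lead_coeff g dvd 1" using p(2) by (metis dvd_triv_left lead_coeff_mult)
  then have u: "coeff g 2 * coeff g 2 = 1" using deg by (metis zdvd1_eq abs_mult_self_eq mult_1)
  have co: "c * coeff g i = coeff g0 i" for i unfolding g0[symmetric] by simp
  have e2: "c * coeff g 2 = t2 * n2" and e1: "c * coeff g 1 = - (t1 * n2)" and e0: "c * coeff g 0 = t2 * n1"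
    using co[of 2] co[of 1] co[of 0] by (simp_all add: g0_def numeral_2_eq_2)
  have key: "t2 * n2 * coeff g i = coeff g 2 * coeff g0 i" for i
    unfolding e2[symmetric] co[symmetric] by simp
  have "t2 * n2 * (coeff g 2 * coeff g i) = coeff g0 i" for i
    using key[of i] u by (metis mult.assoc mult.left_commute mult_1)
  from this[of 1] this[of 0] have "- (t1 * n2) = t2 * n2 * (coeff g 2 * coeff g 1)"
    "t2 * n1 = t2 * n2 * (coeff g 2 * coeff g 0)" by (simp_all only: g0_def) simp_all
  then have "n2 * t1 = n2 * (t2 * (- (coeff g 2 * coeff g 1)))"
    "t2 * n1 = t2 * (n2 * (coeff g 2 * coeff g 0))" by (simp_all only: mult_ac mult_minus_right)
  then have "t1 = t2 * (- (coeff g 2 * coeff g 1))" "n1 = n2 * (coeff g 2 * coeff g 0)"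
    using t(2) n(2) mult_left_cancel[of n2] mult_left_cancel[of t2] by blast+
  then have "t = of_int (- (coeff g 2 * coeff g 1))" "n = of_int (coeff g 2 * coeff g 0)"
    using t n by simp_all
  then show "t \<in> \<int>" "n \<in> \<int>" by (simp_all only: Ints_of_int)
qed


lemma squarefree_square_denominator:
  fixes d :: int and b :: rat
  assumes "squarefree d" "b * b * of_int d \<in> \<int>"
  shows "b \<in> \<int>"
proof -
  obtain p q where pq: "b = of_int p / of_int q" "q > 0" "coprime p q"
    by (metis quotient_of_coprime quotient_of_denom_pos quotient_of_div surj_pair)
  obtain e where "b * b * of_int d = of_int e" using assms(2) by (elim Ints_cases)
  then have "rat_of_int (p * p * d) = of_int (e * (q * q))"
    using pq by (simp add: field_simps)
  then have e: "p * p * d = e * (q * q)" by (simp only: of_int_eq_iff)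
  then have "q * q dvd p * p * d" by simp
  moreover have "coprime (p * p) (q * q)" using pq(3) by simp
  ultimately have "q * q dvd d" by (simp add: coprime_commute coprime_dvd_mult_right_iff)
  then have "is_unit q" using assms(1) unfolding squarefree_def power2_eq_square by blast
  then have "q = 1" using pq(2) by auto
  then show ?thesis using pq(1) by simp
qed

text \<open>With \<open>1\<close> this generates the ring of integers.\<close>

definition qomega :: "int \<Rightarrow> complex" where
  "qomega d = (if d mod 4 = 1 then (1 + rt d) / 2 else rt d)"

lemma radicand_mod_4:
  assumes "radicand d"
  shows "d mod 4 \<in> {1, 2, 3}"
proof -
  have "\<not> 2\<^sup>2 dvd d"
    using assms unfolding radicand_def squarefree_def by (metis odd_one)
  then have "d mod 4 \<noteq> 0" by (simp add: mod_eq_0_iff_dvd)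
  then show ?thesis by (simp only: insert_iff empty_iff) presburger
qed

lemma four_dvd_square_diff:
  fixes d m k :: int
  assumes "4 dvd m * m - d * (k * k)"
  shows "d mod 4 = 1 \<Longrightarrow> even (m - k)" "d mod 4 = 2 \<or> d mod 4 = 3 \<Longrightarrow> even m \<and> even k"
proof -
  define \<alpha> \<beta> \<delta> where "\<alpha> = m mod 2" and "\<beta> = k mod 2" and "\<delta> = d mod 4"
  have ab: "\<alpha> = 0 \<or> \<alpha> = 1" "\<beta> = 0 \<or> \<beta> = 1" unfolding \<alpha>_def \<beta>_def by auto
  have m: "m = 2 * (m div 2) + \<alpha>" and k: "k = 2 * (k div 2) + \<beta>" and d: "d = 4 * (d div 4) + \<delta>"
    unfolding \<alpha>_def \<beta>_def \<delta>_def by simp_all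
  have "m * m - \<alpha> * \<alpha> = 4 * ((m div 2) * (m div 2) + (m div 2) * \<alpha>)"
    by (subst m, subst (2) m) (simp add: algebra_simps)
  then have mm: "4 dvd m * m - \<alpha> * \<alpha>" by simp
  have "k * k - \<beta> * \<beta> = 4 * ((k div 2) * (k div 2) + (k div 2) * \<beta>)"
    by (subst k, subst (2) k) (simp add: algebra_simps)
  then have kk: "4 dvd k * k - \<beta> * \<beta>" by simp
  have dd: "4 dvd d - \<delta>" using d by presburger
  have "\<alpha> * \<alpha> - \<delta> * (\<beta> * \<beta>) = (m * m - d * (k * k)) - (m * m - \<alpha> * \<alpha>) + d * (k * k - \<beta> * \<beta>) + (d - \<delta>) * (\<beta> * \<beta>)"
    by (simp add: algebra_simps)
  then have *: "4 dvd \<alpha> * \<alpha> - \<delta> * (\<beta> * \<beta>)"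
    using dvd_add[OF dvd_add[OF dvd_diff[OF assms mm] dvd_mult[OF kk, of d]] dvd_mult2[OF dd, of "\<beta> * \<beta>"]]
    by (simp only:)
  show "even (m - k)" if "d mod 4 = 1"
  proof -
    have "\<delta> = 1" using that by (simp add: \<delta>_def)
    then have "\<alpha> = \<beta>" using * ab by auto
    then show ?thesis using \<alpha>_def \<beta>_def by presburger
  qed
  show "even m \<and> even k" if "d mod 4 = 2 \<or> d mod 4 = 3"
  proof -
    have "\<delta> = 2 \<or> \<delta> = 3" using that by (simp add: \<delta>_def)
    then have "\<alpha> = 0" "\<beta> = 0" using * ab by auto
    then show ?thesis using \<alpha>_def \<beta>_def by presburger
  qed
qed

lemma algebraic_int_monic_quadratic:
  fixes x :: complex
  assumes "x * x - of_int t * x + of_int n = 0"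
  shows "algebraic_int x"
  using assms by (intro algebraic_int.intros[of "[:of_int n, - of_int t, 1:]"])
    (auto simp: coeff_pCons algebra_simps split: nat.split)

text \<open>An integer \<open>a + b \<surd>d\<close> has integral trace \<open>2 a = m\<close> and norm \<open>a\<^sup>2 - d b\<^sup>2\<close>.  Hence \<open>(2 b)\<^sup>2 d\<close> is
  integral, so \<open>2 b = k\<close> is integral as \<open>d\<close> is squarefree, and \<open>4\<close> divides \<open>m\<^sup>2 - d k\<^sup>2\<close>.\<close>

lemma ring_of_integers_qfield:
  assumes "radicand d"
  shows "ring_of_integers (qfield d) = {of_int m + of_int n * qomega d | m n. True}"
proof (intro equalityI subsetI)
  fix x assume "x \<in> {of_int m + of_int n * qomega d | m n. True}"
  then obtain m n where x: "x = of_int m + of_int n * qomega d" by blast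
  show "x \<in> ring_of_integers (qfield d)"
  proof (cases "d mod 4 = 1")
    case True
    define e where "e = (1 - d) div 4"
    have e: "d = 1 - 4 * e" unfolding e_def using True by presburger
    have w: "qomega d = (1 + rt d) / 2" using True by (simp add: qomega_def)
    have ww: "qomega d * qomega d = qomega d - of_int e"
    proof -
      have "(1 + s) / 2 * ((1 + s) / 2) = (1 + s) / 2 - (1 - s * s) / 4" for s :: complex
        by (simp add: field_simps)
      moreover have "(of_int d :: complex) = 1 - 4 * of_int e" by (subst e) simp
      ultimately show ?thesis using rt_square[of d] by (simp add: w)
    qed
    have "x * x - of_int (2 * m + n) * x + of_int (m * m + m * n + n * n * e) =
        of_int (n * n) * (qomega d * qomega d - qomega d + of_int e)"
      unfolding x by (simp add: algebra_simps)
    then have "algebraic_int x"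
      unfolding ww by (intro algebraic_int_monic_quadratic[of x "2 * m + n" "m * m + m * n + n * n * e"]) simp
    moreover have "x = of_rat (of_int m + of_int n / 2) + of_rat (of_int n / 2) * rt d"
      unfolding x w by (simp add: of_rat_add of_rat_divide of_rat_mult field_simps)
    then have "x \<in> qfield d" by (simp only: qfieldI)
    ultimately show ?thesis unfolding ring_of_integers_def by simp
  next
    case False
    have w: "qomega d = rt d" using False by (simp add: qomega_def)
    have "x * x - of_int (2 * m) * x + of_int (m * m - n * n * d) =
        of_int (n * n) * (rt d * rt d - of_int d)"
      unfolding x w by (simp add: algebra_simps)
    then have "algebraic_int x"
      unfolding rt_square by (intro algebraic_int_monic_quadratic[of x "2 * m" "m * m - n * n * d"]) simp
    moreover have "x = of_rat (of_int m) + of_rat (of_int n) * rt d"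
      unfolding x w by simp
    then have "x \<in> qfield d" by (simp only: qfieldI)
    ultimately show ?thesis unfolding ring_of_integers_def by simp
  qed
next
  fix x assume "x \<in> ring_of_integers (qfield d)"
  then obtain a b where x: "x = of_rat a + of_rat b * rt d" and int: "algebraic_int x"
    unfolding ring_of_integers_def by (auto elim: qfieldE)
  show "x \<in> {of_int m + of_int n * qomega d | m n. True}"
  proof (cases "b = 0")
    case True
    then have "x \<in> \<rat>" unfolding x by simp
    then have "x \<in> \<int>" using int rational_algebraic_int_is_int by blast
    then obtain m where "x = of_int m + of_int 0 * qomega d" by (auto elim: Ints_cases)
    then show ?thesis by blast
  next
    case False
    have irr: "x \<notin> \<rat>"
    proof
      assume "x \<in> \<rat>"
      moreover have "rt d = (x - of_rat a) / of_rat b" unfolding x using False by simp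
      ultimately show False using rt_irrational[OF assms] by simp
    qed
    have "(A + B * s) * (A + B * s) = 2 * A * (A + B * s) - (A * A - B * B * (s * s))" for A B s :: complex
      by (simp add: algebra_simps)
    from this[of "of_rat a" "of_rat b" "rt d"]
    have "x * x = of_rat (2 * a) * x - of_rat (a * a - b * b * of_int d)"
      unfolding x rt_square by (simp add: of_rat_mult of_rat_diff)
    from algebraic_int_quadratic_integral[OF int irr this]
    obtain m l where m: "2 * a = of_int m" and l: "a * a - b * b * of_int d = of_int l"
      by (auto elim!: Ints_cases)
    have e: "(2 * b) * (2 * b) * of_int d = of_int (m * m - 4 * l)"
      using l unfolding of_int_diff of_int_mult m[symmetric] by (simp add: algebra_simps)
    then have "(2 * b) * (2 * b) * of_int d \<in> \<int>" by (metis Ints_of_int)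
    then have "2 * b \<in> \<int>" using squarefree_square_denominator assms unfolding radicand_def by blast
    then obtain k where k: "2 * b = of_int k" by (elim Ints_cases)
    have "rat_of_int (k * k * d) = of_int (m * m - 4 * l)" using e unfolding k by simp
    then have "k * k * d = m * m - 4 * l" by (simp only: of_int_eq_iff)
    then have "m * m - d * (k * k) = 4 * l" by (simp add: algebra_simps)
    then have dv: "4 dvd m * m - d * (k * k)" by simp
    have ab: "a = of_int m / 2" "b = of_int k / 2" using m k by auto
    show ?thesis
    proof (cases "d mod 4 = 1")
      case True
      then obtain j where j: "m = 2 * j + k"
        using four_dvd_square_diff(1)[OF dv True] by (metis evenE diff_add_cancel)
      have "x = of_int j + of_int k * qomega d"
        unfolding x ab j qomega_def using True
        by (simp add: of_rat_add of_rat_divide of_rat_mult field_simps)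
      then show ?thesis by blast
    next
      case False
      then have "d mod 4 = 2 \<or> d mod 4 = 3" using radicand_mod_4[OF assms] by auto
      then obtain j i where ji: "m = 2 * j" "k = 2 * i"
        using four_dvd_square_diff(2)[OF dv] by (meson evenE)
      have "x = of_int j + of_int i * qomega d"
        unfolding x ab ji qomega_def using False by simp
      then show ?thesis by blast
    qed
  qed
qed

lemma qomega_coords_unique:
  assumes "radicand d" "of_int m + of_int n * qomega d = of_int m' + of_int n' * qomega d"
  shows "m = m'" "n = n'"
proof -
  have "qomega d \<notin> \<rat>"
  proof
    assume w: "qomega d \<in> \<rat>"
    have "rt d = (if d mod 4 = 1 then 2 * qomega d - 1 else qomega d)"
      by (auto simp: qomega_def field_simps)
    then show False using rt_irrational[OF assms(1)] w by (auto split: if_splits)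
  qed
  moreover have "of_int (n - n') * qomega d = of_int (m' - m)"
    using assms(2) by (simp add: algebra_simps)
  ultimately show "n = n'"
    by (metis Rats_divide Rats_of_int eq_iff_diff_eq_0 nonzero_mult_div_cancel_left of_int_eq_0_iff)
  then show "m = m'" using assms(2) by simp
qed

text \<open>The algebraic conjugate of \<open>qomega d\<close>.\<close>

definition qconj :: "int \<Rightarrow> complex" where
  "qconj d = (if d mod 4 = 1 then (1 - rt d) / 2 else - rt d)"

lemma qemb_integer:
  assumes "radicand d"
  shows "qemb d 1 (of_int m + of_int n * qomega d) = of_int m + of_int n * qomega d"
    "qemb d (-1) (of_int m + of_int n * qomega d) = of_int m + of_int n * qconj d"
proof -
  obtain a b where ab: "of_int m + of_int n * qomega d = of_rat a + of_rat b * rt d"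
      "of_int m + of_int n * qconj d = of_rat a - of_rat b * rt d"
  proof (cases "d mod 4 = 1")
    case True
    show ?thesis
      by (rule that[of "of_int m + of_int n / 2" "of_int n / 2"])
        (use True in \<open>simp_all add: qomega_def qconj_def of_rat_add of_rat_divide of_rat_mult field_simps\<close>)
  next
    case False
    show ?thesis
      by (rule that[of "of_int m" "of_int n"]) (use False in \<open>simp_all add: qomega_def qconj_def\<close>)
  qed
  show "qemb d 1 (of_int m + of_int n * qomega d) = of_int m + of_int n * qomega d"
    "qemb d (-1) (of_int m + of_int n * qomega d) = of_int m + of_int n * qconj d"
    unfolding ab using qemb_eq[OF assms] by simp_all
qed

definition qdisc :: "int \<Rightarrow> int" where
  "qdisc d = (if d mod 4 = 1 then d else 4 * d)"

lemma qconj_disc: "(qconj d - qomega d)\<^sup>2 = of_int (qdisc d)"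
proof -
  have "(qconj d - qomega d)\<^sup>2 = (if d mod 4 = 1 then rt d * rt d else 4 * (rt d * rt d))"
    by (simp add: qconj_def qomega_def power2_eq_square field_simps)
  then show ?thesis by (simp add: rt_square qdisc_def)
qed

text \<open>Two integral bases differ by an integer matrix with integer inverse, whose determinant
  squares to \<open>1\<close>.\<close>

lemma field_disc_qfield:
  assumes "radicand d"
  shows "field_disc (qfield d) = qdisc d"
  unfolding field_disc_def
proof (rule the_equality)
  have O: "ring_of_integers (qfield d) = {of_int m + of_int n * qomega d | m n. True}"
    by (rule ring_of_integers_qfield[OF assms])
  have O1: "1 = of_int 1 + of_int 0 * qomega d" and Ow: "qomega d = of_int 0 + of_int 1 * qomega d"
    by simp_all
  have one: "1 \<in> ring_of_integers (qfield d)" "qomega d \<in> ring_of_integers (qfield d)"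
    unfolding O using O1 Ow by blast+
  have basis: "integral_basis (qfield d) 1 (qomega d)"
    unfolding integral_basis_def
  proof (intro conjI one ballI)
    fix x assume "x \<in> ring_of_integers (qfield d)"
    then obtain m n where x: "x = of_int m + of_int n * qomega d" unfolding O by blast
    show "\<exists>!(m, n). x = of_int m * 1 + of_int n * qomega d"
      by (rule ex1I[of _ "(m, n)"]) (auto simp: x dest: qomega_coords_unique[OF assms])
  qed
  have sig: "qemb d 1 1 = 1" "qemb d (-1) 1 = 1" "qemb d 1 (qomega d) = qomega d"
      "qemb d (-1) (qomega d) = qconj d"
    using qemb_integer[OF assms, of 1 0] qemb_integer[OF assms, of 0 1] by simp_all
  show "\<exists>a b \<sigma>\<^sub>1 \<sigma>\<^sub>2. integral_basis (qfield d) a b \<and> \<sigma>\<^sub>1 \<noteq> \<sigma>\<^sub>2 \<and> embeddings (qfield d) = {\<sigma>\<^sub>1, \<sigma>\<^sub>2} \<and>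
     of_int (qdisc d) = (\<sigma>\<^sub>1 a * \<sigma>\<^sub>2 b - \<sigma>\<^sub>1 b * \<sigma>\<^sub>2 a)\<^sup>2"
    by (rule exI[of _ 1], rule exI[of _ "qomega d"], rule exI[of _ "qemb d 1"], rule exI[of _ "qemb d (-1)"])
      (use basis embeddings_qfield[OF assms] sig qconj_disc[of d] in simp)
  fix D
  assume "\<exists>a b \<sigma>\<^sub>1 \<sigma>\<^sub>2. integral_basis (qfield d) a b \<and> \<sigma>\<^sub>1 \<noteq> \<sigma>\<^sub>2 \<and> embeddings (qfield d) = {\<sigma>\<^sub>1, \<sigma>\<^sub>2} \<and>
     of_int D = (\<sigma>\<^sub>1 a * \<sigma>\<^sub>2 b - \<sigma>\<^sub>1 b * \<sigma>\<^sub>2 a)\<^sup>2"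
  then obtain a b \<sigma>\<^sub>1 \<sigma>\<^sub>2 where ib: "integral_basis (qfield d) a b" and \<sigma>: "\<sigma>\<^sub>1 \<noteq> \<sigma>\<^sub>2"
      "{qemb d 1, qemb d (-1)} = {\<sigma>\<^sub>1, \<sigma>\<^sub>2}" and D: "of_int D = (\<sigma>\<^sub>1 a * \<sigma>\<^sub>2 b - \<sigma>\<^sub>1 b * \<sigma>\<^sub>2 a)\<^sup>2"
    unfolding embeddings_qfield(1)[OF assms] by blast
  have D': "of_int D = (qemb d 1 a * qemb d (-1) b - qemb d 1 b * qemb d (-1) a)\<^sup>2"
    using \<sigma> D by (auto simp: doubleton_eq_iff power2_commute mult.commute)
  have "a \<in> ring_of_integers (qfield d)" "b \<in> ring_of_integers (qfield d)"
    using ib unfolding integral_basis_def by auto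
  then obtain m1 n1 m2 n2 where ab: "a = of_int m1 + of_int n1 * qomega d" "b = of_int m2 + of_int n2 * qomega d"
    unfolding O by blast
  have "\<exists>p q. x = of_int p * a + of_int q * b" if "x \<in> ring_of_integers (qfield d)" for x
    using ib that unfolding integral_basis_def by (auto dest!: bspec ex1_implies_ex)
  then obtain p q r t where pq: "1 = of_int p * a + of_int q * b" "qomega d = of_int r * a + of_int t * b"
    using one by metis
  have "of_int 1 + of_int 0 * qomega d = of_int (p * m1 + q * m2) + of_int (p * n1 + q * n2) * qomega d"
    using pq(1) unfolding ab by (simp add: algebra_simps)
  note e1 = qomega_coords_unique[OF assms this]
  have "of_int 0 + of_int 1 * qomega d = of_int (r * m1 + t * m2) + of_int (r * n1 + t * n2) * qomega d"
    using pq(2) unfolding ab by (simp add: algebra_simps)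
  note e2 = qomega_coords_unique[OF assms this]
  have "(p * t - q * r) * (m1 * n2 - m2 * n1) =
      (p * m1 + q * m2) * (r * n1 + t * n2) - (p * n1 + q * n2) * (r * m1 + t * m2)"
    by (simp add: algebra_simps)
  also have "\<dots> = 1" by (simp flip: e1 e2)
  finally have "is_unit (m1 * n2 - m2 * n1)" by (metis dvd_triv_right)
  then have unit: "(m1 * n2 - m2 * n1)\<^sup>2 = 1" by (metis zdvd1_eq power2_abs power_one)
  have "qemb d 1 a * qemb d (-1) b - qemb d 1 b * qemb d (-1) a = of_int (m1 * n2 - m2 * n1) * (qconj d - qomega d)"
    unfolding ab qemb_integer[OF assms] by (simp add: algebra_simps)
  then have "of_int D = (of_int ((m1 * n2 - m2 * n1)\<^sup>2) * of_int (qdisc d) :: complex)"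
    unfolding D' qconj_disc[symmetric] by (simp add: power_mult_distrib)
  then show "D = qdisc d" unfolding unit by simp
qed


section \<open>Equidistribution of multiples of square roots modulo one\<close>

lemma cesaro_mean_zero:
  fixes a :: "nat \<Rightarrow> real"
  assumes "a \<longlonglongrightarrow> 0"
  shows "(\<lambda>N. (\<Sum>n<N. a n) / real N) \<longlonglongrightarrow> 0"
proof (rule LIMSEQ_I)
  fix \<epsilon> :: real assume "\<epsilon> > 0"
  then obtain M where M: "\<And>n. n \<ge> M \<Longrightarrow> \<bar>a n\<bar> < \<epsilon> / 2"
    using LIMSEQ_D[OF assms, of "\<epsilon> / 2"] by auto
  define S where "S = (\<Sum>n<M. \<bar>a n\<bar>)"
  have "(\<lambda>N. S / real N) \<longlonglongrightarrow> 0" by real_asymp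
  then obtain K where K: "\<And>N. N \<ge> K \<Longrightarrow> \<bar>S / real N\<bar> < \<epsilon> / 2"
    using LIMSEQ_D[of "\<lambda>N. S / real N" 0 "\<epsilon> / 2"] \<open>\<epsilon> > 0\<close> by auto
  have "\<bar>(\<Sum>n<N. a n) / real N\<bar> < \<epsilon>" if N: "N \<ge> max K (max M 1)" for N
  proof -
    have split: "{..<N} = {..<M} \<union> {M..<N}" using N by auto
    have "(\<Sum>n<N. \<bar>a n\<bar>) = S + (\<Sum>n\<in>{M..<N}. \<bar>a n\<bar>)"
      unfolding S_def split by (rule sum.union_disjoint) auto
    moreover have "(\<Sum>n\<in>{M..<N}. \<bar>a n\<bar>) \<le> (\<Sum>n\<in>{M..<N}. \<epsilon> / 2)"
      using M by (intro sum_mono) (simp add: less_imp_le)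
    moreover have "(\<Sum>n\<in>{M..<N}. \<epsilon> / 2) \<le> real N * (\<epsilon> / 2)"
      using \<open>\<epsilon> > 0\<close> by (simp add: mult_right_mono)
    moreover have "\<bar>\<Sum>n<N. a n\<bar> \<le> (\<Sum>n<N. \<bar>a n\<bar>)" by (rule sum_abs)
    ultimately have "\<bar>\<Sum>n<N. a n\<bar> \<le> S + real N * (\<epsilon> / 2)" by linarith
    then have "\<bar>\<Sum>n<N. a n\<bar> / real N \<le> (S + real N * (\<epsilon> / 2)) / real N"
      by (rule divide_right_mono) simp
    also have "\<dots> = S / real N + \<epsilon> / 2" using N by (simp add: add_divide_distrib)
    also have "\<dots> < \<epsilon>" using K[of N] N abs_ge_self[of "S / real N"] by linarith
    finally show ?thesis by simp
  qed
  then show "\<exists>no. \<forall>N\<ge>no. norm ((\<Sum>n<N. a n) / real N - 0) < \<epsilon>"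
    by (intro exI[of _ "max K (max M 1)"]) simp
qed

lemma periodic_int:
  fixes F :: "real \<Rightarrow> 'a"
  assumes per: "\<And>x. F (x + 1) = F x"
  shows "F (x + of_int k) = F x"
proof -
  have nat: "F (y + real n) = F y" for y n
  proof (induction n)
    case (Suc n)
    then show ?case using per[of "y + real n"] by (simp add: algebra_simps)
  qed simp
  show ?thesis
  proof (cases k rule: int_cases2)
    case (nonneg n)
    then show ?thesis using nat by simp
  next
    case (nonpos n)
    then show ?thesis using nat[of "x + of_int k" n] by simp
  qed
qed

text \<open>Continuous functions on \<open>\<real>/\<int>\<close>, as periodic functions on the line.\<close>

definition circle_fun :: "(real \<Rightarrow> real) \<Rightarrow> bool" where
  "circle_fun F \<longleftrightarrow> continuous_on UNIV F \<and> (\<forall>x. F (x + 1) = F x)"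

lemma circle_fun_int:
  assumes "circle_fun F"
  shows "F (x + of_int k) = F x"
  using assms unfolding circle_fun_def by (intro periodic_int) blast

lemma circle_fun_bounded:
  assumes "circle_fun F"
  obtains B where "B > 0" "\<And>x. \<bar>F x\<bar> \<le> B"
proof -
  have "compact (F ` {0..1})"
    using assms unfolding circle_fun_def by (intro compact_continuous_image) (auto intro: continuous_on_subset)
  then have "bounded (F ` {0..1})" by (rule compact_imp_bounded)
  then obtain B where "B > 0" "\<forall>y \<in> F ` {0..1}. norm y \<le> B"
    unfolding bounded_pos by blast
  then have B: "B > 0" "\<And>x. x \<in> {0..1} \<Longrightarrow> \<bar>F x\<bar> \<le> B" by auto
  have "\<bar>F x\<bar> \<le> B" for x
  proof -
    have "F x = F (frac x)" using circle_fun_int[OF assms, of "frac x" "\<lfloor>x\<rfloor>"] by (simp add: frac_def)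
    then show ?thesis using B(2)[of "frac x"] by (simp add: frac_ge_0 frac_lt_1 less_imp_le)
  qed
  then show ?thesis using that B(1) by blast
qed

lemma circle_fun_uniformly_continuous:
  assumes "circle_fun F"
  shows "uniformly_continuous_on UNIV F"
  unfolding uniformly_continuous_on_def
proof (intro allI impI)
  fix e :: real assume "e > 0"
  have "uniformly_continuous_on {-1..2} F"
    using assms unfolding circle_fun_def
    by (intro compact_uniformly_continuous) (auto intro: continuous_on_subset)
  then obtain d where d: "d > 0"
      "\<And>x y. x \<in> {-1..2} \<Longrightarrow> y \<in> {-1..2} \<Longrightarrow> dist y x < d \<Longrightarrow> dist (F y) (F x) < e"
    using \<open>e > 0\<close> unfolding uniformly_continuous_on_def by metis
  have "dist (F y) (F x) < e" if "dist y x < min d 1" for x y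
  proof -
    define k where "k = \<lfloor>x\<rfloor>"
    have "x - of_int k \<in> {-1..2}" "y - of_int k \<in> {-1..2}"
      using that unfolding k_def dist_real_def by (auto simp: abs_less_iff) linarith+
    moreover have "dist (y - of_int k) (x - of_int k) < d" using that by (simp add: dist_real_def)
    ultimately have "dist (F (y - of_int k)) (F (x - of_int k)) < e" using d(2) by blast
    then show ?thesis
      using circle_fun_int[OF assms, of x "-k"] circle_fun_int[OF assms, of y "-k"] by simp
  qed
  then show "\<exists>d>0. \<forall>x\<in>UNIV. \<forall>x'\<in>UNIV. dist x' x < d \<longrightarrow> dist (F x') (F x) < e"
    using d(1) by (intro exI[of _ "min d 1"]) auto
qed

text \<open>Subtracting the mean is what makes the primitive periodic, hence bounded.\<close>

lemma circle_fun_primitive: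
  assumes "circle_fun F"
  obtains G where "circle_fun G" "\<And>x. (G has_real_derivative (F x - integral {0..1} F)) (at x)"
proof -
  define f where "f x = F x - integral {0..1} F" for x
  have cont: "continuous_on UNIV F" using assms by (simp add: circle_fun_def)
  have "isCont f x" for x
    unfolding f_def using cont by (intro continuous_intros) (simp add: continuous_on_eq_continuous_at)
  then obtain G where G: "\<And>x. (G has_vector_derivative f x) (at x)"
    using einterval_antiderivative[of "-\<infinity>" "\<infinity>" f] by auto
  have G': "(G has_real_derivative f x) (at x)" for x
    using G by (simp add: has_real_derivative_iff_has_vector_derivative)
  have fper: "f (x + 1) = f x" for x using assms unfolding circle_fun_def f_def by simp
  have "((\<lambda>x. x + 1) has_real_derivative 1) (at x)" for x :: real
    by (auto intro!: derivative_eq_intros)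
  then have "((\<lambda>x. G (x + 1)) has_real_derivative (f (x + 1) * 1)) (at x)" for x
    by (rule DERIV_chain2[OF G'])
  then have "((\<lambda>x. G (x + 1) - G x) has_real_derivative 0) (at x)" for x
    using DERIV_diff[OF _ G'[of x]] fper[of x] by fastforce
  then have const: "G (x + 1) - G x = G (0 + 1) - G 0" for x
    using DERIV_isconst_all by blast
  have "(f has_integral (G 1 - G 0)) {0..1}"
    using G by (intro fundamental_theorem_of_calculus) (auto intro: has_vector_derivative_at_within)
  then have "G 1 - G 0 = integral {0..1} f" by (simp add: integral_unique)
  also have "\<dots> = 0"
    unfolding f_def using cont
    by (subst integral_diff) (auto intro!: integrable_continuous_interval continuous_on_subset[OF cont])
  finally have per: "G (x + 1) = G x" for x using const[of x] by simp
  have "continuous_on UNIV G" using G' by (meson DERIV_isCont continuous_at_imp_continuous_on)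
  then have "circle_fun G" using per unfolding circle_fun_def by blast
  then show ?thesis using that G' unfolding f_def by blast
qed

text \<open>With \<open>G\<close> a periodic primitive of \<open>F - \<integral>F\<close>, the function \<open>\<Phi> x = 2 \<surd>x G (\<alpha> \<surd>x) / \<alpha>\<close> has
  derivative \<open>(F - \<integral>F) (\<alpha> \<surd>x) + O (1 / \<surd>x)\<close> and size \<open>O (\<surd>x)\<close>.  By the mean value theorem the
  sum is therefore a telescoping sum of \<open>\<Phi>\<close>, up to a sum of null terms.\<close>

lemma sqrt_equidistributed:
  assumes F: "circle_fun F" and \<alpha>: "\<alpha> \<noteq> 0" and \<rho>: "\<rho> \<ge> 0"
  shows "(\<lambda>N. (\<Sum>n<N. F (\<alpha> * sqrt (real n + \<rho>))) / real N) \<longlonglongrightarrow> integral {0..1} F"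
proof -
  define I where "I = integral {0..1} F"
  obtain G where G: "circle_fun G" "\<And>x. (G has_real_derivative (F x - I)) (at x)"
    using circle_fun_primitive[OF F] unfolding I_def by blast
  obtain B where B: "B > 0" "\<And>x. \<bar>G x\<bar> \<le> B" using circle_fun_bounded[OF G(1)] by blast
  define \<Phi> where "\<Phi> x = 2 / \<alpha> * (sqrt x * G (\<alpha> * sqrt x))" for x
  define g where "g x = G (\<alpha> * sqrt x) / (\<alpha> * sqrt x)" for x
  have \<Phi>': "(\<Phi> has_real_derivative (F (\<alpha> * sqrt x) - I + g x)) (at x)" if "x > 0" for x
  proof -
    have s: "((\<lambda>x. \<alpha> * sqrt x) has_real_derivative (\<alpha> / (2 * sqrt x))) (at x)"
      using that by (auto intro!: derivative_eq_intros simp: field_simps)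
    have "(\<Phi> has_real_derivative 2 / \<alpha> * (1 / (2 * sqrt x) * G (\<alpha> * sqrt x) +
        ((F (\<alpha> * sqrt x) - I) * (\<alpha> / (2 * sqrt x))) * sqrt x)) (at x)"
      unfolding \<Phi>_def using that
      by (intro DERIV_cmult DERIV_mult DERIV_chain2[OF G(2) s])
        (auto intro!: derivative_eq_intros simp: field_simps)
    moreover have "2 / \<alpha> * (1 / (2 * sqrt x) * G (\<alpha> * sqrt x) +
        ((F (\<alpha> * sqrt x) - I) * (\<alpha> / (2 * sqrt x))) * sqrt x) = F (\<alpha> * sqrt x) - I + g x"
      unfolding g_def using that \<alpha> by (simp add: field_simps)
    ultimately show ?thesis by simp
  qed
  \<comment> \<open>The defect of the telescoping sum.\<close>
  define e where "e n = \<Phi> (real (Suc n) + \<rho>) - \<Phi> (real n + \<rho>) - (F (\<alpha> * sqrt (real n + \<rho>)) - I)" for n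
  \<comment> \<open>For \<open>n = 0\<close> and \<open>\<rho> = 0\<close> the interval touches \<open>0\<close>, where \<open>\<Phi>\<close> need not be differentiable.\<close>
  have "\<exists>\<xi>. real n + \<rho> < \<xi> \<and> \<xi> < real (Suc n) + \<rho> \<and>
      \<Phi> (real (Suc n) + \<rho>) - \<Phi> (real n + \<rho>) = F (\<alpha> * sqrt \<xi>) - I + g \<xi>" if "n \<ge> 1" for n
    using MVT2[of "real n + \<rho>" "real (Suc n) + \<rho>" \<Phi> "\<lambda>x. F (\<alpha> * sqrt x) - I + g x"] \<Phi>' that \<rho>
    by (auto simp: algebra_simps)
  then obtain \<xi> where \<xi>: "\<And>n. n \<ge> 1 \<Longrightarrow> real n + \<rho> < \<xi> n" "\<And>n. n \<ge> 1 \<Longrightarrow> \<xi> n < real (Suc n) + \<rho>"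
      "\<And>n. n \<ge> 1 \<Longrightarrow> \<Phi> (real (Suc n) + \<rho>) - \<Phi> (real n + \<rho>) = F (\<alpha> * sqrt (\<xi> n)) - I + g (\<xi> n)"
    by metis
  have lim0: "(\<lambda>n. C / sqrt (real n)) \<longlonglongrightarrow> 0" for C by real_asymp
  have "(\<lambda>n. F (\<alpha> * sqrt (\<xi> n)) - F (\<alpha> * sqrt (real n + \<rho>))) \<longlonglongrightarrow> 0"
  proof (rule LIMSEQ_I)
    fix \<epsilon> :: real assume "\<epsilon> > 0"
    then obtain d where d: "d > 0" "\<And>x y. dist y x < d \<Longrightarrow> dist (F y) (F x) < \<epsilon>"
      using circle_fun_uniformly_continuous[OF F] unfolding uniformly_continuous_on_def by (metis UNIV_I)
    obtain M where M: "\<And>n. n \<ge> M \<Longrightarrow> \<bar>\<bar>\<alpha>\<bar> / sqrt (real n)\<bar> < d"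
      using LIMSEQ_D[OF lim0 d(1)] by auto
    have "norm (F (\<alpha> * sqrt (\<xi> n)) - F (\<alpha> * sqrt (real n + \<rho>)) - 0) < \<epsilon>" if n: "n \<ge> max M 1" for n
    proof -
      define u where "u = real n + \<rho>"
      have u: "u \<ge> real n" "u > 0" "u < \<xi> n" "\<xi> n < u + 1"
        using \<xi>(1,2)[of n] n \<rho> unfolding u_def by auto
      have "(sqrt (\<xi> n) - sqrt u) * sqrt (real n) \<le> (sqrt (\<xi> n) - sqrt u) * (sqrt (\<xi> n) + sqrt u)"
      proof (rule mult_left_mono)
        have "sqrt (real n) \<le> sqrt u" "0 \<le> sqrt (\<xi> n)" using u by simp_all
        then show "sqrt (real n) \<le> sqrt (\<xi> n) + sqrt u" by linarith
        show "0 \<le> sqrt (\<xi> n) - sqrt u" using u by simp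
      qed
      also have "\<dots> = \<xi> n - u" using u by (simp add: algebra_simps)
      finally have "(sqrt (\<xi> n) - sqrt u) * sqrt (real n) \<le> 1" using u by simp
      then have "sqrt (\<xi> n) - sqrt u \<le> 1 / sqrt (real n)" using n by (simp add: field_simps)
      then have "\<bar>\<alpha>\<bar> * (sqrt (\<xi> n) - sqrt u) \<le> \<bar>\<alpha>\<bar> * (1 / sqrt (real n))"
        by (intro mult_left_mono) auto
      moreover have "\<bar>\<alpha> * sqrt (\<xi> n) - \<alpha> * sqrt u\<bar> = \<bar>\<alpha>\<bar> * (sqrt (\<xi> n) - sqrt u)"
        using u by (simp add: abs_mult flip: right_diff_distrib)
      ultimately have "dist (\<alpha> * sqrt (\<xi> n)) (\<alpha> * sqrt u) < d"
        using M[of n] n by (simp add: dist_real_def)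
      then show ?thesis using d(2) unfolding u_def dist_real_def by simp
    qed
    then show "\<exists>no. \<forall>n\<ge>no. norm (F (\<alpha> * sqrt (\<xi> n)) - F (\<alpha> * sqrt (real n + \<rho>)) - 0) < \<epsilon>" by blast
  qed
  moreover have "(\<lambda>n. g (\<xi> n)) \<longlonglongrightarrow> 0"
  proof (rule Lim_null_comparison[OF _ lim0[of "B / \<bar>\<alpha>\<bar>"]])
    have "norm (g (\<xi> n)) \<le> B / \<bar>\<alpha>\<bar> / sqrt (real n)" if "n \<ge> 1" for n
    proof -
      have "real n \<le> \<xi> n" using \<xi>(1)[OF that] \<rho> by simp
      then have "\<bar>G (\<alpha> * sqrt (\<xi> n))\<bar> / (\<bar>\<alpha>\<bar> * sqrt (\<xi> n)) \<le> B / (\<bar>\<alpha>\<bar> * sqrt (real n))"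
        using B that \<alpha> by (intro frac_le mult_left_mono) auto
      then show ?thesis using \<open>real n \<le> \<xi> n\<close> unfolding g_def by (simp add: abs_mult)
    qed
    then show "\<forall>\<^sub>F n in sequentially. norm (g (\<xi> n)) \<le> B / \<bar>\<alpha>\<bar> / sqrt (real n)"
      by (auto simp: eventually_sequentially)
  qed
  ultimately have "(\<lambda>n. F (\<alpha> * sqrt (\<xi> n)) - F (\<alpha> * sqrt (real n + \<rho>)) + g (\<xi> n)) \<longlonglongrightarrow> 0 + 0"
    by (rule tendsto_add)
  moreover have "\<forall>\<^sub>F n in sequentially. F (\<alpha> * sqrt (\<xi> n)) - F (\<alpha> * sqrt (real n + \<rho>)) + g (\<xi> n) = e n"
    unfolding eventually_sequentially e_def using \<xi>(3) by (intro exI[of _ 1]) auto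
  ultimately have "e \<longlonglongrightarrow> 0" by (simp add: tendsto_cong)
  then have lim_e: "(\<lambda>N. (\<Sum>n<N. e n) / real N) \<longlonglongrightarrow> 0" by (rule cesaro_mean_zero)
  have lim_\<Phi>: "(\<lambda>N. (\<Phi> (real N + \<rho>) - \<Phi> \<rho>) / real N) \<longlonglongrightarrow> 0"
  proof (rule Lim_null_comparison)
    show "(\<lambda>N. (2 / \<bar>\<alpha>\<bar> * (sqrt (real N + \<rho>) * B) + \<bar>\<Phi> \<rho>\<bar>) / real N) \<longlonglongrightarrow> 0" by real_asymp
    have "\<bar>\<Phi> (real N + \<rho>)\<bar> \<le> 2 / \<bar>\<alpha>\<bar> * (sqrt (real N + \<rho>) * B)" for N
      unfolding \<Phi>_def abs_mult using B \<rho> by (intro mult_mono) auto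
    then have "\<bar>\<Phi> (real N + \<rho>) - \<Phi> \<rho>\<bar> \<le> 2 / \<bar>\<alpha>\<bar> * (sqrt (real N + \<rho>) * B) + \<bar>\<Phi> \<rho>\<bar>" for N
      by (smt (verit))
    then show "\<forall>\<^sub>F N in sequentially. norm ((\<Phi> (real N + \<rho>) - \<Phi> \<rho>) / real N) \<le>
        (2 / \<bar>\<alpha>\<bar> * (sqrt (real N + \<rho>) * B) + \<bar>\<Phi> \<rho>\<bar>) / real N"
      by (intro always_eventually allI) (simp add: divide_right_mono)
  qed
  have "(\<Sum>n<N. F (\<alpha> * sqrt (real n + \<rho>))) / real N =
      (\<Phi> (real N + \<rho>) - \<Phi> \<rho>) / real N - (\<Sum>n<N. e n) / real N + I" if "N \<ge> 1" for N
  proof -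
    have "(\<Sum>n<N. e n) = (\<Sum>n<N. \<Phi> (real (Suc n) + \<rho>) - \<Phi> (real n + \<rho>)) -
        ((\<Sum>n<N. F (\<alpha> * sqrt (real n + \<rho>))) - (\<Sum>n<N. I))"
      unfolding e_def sum_subtractf ..
    also have "(\<Sum>n<N. \<Phi> (real (Suc n) + \<rho>) - \<Phi> (real n + \<rho>)) = \<Phi> (real N + \<rho>) - \<Phi> (real 0 + \<rho>)"
      by (rule sum_lessThan_telescope)
    finally have "(\<Sum>n<N. F (\<alpha> * sqrt (real n + \<rho>))) = \<Phi> (real N + \<rho>) - \<Phi> \<rho> - (\<Sum>n<N. e n) + real N * I"
      by simp
    then show ?thesis using that by (simp add: add_divide_distrib diff_divide_distrib)
  qed
  then have "\<forall>\<^sub>F N in sequentially. (\<Phi> (real N + \<rho>) - \<Phi> \<rho>) / real N - (\<Sum>n<N. e n) / real N + I =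
      (\<Sum>n<N. F (\<alpha> * sqrt (real n + \<rho>))) / real N"
    unfolding eventually_sequentially by (intro exI[of _ 1]) auto
  moreover have "(\<lambda>N. (\<Phi> (real N + \<rho>) - \<Phi> \<rho>) / real N - (\<Sum>n<N. e n) / real N + I) \<longlonglongrightarrow> 0 - 0 + I"
    by (intro tendsto_intros lim_e lim_\<Phi>)
  ultimately show ?thesis unfolding I_def[symmetric] by (simp add: tendsto_cong)
qed


section \<open>Square roots of squarefree numbers\<close>

text \<open>The bound for \<open>k\<close> is \<open>\<lceil>(N - j) / q\<rceil>\<close>, written so that no difference of natural numbers is truncated.\<close>

lemma residue_class_image:
  fixes q j N :: nat
  assumes "j < q"
  shows "{n. n < N \<and> n mod q = j} = (\<lambda>k. q * k + j) ` {..<(N + q - 1 - j) div q}"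
proof -
  have *: "q * k + j < N \<longleftrightarrow> k < (N + q - 1 - j) div q" for k
  proof -
    have "k < (N + q - 1 - j) div q \<longleftrightarrow> (Suc k) * q \<le> N + q - 1 - j"
      using assms by (simp add: less_eq_div_iff_mult_less_eq Suc_le_eq flip: Suc_le_eq)
    also have "\<dots> \<longleftrightarrow> q * k + j < N" using assms by (auto simp: algebra_simps)
    finally show ?thesis by blast
  qed
  show ?thesis
  proof (intro equalityI subsetI)
    fix n assume "n \<in> {n. n < N \<and> n mod q = j}"
    then have "n = q * (n div q) + j" "n < N" using mult_div_mod_eq[of q n] by auto
    then show "n \<in> (\<lambda>k. q * k + j) ` {..<(N + q - 1 - j) div q}"
      using *[of "n div q"] by (intro image_eqI[of _ _ "n div q"]) auto
  next
    fix n assume "n \<in> (\<lambda>k. q * k + j) ` {..<(N + q - 1 - j) div q}"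
    then obtain k where "n = q * k + j" "k < (N + q - 1 - j) div q" by auto
    then show "n \<in> {n. n < N \<and> n mod q = j}" using *[of k] assms by simp
  qed
qed

lemma sum_residue_class:
  fixes q j N :: nat
  assumes "j < q"
  shows "(\<Sum>n | n < N \<and> n mod q = j. f n) = (\<Sum>k<(N + q - 1 - j) div q. f (q * k + j))"
  unfolding residue_class_image[OF assms] using assms
  by (subst sum.reindex) (auto simp: inj_on_def)

lemma card_residue_class_bounds:
  fixes q j N :: nat
  assumes "j < q"
  shows "real (card {n. n < N \<and> n mod q = j}) \<le> real N / real q + 1"
    "real (card {n. n < N \<and> n mod q = j}) \<ge> real N / real q - 1"
proof -
  have c: "card {n. n < N \<and> n mod q = j} = (N + q - 1 - j) div q"
    unfolding residue_class_image[OF assms] using assms by (subst card_image) (auto simp: inj_on_def)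
  have d: "real (x div q) \<le> real x / real q" "real (x div q) \<ge> real x / real q - (real q - 1) / real q" for x
  proof -
    have e: "real x = real q * real (x div q) + real (x mod q)"
      by (metis mult_div_mod_eq of_nat_add of_nat_mult)
    have "real (x mod q) \<le> real q - 1" using assms
      by (metis Suc_leI less_nat_zero_code mod_less_divisor not_gr_zero of_nat_Suc of_nat_le_iff le_diff_eq add.commute)
    then have "real (x mod q) / real q \<le> (real q - 1) / real q" by (intro divide_right_mono) auto
    moreover have "real x / real q = real (x div q) + real (x mod q) / real q"
      using assms unfolding e by (simp add: field_simps)
    moreover have "real (x mod q) / real q \<ge> 0" by simp
    ultimately show "real (x div q) \<le> real x / real q" "real (x div q) \<ge> real x / real q - (real q - 1) / real q"
      by linarith+
  qed
  have r: "real (N + q - 1 - j) = real N + real q - 1 - real j" using assms by (simp add: of_nat_diff)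
  have "(real N + real q - 1 - real j) / real q \<le> real N / real q + 1"
    using assms by (simp add: field_simps)
  then show "real (card {n. n < N \<and> n mod q = j}) \<le> real N / real q + 1"
    unfolding c using order_trans[OF d(1)[of "N + q - 1 - j", unfolded r]] by blast
  have "(real N + real q - 1 - real j) / real q - (real q - 1) / real q \<ge> real N / real q - 1"
    using assms by (simp add: field_simps)
  then show "real (card {n. n < N \<and> n mod q = j}) \<ge> real N / real q - 1"
    unfolding c using order_trans[OF _ d(2)[of "N + q - 1 - j", unfolded r]] by blast
qed

text \<open>Substituting \<open>n = q k + j\<close> turns \<open>\<alpha> \<surd>n\<close> into \<open>\<alpha> \<surd>q \<surd>(k + j / q)\<close>; this is the reason for
  admitting a shift \<open>\<rho>\<close> in \<open>sqrt_equidistributed\<close>.\<close>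

lemma sqrt_equidistributed_residue_class:
  fixes q j :: nat
  assumes "circle_fun F" "\<alpha> \<noteq> 0" "j < q"
  shows "(\<lambda>N. (\<Sum>n | n < N \<and> n mod q = j. F (\<alpha> * sqrt (real n))) / real N) \<longlonglongrightarrow> integral {0..1} F / real q"
proof -
  define K where "K N = (N + q - 1 - j) div q" for N
  define S where "S k = (\<Sum>i<k. F (\<alpha> * sqrt (real q) * sqrt (real i + real j / real q)))" for k
  have q: "q > 0" using assms by simp
  have cK: "K N = card {n. n < N \<and> n mod q = j}" for N
    unfolding K_def residue_class_image[OF assms(3)] using q by (subst card_image) (auto simp: inj_on_def)
  have eq: "(\<Sum>n | n < N \<and> n mod q = j. F (\<alpha> * sqrt (real n))) = S (K N)" for N
    unfolding sum_residue_class[OF assms(3)] S_def K_def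
  proof (rule sum.cong[OF refl])
    fix k
    have "real (q * k + j) = real q * (real k + real j / real q)" using q by (simp add: field_simps)
    then show "F (\<alpha> * sqrt (real (q * k + j))) = F (\<alpha> * sqrt (real q) * sqrt (real k + real j / real q))"
      by (simp add: real_sqrt_mult mult.assoc)
  qed
  have lK: "(\<lambda>N. real (K N) / real N) \<longlonglongrightarrow> 1 / real q"
  proof (rule tendsto_sandwich)
    show "(\<lambda>N. (real N / real q - 1) / real N) \<longlonglongrightarrow> 1 / real q" using q by real_asymp (simp add: divide_inverse)
    show "(\<lambda>N. (real N / real q + 1) / real N) \<longlonglongrightarrow> 1 / real q" using q by real_asymp (simp add: divide_inverse)
    show "\<forall>\<^sub>F N in sequentially. (real N / real q - 1) / real N \<le> real (K N) / real N"
      unfolding cK using card_residue_class_bounds(2)[OF assms(3)]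
      by (intro always_eventually allI divide_right_mono) auto
    show "\<forall>\<^sub>F N in sequentially. real (K N) / real N \<le> (real N / real q + 1) / real N"
      unfolding cK using card_residue_class_bounds(1)[OF assms(3)]
      by (intro always_eventually allI divide_right_mono) auto
  qed
  have fK: "filterlim K at_top sequentially"
  proof -
    have "filterlim (\<lambda>N. real N / real q - 1) at_top sequentially" using q by real_asymp
    then have "filterlim (\<lambda>N. real (K N)) at_top sequentially"
      by (rule filterlim_at_top_mono)
        (use card_residue_class_bounds(2)[OF assms(3)] in \<open>simp add: cK\<close>)
    then show ?thesis by (simp add: filterlim_sequentially_iff_filterlim_real)
  qed
  have "(\<lambda>k. S k / real k) \<longlonglongrightarrow> integral {0..1} F"
    unfolding S_def using assms q by (intro sqrt_equidistributed) auto
  then have "(\<lambda>N. S (K N) / real (K N)) \<longlonglongrightarrow> integral {0..1} F"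
    by (rule filterlim_compose[OF _ fK])
  from tendsto_mult[OF this lK]
  have "(\<lambda>N. S (K N) / real (K N) * (real (K N) / real N)) \<longlonglongrightarrow> integral {0..1} F / real q" by simp
  moreover have "S (K N) / real (K N) * (real (K N) / real N) = S (K N) / real N" for N
    by (cases "K N = 0") (auto simp: S_def)
  ultimately show ?thesis by (simp only: eq)
qed

lemma sqrt_equidistributed_periodic_set:
  fixes A :: "nat set"
  assumes "circle_fun F" "\<alpha> \<noteq> 0" "q > 0" and periodic: "\<And>n. n \<in> A \<longleftrightarrow> n mod q \<in> A"
  shows "(\<lambda>N. (\<Sum>n | n < N \<and> n \<in> A. F (\<alpha> * sqrt (real n))) / real N) \<longlonglongrightarrow>
     real (card (A \<inter> {..<q})) / real q * integral {0..1} F"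
proof -
  have "{n. n < N \<and> n \<in> A} = (\<Union>j\<in>A \<inter> {..<q}. {n. n < N \<and> n mod q = j})" for N
    using periodic \<open>q > 0\<close> by auto
  then have "(\<Sum>n | n < N \<and> n \<in> A. F (\<alpha> * sqrt (real n))) / real N =
      (\<Sum>j\<in>A \<inter> {..<q}. (\<Sum>n | n < N \<and> n mod q = j. F (\<alpha> * sqrt (real n))) / real N)" for N
    by (simp add: sum_divide_distrib) (subst sum.UNION_disjoint, auto)
  moreover have "(\<lambda>N. \<Sum>j\<in>A \<inter> {..<q}. (\<Sum>n | n < N \<and> n mod q = j. F (\<alpha> * sqrt (real n))) / real N)
      \<longlonglongrightarrow> (\<Sum>j\<in>A \<inter> {..<q}. integral {0..1} F / real q)"
    by (intro tendsto_sum sqrt_equidistributed_residue_class) (use assms in auto)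
  ultimately show ?thesis by simp
qed

text \<open>Compare with the telescoping sum of \<open>1 / (m - 1) - 1 / m\<close>.\<close>

lemma sum_inverse_squares_tail:
  assumes "M \<ge> 1"
  shows "(\<Sum>m\<in>{M<..K}. 1 / (real m)\<^sup>2) \<le> 1 / real M"
proof -
  have "(\<Sum>m\<in>{M<..K}. 1 / (real m)\<^sup>2) \<le> 1 / real M - 1 / real K" if "M \<le> K"
    using that
  proof (induction K rule: dec_induct)
    case (step K)
    have "{M<..Suc K} = insert (Suc K) {M<..K}" using step by auto
    then have "(\<Sum>m\<in>{M<..Suc K}. 1 / (real m)\<^sup>2) = 1 / (real (Suc K))\<^sup>2 + (\<Sum>m\<in>{M<..K}. 1 / (real m)\<^sup>2)"
      by simp
    moreover have "1 / (real (Suc K))\<^sup>2 \<le> 1 / real K - 1 / real (Suc K)"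
    proof -
      have "real K > 0" using step assms by simp
      then have "1 / real K - 1 / real (Suc K) = 1 / (real K * real (Suc K))" by (simp add: field_simps)
      moreover have "1 / (real (Suc K))\<^sup>2 \<le> 1 / (real K * real (Suc K))"
        using \<open>real K > 0\<close> by (intro divide_left_mono) (auto simp: power2_eq_square)
      ultimately show ?thesis by simp
    qed
    ultimately show ?case using step by linarith
  qed simp
  moreover have "1 / real M - 1 / real K \<le> 1 / real M" by simp
  ultimately show ?thesis by (cases "M \<le> K") (force intro: order_trans)+
qed

definition sieve_set :: "nat \<Rightarrow> nat \<Rightarrow> nat set" where
  "sieve_set r M = {n. n mod 4 = r \<and> (\<forall>m\<in>{2..M}. \<not> m\<^sup>2 dvd n)}"

lemma not_squarefree_natE:
  fixes n :: nat
  assumes "\<not> squarefree n" "n > 0"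
  obtains m where "m \<ge> 2" "m\<^sup>2 dvd n" "m \<le> n"
proof -
  obtain m where m: "m\<^sup>2 dvd n" "\<not> is_unit m" using assms(1) by (rule not_squarefreeE)
  have "m \<noteq> 0" using m assms(2) by (auto simp: power2_eq_square)
  moreover have "m \<noteq> 1" using m by auto
  ultimately have "m \<ge> 2" by simp
  have "m \<le> m\<^sup>2" by (simp add: power2_eq_square)
  also have "\<dots> \<le> n" using m(1) assms(2) by (rule dvd_imp_le)
  finally show ?thesis using that \<open>m \<ge> 2\<close> m(1) by blast
qed

lemma card_multiples_le:
  assumes "q > 0"
  shows "real (card {n. 0 < n \<and> n < N \<and> q dvd n}) \<le> real N / real q"
proof -
  have "{n. 0 < n \<and> n < N \<and> q dvd n} \<subseteq> (\<lambda>k. q * k) ` {1..N div q}"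
  proof
    fix n assume "n \<in> {n. 0 < n \<and> n < N \<and> q dvd n}"
    then obtain k where k: "n = q * k" "0 < n" "n < N" by auto
    then have "k \<in> {1..N div q}" using assms by (auto simp: less_eq_div_iff_mult_less_eq mult.commute)
    then show "n \<in> (\<lambda>k. q * k) ` {1..N div q}" using k by blast
  qed
  then have "card {n. 0 < n \<and> n < N \<and> q dvd n} \<le> card ((\<lambda>k. q * k) ` {1..N div q})"
    by (intro card_mono) auto
  also have "\<dots> \<le> N div q" using card_image_le[of "{1..N div q}" "\<lambda>k. q * k"] by simp
  finally have "real (card {n. 0 < n \<and> n < N \<and> q dvd n}) \<le> real (N div q)" by simp
  also have "\<dots> \<le> real N / real q" by (rule of_nat_div_le_of_nat)
  finally show ?thesis .
qed


text \<open>A number that survives the sieve but is not squarefree is divisible by \<open>m\<^sup>2\<close> for some \<open>m > M\<close>, and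
  the multiples of these squares below \<open>N\<close> number at most \<open>N / M\<close>.  The class \<open>r = 0\<close> is excluded
  because it contains \<open>0\<close>, a multiple of every square.\<close>

lemma squarefree_sieve_error:
  assumes "M \<ge> 1" "r \<noteq> 0" "\<And>x. \<bar>F x\<bar> \<le> B"
  shows "\<bar>(\<Sum>n | n < N \<and> squarefree n \<and> n mod 4 = r. F (\<alpha> * sqrt (real n))) / real N
      - (\<Sum>n | n < N \<and> n \<in> sieve_set r M. F (\<alpha> * sqrt (real n))) / real N\<bar> \<le> B / real M"
proof -
  define S where "S = {n. n < N \<and> squarefree n \<and> n mod 4 = r}"
  define A where "A = {n. n < N \<and> n \<in> sieve_set r M}"
  define f where "f n = F (\<alpha> * sqrt (real n))" for n :: nat
  have B: "B \<ge> 0" using assms(3)[of 0] by linarith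
  have fin: "finite A" unfolding A_def by simp
  have "S \<subseteq> A"
  proof
    fix n assume n: "n \<in> S"
    have "\<not> m\<^sup>2 dvd n" if "m \<ge> 2" for m
    proof
      assume "m\<^sup>2 dvd n"
      then have "m dvd 1" using n unfolding S_def by (auto dest: squarefreeD)
      then show False using that by simp
    qed
    then show "n \<in> A" using n unfolding S_def A_def sieve_set_def by auto
  qed
  have "A - S \<subseteq> (\<Union>m\<in>{M<..N}. {n. 0 < n \<and> n < N \<and> m\<^sup>2 dvd n})"
  proof
    fix n assume n: "n \<in> A - S"
    then have n0: "n > 0" "n < N" "\<not> squarefree n"
      using assms(2) unfolding S_def A_def sieve_set_def by (auto intro: Nat.gr0I)
    obtain m where m: "m \<ge> 2" "m\<^sup>2 dvd n" "m \<le> n" using not_squarefree_natE n0 by blast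
    have "m > M"
    proof (rule ccontr)
      assume "\<not> m > M"
      then show False using n m unfolding A_def sieve_set_def by auto
    qed
    then show "n \<in> (\<Union>m\<in>{M<..N}. {n. 0 < n \<and> n < N \<and> m\<^sup>2 dvd n})"
      using m n0 by (intro UN_I[of m]) auto
  qed
  then have "card (A - S) \<le> card (\<Union>m\<in>{M<..N}. {n. 0 < n \<and> n < N \<and> m\<^sup>2 dvd n})"
    by (intro card_mono) auto
  also have "\<dots> \<le> (\<Sum>m\<in>{M<..N}. card {n. 0 < n \<and> n < N \<and> m\<^sup>2 dvd n})"
    by (rule card_UN_le) simp
  finally have "real (card (A - S)) \<le> (\<Sum>m\<in>{M<..N}. real (card {n. 0 < n \<and> n < N \<and> m\<^sup>2 dvd n}))"
    by (simp only: of_nat_le_iff flip: of_nat_sum)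
  also have "\<dots> \<le> (\<Sum>m\<in>{M<..N}. real N / real (m\<^sup>2))"
    using assms(1) by (intro sum_mono card_multiples_le) auto
  also have "\<dots> = real N * (\<Sum>m\<in>{M<..N}. 1 / (real m)\<^sup>2)" by (simp add: sum_distrib_left)
  also have "\<dots> \<le> real N * (1 / real M)" by (intro mult_left_mono sum_inverse_squares_tail assms(1)) simp
  finally have card: "real (card (A - S)) \<le> real N / real M" by simp
  have split: "sum f A = sum f (A - S) + sum f S" using sum.subset_diff[OF \<open>S \<subseteq> A\<close> fin] .
  have "\<bar>sum f S / real N - sum f A / real N\<bar> = \<bar>sum f (A - S)\<bar> / real N"
    unfolding split add_divide_distrib by simp
  also have "\<dots> \<le> (real N / real M * B) / real N"
  proof (rule divide_right_mono)
    have "\<bar>sum f (A - S)\<bar> \<le> (\<Sum>n\<in>A - S. \<bar>f n\<bar>)" by (rule sum_abs)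
    also have "\<dots> \<le> (\<Sum>n\<in>A - S. B)" unfolding f_def using assms(3) by (intro sum_mono) auto
    also have "\<dots> = real (card (A - S)) * B" by simp
    also have "\<dots> \<le> real N / real M * B" using card B by (rule mult_right_mono)
    finally show "\<bar>sum f (A - S)\<bar> \<le> real N / real M * B" .
  qed simp
  also have "\<dots> \<le> B / real M" using B by (cases "N = 0") auto
  finally show ?thesis unfolding S_def A_def f_def .
qed

text \<open>Compare with the telescoping sum of \<open>1 / (4 i (i + 1))\<close>.\<close>

lemma sum_inverse_odd_squares: "(\<Sum>i\<in>{1..I}. 1 / (real (2 * i + 1))\<^sup>2) \<le> 1 / 4"
proof -
  have "(\<Sum>i\<in>{1..I}. 1 / (real (2 * i + 1))\<^sup>2) \<le> 1 / 4 - 1 / (4 * (real I + 1))"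
  proof (induction I)
    case (Suc I)
    have "1 / (real (2 * Suc I + 1))\<^sup>2 \<le> 1 / (4 * (real I + 1) * (real I + 2))"
    proof (rule divide_left_mono)
      show "4 * (real I + 1) * (real I + 2) \<le> (real (2 * Suc I + 1))\<^sup>2"
        by (simp add: power2_eq_square algebra_simps)
      show "0 < (real (2 * Suc I + 1))\<^sup>2 * (4 * (real I + 1) * (real I + 2))"
        by (intro mult_pos_pos zero_less_power) auto
    qed simp
    also have "\<dots> = 1 / (4 * (real I + 1)) - 1 / (4 * (real (Suc I) + 1))"
    proof -
      have "1 / x - 1 / (x + 1) = 1 / (x * (x + 1))" if "x > 0" for x :: real
        using that by (simp add: field_simps)
      from this[of "real I + 1"]
      have "1 / (real I + 1) - 1 / (real I + 2) = 1 / ((real I + 1) * (real I + 2))"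
        by (simp add: add.assoc)
      moreover have "1 / (4 * (real I + 1) * (real I + 2)) = 1 / ((real I + 1) * (real I + 2)) / 4"
        by (simp only: divide_divide_eq_left mult_ac)
      moreover have "1 / (4 * (real I + 1)) = 1 / (real I + 1) / 4"
        "1 / (4 * (real (Suc I) + 1)) = 1 / (real I + 2) / 4" by (simp_all add: add.commute)
      ultimately show ?thesis by (simp only: flip: diff_divide_distrib)
    qed
    finally show ?case using Suc by simp
  qed simp
  then show ?thesis by (rule order_trans) simp
qed

text \<open>A square dividing a number that is not divisible by \<open>4\<close> is odd.  Since \<open>m\<^sup>2 \<equiv> 1\<close> modulo \<open>4\<close> for odd
  \<open>m = 2 i + 1\<close>, the multiples of \<open>m\<^sup>2\<close> in the class of \<open>r\<close> have density \<open>1 / (4 m\<^sup>2)\<close>, in total at most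
  \<open>1/16\<close>, against the density \<open>1/4\<close> of the class.\<close>

lemma squarefree_residue_class_count:
  assumes "r \<in> {1, 2, 3}"
  shows "real (card {n. n < N \<and> squarefree n \<and> n mod 4 = r}) \<ge> 3 / 16 * real N - 2 * sqrt (real N) - 1"
proof -
  define I where "I = nat \<lfloor>sqrt (real N)\<rfloor>"
  have I: "real I \<le> sqrt (real N)" unfolding I_def by simp
  define A where "A = {n. n < N \<and> n mod 4 = r}"
  define S where "S = {n. n < N \<and> squarefree n \<and> n mod 4 = r}"
  define C where "C i = {n. n < N \<and> n mod 4 = r \<and> (2 * i + 1)\<^sup>2 dvd n}" for i :: nat
  have cardC: "real (card (C i)) \<le> real N / 4 * (1 / (real (2 * i + 1))\<^sup>2) + 2" for i
  proof -
    define m where "m = (2 * i + 1)\<^sup>2"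
    have m4: "m = 4 * (i * i + i) + 1" unfolding m_def by (simp add: power2_eq_square algebra_simps)
    then have m: "m > 0" "m mod 4 = 1" by (simp, simp only: mod_mult_self4) simp
    have "C i \<subseteq> (\<lambda>k. m * k) ` {k. k < N div m + 1 \<and> k mod 4 = r}"
    proof
      fix n assume n: "n \<in> C i"
      then obtain k where k: "n = m * k" unfolding C_def m_def by auto
      have "k mod 4 = r" using n m(2) unfolding C_def k by (metis (mono_tags, lifting) mem_Collect_eq mod_mult_left_eq mult_1)
      moreover have "k \<le> N div m"
        using n m(1) unfolding C_def k by (simp add: less_eq_div_iff_mult_less_eq mult.commute)
      ultimately show "n \<in> (\<lambda>k. m * k) ` {k. k < N div m + 1 \<and> k mod 4 = r}"
        unfolding k by (intro imageI) simp
    qed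
    then have "card (C i) \<le> card ((\<lambda>k. m * k) ` {k. k < N div m + 1 \<and> k mod 4 = r})"
      by (intro card_mono) auto
    also have "\<dots> \<le> card {k. k < N div m + 1 \<and> k mod 4 = r}" by (intro card_image_le) auto
    finally have "card (C i) \<le> card {k. k < N div m + 1 \<and> k mod 4 = r}" .
    then have "real (card (C i)) \<le> real (card {k. k < N div m + 1 \<and> k mod 4 = r})" by simp
    also have "\<dots> \<le> real (N div m + 1) / real 4 + 1"
      by (rule card_residue_class_bounds) (use assms in auto)
    also have "\<dots> \<le> (real N / real m + 1) / 4 + 1"
      unfolding of_nat_add of_nat_1 of_nat_numeral
      by (intro add_right_mono divide_right_mono of_nat_div_le_of_nat) simp
    finally show ?thesis unfolding m_def by (simp add: add_divide_distrib)
  qed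
  have "A - S \<subseteq> (\<Union>i\<in>{1..I}. C i)"
  proof
    fix n assume n: "n \<in> A - S"
    then have n0: "n > 0" "n < N" "\<not> squarefree n" "n mod 4 = r"
      using assms unfolding A_def S_def by (auto intro: Nat.gr0I)
    obtain m where m: "m \<ge> 2" "m\<^sup>2 dvd n" using not_squarefree_natE n0 by blast
    have "odd m"
    proof
      assume "even m"
      then have "2\<^sup>2 dvd m\<^sup>2" by (rule dvd_power_same)
      then have "4 dvd n" using m(2) by (simp add: dvd_trans)
      then show False using n0(4) assms by auto
    qed
    then obtain i where i: "m = 2 * i + 1" by (elim oddE)
    have "m\<^sup>2 \<le> N" using dvd_imp_le[OF m(2) n0(1)] n0(2) by simp
    then have "real m \<le> sqrt (real N)" by (metis of_nat_le_iff of_nat_power real_le_rsqrt)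
    then have "i \<le> I" using i unfolding I_def by linarith
    then show "n \<in> (\<Union>i\<in>{1..I}. C i)" using m n0 i unfolding C_def by auto
  qed
  then have "card (A - S) \<le> card (\<Union>i\<in>{1..I}. C i)"
    by (intro card_mono) (auto simp: C_def)
  also have "\<dots> \<le> (\<Sum>i\<in>{1..I}. card (C i))" by (rule card_UN_le) simp
  finally have "real (card (A - S)) \<le> (\<Sum>i\<in>{1..I}. real (card (C i)))"
    by (simp only: of_nat_le_iff flip: of_nat_sum)
  also have "\<dots> \<le> (\<Sum>i\<in>{1..I}. real N / 4 * (1 / (real (2 * i + 1))\<^sup>2) + 2)"
    by (intro sum_mono cardC)
  also have "\<dots> = real N / 4 * (\<Sum>i\<in>{1..I}. 1 / (real (2 * i + 1))\<^sup>2) + 2 * real I"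
    by (simp add: sum.distrib sum_distrib_left)
  also have "\<dots> \<le> real N / 4 * (1 / 4) + 2 * sqrt (real N)"
    using I by (intro add_mono mult_left_mono sum_inverse_odd_squares) auto
  finally have bad: "real (card (A - S)) \<le> real N / 16 + 2 * sqrt (real N)" by simp
  have "S \<subseteq> A" "finite A" unfolding S_def A_def by auto
  then have "real (card (A - S)) = real (card A) - real (card S)"
    by (metis card_Diff_subset card_mono finite_subset of_nat_diff)
  moreover have "real (card A) \<ge> real N / real 4 - 1"
    unfolding A_def by (rule card_residue_class_bounds) (use assms in auto)
  ultimately have "real (card S) \<ge> 3 / 16 * real N - 2 * sqrt (real N) - 1" using bad by simp
  then show ?thesis unfolding S_def .
qed

text \<open>The limits for the sieved sets are \<open>d M \<integral>F\<close>; the sieve error is uniform in \<open>N\<close>, so the limits in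
  \<open>N\<close> and \<open>M\<close> may be interchanged.\<close>

theorem sqrt_squarefree_equidistributed:
  assumes "r \<in> {1, 2, 3}"
  obtains \<delta> :: real where "\<delta> > 0"
    "\<And>F \<alpha>. circle_fun F \<Longrightarrow> \<alpha> \<noteq> 0 \<Longrightarrow>
       (\<lambda>N. (\<Sum>n | n < N \<and> squarefree n \<and> n mod 4 = r. F (\<alpha> * sqrt (real n))) / real N)
         \<longlonglongrightarrow> \<delta> * integral {0..1} F"
proof -
  have r: "r \<noteq> 0" using assms by auto
  \<comment> \<open>A period of the sieved set: \<open>4\<close> for the class, \<open>(M!)\<^sup>2\<close> for divisibility by \<open>m\<^sup>2\<close>.\<close>
  define Q :: "nat \<Rightarrow> nat" where "Q M = 4 * (fact M)\<^sup>2" for M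
  define d where "d M = real (card (sieve_set r M \<inter> {..<Q M})) / real (Q M)" for M
  have lim: "(\<lambda>N. (\<Sum>n | n < N \<and> n \<in> sieve_set r M. F (\<alpha> * sqrt (real n))) / real N)
      \<longlonglongrightarrow> d M * integral {0..1} F" if "circle_fun F" "\<alpha> \<noteq> 0" for F \<alpha> M
    unfolding d_def
  proof (rule sqrt_equidistributed_periodic_set[OF that])
    show "Q M > 0" by (simp add: Q_def)
    fix n
    have "n mod Q M mod 4 = n mod 4" by (simp add: Q_def mod_mod_cancel)
    moreover have "m\<^sup>2 dvd n mod Q M \<longleftrightarrow> m\<^sup>2 dvd n" if "m \<in> {2..M}" for m
    proof -
      have "m dvd fact M" using that by (intro dvd_fact) auto
      then have "m\<^sup>2 dvd Q M" unfolding Q_def by (intro dvd_mult dvd_power_same)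
      then show ?thesis by (rule dvd_mod_iff)
    qed
    ultimately show "n \<in> sieve_set r M \<longleftrightarrow> n mod Q M \<in> sieve_set r M"
      unfolding sieve_set_def by simp
  qed
  have one: "circle_fun (\<lambda>_. 1)" by (simp add: circle_fun_def)
  have "d (Suc M) \<le> d M" for M
  proof -
    have "sieve_set r (Suc M) \<subseteq> sieve_set r M" unfolding sieve_set_def by auto
    then have "(\<Sum>n | n < N \<and> n \<in> sieve_set r (Suc M). 1 :: real) / real N \<le> (\<Sum>n | n < N \<and> n \<in> sieve_set r M. 1) / real N" for N
      by (intro divide_right_mono sum_mono2) auto
    then show ?thesis using LIMSEQ_le[OF lim[OF one, of 1 "Suc M"] lim[OF one, of 1 M]] by auto
  qed
  then have "decseq d" by (rule decseq_SucI)
  moreover have "d M \<ge> 0" for M unfolding d_def by simp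
  ultimately obtain \<delta> where \<delta>: "d \<longlonglongrightarrow> \<delta>" using decseq_convergent[of d 0] by blast
  have main: "(\<lambda>N. (\<Sum>n | n < N \<and> squarefree n \<and> n mod 4 = r. F (\<alpha> * sqrt (real n))) / real N)
         \<longlonglongrightarrow> \<delta> * integral {0..1} F" if "circle_fun F" "\<alpha> \<noteq> 0" for F \<alpha>
  proof (rule LIMSEQ_I)
    note F = that
    fix \<epsilon> :: real assume \<epsilon>: "\<epsilon> > 0"
    define J where "J = integral {0..1} F"
    define x where "x N = (\<Sum>n | n < N \<and> squarefree n \<and> n mod 4 = r. F (\<alpha> * sqrt (real n))) / real N" for N
    define y where "y M N = (\<Sum>n | n < N \<and> n \<in> sieve_set r M. F (\<alpha> * sqrt (real n))) / real N" for M N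
    obtain B where B: "\<And>x. \<bar>F x\<bar> \<le> B" using circle_fun_bounded[OF F(1)] by blast
    have "(\<lambda>M. B / real M) \<longlonglongrightarrow> 0" by real_asymp
    then have "\<forall>\<^sub>F M in sequentially. B / real M < \<epsilon> / 3" by (rule order_tendstoD) (use \<epsilon> in simp)
    moreover have "\<forall>\<^sub>F M in sequentially. \<bar>d M * J - \<delta> * J\<bar> < \<epsilon> / 3"
      using tendstoD[OF tendsto_mult_right[OF \<delta>, of J], of "\<epsilon> / 3"] \<epsilon> by (simp add: dist_real_def)
    ultimately have "\<forall>\<^sub>F M in sequentially. B / real M < \<epsilon> / 3 \<and> \<bar>d M * J - \<delta> * J\<bar> < \<epsilon> / 3 \<and> M \<ge> 1"
      using eventually_ge_at_top[of 1] by eventually_elim simp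
    then obtain M where M: "B / real M < \<epsilon> / 3" "\<bar>d M * J - \<delta> * J\<bar> < \<epsilon> / 3" "M \<ge> 1"
      using eventually_happens'[OF sequentially_bot] by blast
    have "y M \<longlonglongrightarrow> d M * J" unfolding y_def J_def by (rule lim[OF F])
    then obtain K where "\<forall>N\<ge>K. norm (y M N - d M * J) < \<epsilon> / 3"
      using LIMSEQ_D[of "y M" "d M * J" "\<epsilon> / 3"] \<epsilon> by force
    then have K: "\<And>N. N \<ge> K \<Longrightarrow> \<bar>y M N - d M * J\<bar> < \<epsilon> / 3" by simp
    have "\<bar>x N - y M N\<bar> \<le> B / real M" for N
      unfolding x_def y_def by (rule squarefree_sieve_error[OF M(3) r B])
    then have "\<bar>x N - \<delta> * J\<bar> < \<epsilon>" if "N \<ge> K" for N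
      using K[OF that] M(1,2) \<open>\<bar>x N - y M N\<bar> \<le> B / real M\<close> by linarith
    then show "\<exists>no. \<forall>N\<ge>no. norm ((\<Sum>n | n < N \<and> squarefree n \<and> n mod 4 = r. F (\<alpha> * sqrt (real n))) / real N
        - \<delta> * integral {0..1} F) < \<epsilon>"
      unfolding x_def J_def real_norm_def by blast
  qed
  have "\<delta> * integral {0..1} (\<lambda>_::real. 1) \<ge> 3 / 16"
  proof (rule LIMSEQ_le[OF _ main[OF one, of 1]])
    show "(\<lambda>N. (3 / 16 * real N - 2 * sqrt (real N) - 1) / real N) \<longlonglongrightarrow> 3 / 16" by real_asymp
    show "\<exists>K. \<forall>N\<ge>K. (3 / 16 * real N - 2 * sqrt (real N) - 1) / real N \<le>
        (\<Sum>n | n < N \<and> squarefree n \<and> n mod 4 = r. 1) / real N"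
      using squarefree_residue_class_count[OF assms] by (auto intro!: divide_right_mono exI[of _ 0])
  qed simp
  then have "\<delta> > 0" by simp
  then show ?thesis using that main by blast
qed

text \<open>The cutoff \<open>c n \<le> T\<close> is the cutoff \<open>n < K\<close> with \<open>K\<close> within \<open>1\<close> of \<open>T / c\<close>.\<close>

lemma sum_upto_real_limit:
  fixes f :: "nat \<Rightarrow> real"
  assumes "(\<lambda>N. (\<Sum>n | n < N \<and> P n. f n) / real N) \<longlonglongrightarrow> l" "c > 0"
  shows "((\<lambda>T. (\<Sum>n | c * real n \<le> T \<and> P n. f n) / T) \<longlongrightarrow> l / c) at_top"
proof -
  define K where "K T = nat \<lfloor>T / c\<rfloor> + 1" for T
  have Kb: "real (K T) > T / c" "T \<ge> 0 \<Longrightarrow> real (K T) \<le> T / c + 1" for T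
    unfolding K_def using assms(2) by linarith (simp add: assms(2) less_imp_le)
  have set: "{n. c * real n \<le> T \<and> P n} = {n. n < K T \<and> P n}" if "T \<ge> 0" for T
  proof -
    have "c * real n \<le> T \<longleftrightarrow> n < K T" for n
    proof -
      have "c * real n \<le> T \<longleftrightarrow> real n \<le> T / c" using assms(2) by (simp add: field_simps)
      also have "\<dots> \<longleftrightarrow> int n \<le> \<lfloor>T / c\<rfloor>" by (simp add: le_floor_iff)
      also have "\<dots> \<longleftrightarrow> n < K T" unfolding K_def using that assms(2) by (auto simp: nat_le_iff le_nat_iff less_Suc_eq_le)
      finally show ?thesis .
    qed
    then show ?thesis by simp
  qed
  have lK: "((\<lambda>T. real (K T) / T) \<longlongrightarrow> 1 / c) at_top"
  proof (rule tendsto_sandwich)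
    show "((\<lambda>T. (T / c) / T) \<longlongrightarrow> 1 / c) at_top" using assms(2) by real_asymp (simp add: divide_inverse)
    show "((\<lambda>T. (T / c + 1) / T) \<longlongrightarrow> 1 / c) at_top" using assms(2) by real_asymp (simp add: divide_inverse)
    show "\<forall>\<^sub>F T in at_top. (T / c) / T \<le> real (K T) / T"
      using eventually_ge_at_top[of 0] by eventually_elim (rule divide_right_mono[OF less_imp_le[OF Kb(1)]])
    show "\<forall>\<^sub>F T in at_top. real (K T) / T \<le> (T / c + 1) / T"
      using eventually_ge_at_top[of 0] by eventually_elim (intro divide_right_mono Kb(2), simp_all)
  qed
  have "filterlim (\<lambda>T. T / c) at_top at_top" using assms(2) by real_asymp
  then have "filterlim (\<lambda>T. real (K T)) at_top at_top"
    by (rule filterlim_at_top_mono) (use Kb(1) in \<open>simp add: less_imp_le\<close>)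
  then have fK: "filterlim K at_top at_top"
    by (simp add: filterlim_sequentially_iff_filterlim_real)
  have "((\<lambda>T. (\<Sum>n | n < K T \<and> P n. f n) / real (K T) * (real (K T) / T)) \<longlongrightarrow> l * (1 / c)) at_top"
    by (intro tendsto_mult lK filterlim_compose[OF assms(1) fK])
  moreover have "\<forall>\<^sub>F T in at_top. (\<Sum>n | n < K T \<and> P n. f n) / real (K T) * (real (K T) / T) =
      (\<Sum>n | c * real n \<le> T \<and> P n. f n) / T"
    using eventually_ge_at_top[of 0] by eventually_elim (simp add: set K_def)
  ultimately have "((\<lambda>T. (\<Sum>n | c * real n \<le> T \<and> P n. f n) / T) \<longlongrightarrow> l * (1 / c)) at_top"
    by (rule Lim_transform_eventually)
  then show ?thesis by simp
qed


section \<open>Plane lattices in coordinates adapted to the line\<close>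

definition mat2 :: "real \<Rightarrow> real \<Rightarrow> real \<Rightarrow> real \<Rightarrow> real^2^2" where
  "mat2 a b c d = vector [vector [a, b], vector [c, d]]"

lemma mat2_nth [simp]:
  "mat2 a b c d $ 1 $ 1 = a" "mat2 a b c d $ 1 $ 2 = b"
  "mat2 a b c d $ 2 $ 1 = c" "mat2 a b c d $ 2 $ 2 = d"
  by (simp_all add: mat2_def)

lemma mat2_collapse: "mat2 (g $ 1 $ 1) (g $ 1 $ 2) (g $ 2 $ 1) (g $ 2 $ 2) = g"
  by (simp add: vec_eq_iff forall_2)

lemma mat2_eq_iff: "g = h \<longleftrightarrow> g $ 1 $ 1 = h $ 1 $ 1 \<and> g $ 1 $ 2 = h $ 1 $ 2 \<and>
    g $ 2 $ 1 = h $ 2 $ 1 \<and> g $ 2 $ 2 = (h :: real^2^2) $ 2 $ 2"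
  by (auto simp: vec_eq_iff forall_2)

lemma mat2_mult: "mat2 a b c d ** mat2 a' b' c' d' =
    mat2 (a * a' + b * c') (a * b' + b * d') (c * a' + d * c') (c * b' + d * d')"
  by (simp add: mat2_eq_iff matrix_matrix_mult_def sum_2)

lemma mat2_vec: "mat2 a b c d *v x = vector [a * x $ 1 + b * x $ 2, c * x $ 1 + d * x $ 2]"
  by (simp add: vec_eq_iff forall_2 matrix_vector_mult_def sum_2)

lemma mat2_one: "mat 1 = mat2 1 0 0 1"
  by (simp add: mat2_eq_iff mat_def)

lemma det_mat2: "det (mat2 a b c d) = a * d - b * c"
  by (simp add: det_2)

lemma tendsto_matrix_mult:
  fixes X Y :: "'b \<Rightarrow> real^2^2"
  assumes "(X \<longlongrightarrow> A) F" "(Y \<longlongrightarrow> B) F"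
  shows "((\<lambda>n. X n ** Y n) \<longlongrightarrow> A ** B) F"
  unfolding matrix_matrix_mult_def using assms
  by (intro vec_tendstoI) (auto intro!: tendsto_sum tendsto_mult tendsto_vec_nth)

lemma tendsto_mat2:
  assumes "(a \<longlongrightarrow> a') F" "(b \<longlongrightarrow> b') F" "(c \<longlongrightarrow> c') F" "(d \<longlongrightarrow> d') F"
  shows "((\<lambda>n. mat2 (a n) (b n) (c n) (d n)) \<longlongrightarrow> mat2 a' b' c' d') F"
proof (intro vec_tendstoI)
  show "((\<lambda>n. mat2 (a n) (b n) (c n) (d n) $ i $ j) \<longlongrightarrow> mat2 a' b' c' d' $ i $ j) F" for i j
    using assms exhaust_2[of i] exhaust_2[of j] by auto
qed

lemma act_lattice_of_mat: "act h (lattice_of_mat g) = lattice_of_mat (h ** g)"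
  unfolding act_def lattice_of_mat_def by (auto simp: matrix_vector_mul_assoc image_iff) (metis matrix_vector_mul_assoc)

lemma scale_lattice_of_mat: "(\<lambda>v. k *\<^sub>R v) ` lattice_of_mat g = lattice_of_mat (k *\<^sub>R g)"
  unfolding lattice_of_mat_def by (auto simp: scaleR_matrix_vector_assoc image_iff) (metis scaleR_matrix_vector_assoc)

lemma lattice_of_mat_mult_subset:
  assumes "\<And>i j. A $ i $ j \<in> \<int>"
  shows "lattice_of_mat (g ** A) \<subseteq> lattice_of_mat g"
proof
  fix v assume "v \<in> lattice_of_mat (g ** A)"
  then obtain x where x: "v = g *v (A *v x)" "\<forall>i. x $ i \<in> \<int>"
    unfolding lattice_of_mat_def by (auto simp: matrix_vector_mul_assoc)
  have "\<forall>i. (A *v x) $ i \<in> \<int>"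
    using x(2) assms by (auto simp: matrix_vector_mult_def intro!: Ints_sum Ints_mult)
  then show "v \<in> lattice_of_mat g" unfolding lattice_of_mat_def x(1) by blast
qed

text \<open>The adjugate, up to the sign \<open>det A\<close>, is an integer inverse of \<open>A\<close>.\<close>

lemma lattice_of_mat_unimodular:
  assumes "\<And>i j. A $ i $ j \<in> \<int>" "det A = 1 \<or> det A = -1"
  shows "lattice_of_mat (g ** A) = lattice_of_mat g"
proof
  show "lattice_of_mat (g ** A) \<subseteq> lattice_of_mat g" by (rule lattice_of_mat_mult_subset[OF assms(1)])
  define B where "B = det A *\<^sub>R mat2 (A $ 2 $ 2) (- A $ 1 $ 2) (- A $ 2 $ 1) (A $ 1 $ 1)"
  have "det A \<in> \<int>" using assms(2) by auto
  then have B: "B $ i $ j \<in> \<int>" for i j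
    using exhaust_2[of i] exhaust_2[of j] assms(1) unfolding B_def by (auto intro!: Ints_mult)
  have d: "det A * det A = 1" using assms(2) by auto
  have "A ** B = mat 1"
  proof -
    have "A ** B = det A *\<^sub>R mat2 (det A) 0 0 (det A)"
      unfolding B_def mat2_eq_iff by (simp add: matrix_matrix_mult_def sum_2 det_2 algebra_simps)
    also have "\<dots> = mat 1" unfolding mat2_one mat2_eq_iff using d by simp
    finally show ?thesis .
  qed
  then have "g = (g ** A) ** B" by (simp flip: matrix_mul_assoc)
  then show "lattice_of_mat g \<subseteq> lattice_of_mat (g ** A)"
    using lattice_of_mat_mult_subset[of B "g ** A"] B by simp
qed

definition frame_cos :: "nat \<Rightarrow> real" where "frame_cos s = (if s = 0 then 1 / sqrt 2 else 1)"
definition frame_sin :: "nat \<Rightarrow> real" where "frame_sin s = (if s = 0 then 1 / sqrt 2 else 0)"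

text \<open>The rotation taking the first coordinate axis to the line.\<close>

definition frame :: "nat \<Rightarrow> real^2^2" where
  "frame s = mat2 (frame_cos s) (- frame_sin s) (frame_sin s) (frame_cos s)"

definition frame_inv :: "nat \<Rightarrow> real^2^2" where
  "frame_inv s = mat2 (frame_cos s) (frame_sin s) (- frame_sin s) (frame_cos s)"

lemma frame_cos_sin: "frame_cos s * frame_cos s + frame_sin s * frame_sin s = 1"
  by (simp add: frame_cos_def frame_sin_def)

lemma det_frame: "det (frame s) = 1"
  using frame_cos_sin[of s] by (simp add: frame_def det_mat2)

lemma det_frame_inv: "det (frame_inv s) = 1"
  using frame_cos_sin[of s] by (simp add: frame_inv_def det_mat2)

lemma frame_inverse: "frame s ** frame_inv s = mat 1" "frame_inv s ** frame s = mat 1"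
  using frame_cos_sin[of s]
  by (simp_all add: frame_def frame_inv_def mat2_mult mat2_one mult.commute add.commute)

lemma frame_inverse_mult [simp]:
  "frame s ** (frame_inv s ** g) = g" "frame_inv s ** (frame s ** g) = g"
  by (simp_all add: matrix_mul_assoc frame_inverse)

lemma frame_inverse_vec [simp]:
  "frame s *v (frame_inv s *v x) = x" "frame_inv s *v (frame s *v x) = x"
  by (simp_all add: matrix_vector_mul_assoc frame_inverse)

lemma frame_vec_eq_iff: "frame s *v x = frame s *v y \<longleftrightarrow> x = y"
  by (metis frame_inverse_vec(2))

lemma inner_frame: "(frame s *v x) \<bullet> (frame s *v y) = x \<bullet> y"
proof -
  have "(frame s *v x) \<bullet> (frame s *v y) =
      (frame_cos s * frame_cos s + frame_sin s * frame_sin s) * (x $ 1 * y $ 1 + x $ 2 * y $ 2)"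
    by (simp add: frame_def mat2_vec inner_vec_def sum_2 algebra_simps)
  then show ?thesis unfolding frame_cos_sin by (simp add: inner_vec_def sum_2)
qed

lemma norm_frame: "norm (frame s *v x) = norm x"
  by (simp add: norm_eq_sqrt_inner inner_frame)

lemma ell_frame: "ell s = {frame s *v vector [k, 0] | k. True}"
proof -
  define \<rho> where "\<rho> = (if s = 0 then sqrt 2 else 1)"
  have "one_bar s = frame s *v vector [\<rho>, 0]"
    by (simp add: one_bar_def frame_def mat2_vec frame_cos_def frame_sin_def \<rho>_def vec_eq_iff forall_2)
  then have "k *\<^sub>R one_bar s = frame s *v vector [k * \<rho>, 0]" for k
    by (simp add: frame_def mat2_vec vec_eq_iff forall_2)
  moreover have "\<rho> \<noteq> 0" by (simp add: \<rho>_def)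
  then have "\<exists>k'. k = k' * \<rho>" for k by (intro exI[of _ "k / \<rho>"]) simp
  ultimately show ?thesis unfolding ell_def span_singleton by (auto simp: image_iff) metis+
qed

lemma vector2_collapse: "(vector [x $ 1, x $ 2] :: real^2) = x"
  by (simp add: vec_eq_iff forall_2)

lemma frame_in_ell: "frame s *v x \<in> ell s \<longleftrightarrow> x $ 2 = 0"
proof
  assume "frame s *v x \<in> ell s"
  then show "x $ 2 = 0" unfolding ell_frame by (auto simp: frame_vec_eq_iff)
next
  assume "x $ 2 = 0"
  then have "frame s *v x = frame s *v vector [x $ 1, 0]" by (metis vector2_collapse)
  then show "frame s *v x \<in> ell s" unfolding ell_frame by blast
qed

lemma lattice_frame_iff:
  "v \<in> lattice_of_mat (frame s ** mat2 a b c d) \<longleftrightarrow>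
     (\<exists>m n. v = frame s *v vector [a * of_int m + b * of_int n, c * of_int m + d * of_int n])"
proof
  assume "v \<in> lattice_of_mat (frame s ** mat2 a b c d)"
  then obtain x where x: "v = frame s *v (mat2 a b c d *v x)" "x $ 1 \<in> \<int>" "x $ 2 \<in> \<int>"
    unfolding lattice_of_mat_def by (auto simp: matrix_vector_mul_assoc)
  obtain m n where "x $ 1 = of_int m" "x $ 2 = of_int n" using x(2,3) by (meson Ints_cases)
  then have "v = frame s *v vector [a * of_int m + b * of_int n, c * of_int m + d * of_int n]"
    unfolding x(1) mat2_vec by simp
  then show "\<exists>m n. v = frame s *v vector [a * of_int m + b * of_int n, c * of_int m + d * of_int n]"
    by blast
next
  assume "\<exists>m n. v = frame s *v vector [a * of_int m + b * of_int n, c * of_int m + d * of_int n]"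
  then obtain m n where "v = (frame s ** mat2 a b c d) *v vector [of_int m, of_int n]"
    by (auto simp: mat2_vec simp flip: matrix_vector_mul_assoc)
  moreover have "\<forall>i. (vector [of_int m, of_int n] :: real^2) $ i \<in> \<int>" by (simp add: forall_2)
  ultimately show "v \<in> lattice_of_mat (frame s ** mat2 a b c d)" unfolding lattice_of_mat_def by blast
qed

section \<open>The circle of lattices\<close>

definition circle_lattice :: "nat \<Rightarrow> real \<Rightarrow> (real^2) set" where
  "circle_lattice s x = lattice_of_mat (frame s ** mat2 1 x 0 1)"

text \<open>The matrix fixing the line pointwise and moving the orthogonal unit vector by \<open>y\<close> units along it.\<close>

definition shear :: "nat \<Rightarrow> real \<Rightarrow> real^2^2" where
  "shear s y = frame s ** mat2 1 y 0 1 ** frame_inv s"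

lemma frame_shear_SL2: "frame s ** mat2 1 x 0 1 \<in> SL2"
  by (simp add: SL2_def det_mul det_frame det_mat2)

lemma circle_lattice_X2: "circle_lattice s x \<in> topspace X2"
  unfolding circle_lattice_def topspace_X2 unimodular_lattices_eq using frame_shear_SL2 by blast

lemma act_shear: "act (shear s y) (circle_lattice s x) = circle_lattice s (x + y)"
  unfolding circle_lattice_def act_lattice_of_mat shear_def
  by (simp add: mat2_mult flip: matrix_mul_assoc)

lemma circle_lattice_eq_iff: "circle_lattice s x = circle_lattice s y \<longleftrightarrow> x - y \<in> \<int>"
proof
  assume eq: "circle_lattice s x = circle_lattice s y"
  have "frame s *v vector [1 * of_int 0 + x * of_int 1, 0 * of_int 0 + 1 * of_int 1] \<in> circle_lattice s x"
    unfolding circle_lattice_def lattice_frame_iff by blast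
  then obtain m n where "frame s *v vector [1 * of_int 0 + x * of_int 1, 0 * of_int 0 + 1 * of_int 1] =
      frame s *v vector [1 * of_int m + y * of_int n, 0 * of_int m + 1 * of_int n]"
    unfolding eq unfolding circle_lattice_def lattice_frame_iff by blast
  then have "x = of_int m + y * of_int n" "of_int n = (1 :: real)"
    unfolding frame_vec_eq_iff by (simp_all add: vec_eq_iff forall_2)
  then have "x = of_int m + y" by simp
  then show "x - y \<in> \<int>" by simp
next
  assume "x - y \<in> \<int>"
  then obtain k where k: "x = y + of_int k" by (metis Ints_cases diff_add_cancel add.commute)
  have "frame s ** mat2 1 x 0 1 = (frame s ** mat2 1 y 0 1) ** mat2 1 (of_int k) 0 1"
    by (simp add: mat2_mult k add.commute flip: matrix_mul_assoc)
  moreover have "mat2 1 (of_int k) 0 1 $ i $ j \<in> \<int>" for i j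
    using exhaust_2[of i] exhaust_2[of j] by auto
  ultimately show "circle_lattice s x = circle_lattice s y"
    unfolding circle_lattice_def using lattice_of_mat_unimodular by (simp add: det_mat2)
qed

lemma circle_lattice_in_Y1: "circle_lattice s x \<in> Y1 s"
proof -
  define v where "v = frame s *v vector [1, 0]"
  have "norm v = 1" unfolding v_def norm_frame by (simp add: norm_vec_def L2_set_def sum_2)
  moreover have "circle_lattice s x \<inter> ell s = {of_int k *\<^sub>R v | k :: int. True}"
  proof -
    have kv: "of_int k *\<^sub>R v = frame s *v vector [of_int k, 0]" for k
      by (simp add: v_def frame_def mat2_vec vec_eq_iff forall_2)
    have "w \<in> circle_lattice s x \<inter> ell s \<longleftrightarrow> (\<exists>k. w = frame s *v vector [of_int k, 0])" for w
    proof
      assume "w \<in> circle_lattice s x \<inter> ell s"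
      then obtain m n where "w = frame s *v vector [1 * of_int m + x * of_int n, 0 * of_int m + 1 * of_int n]"
          "w \<in> ell s"
        unfolding circle_lattice_def using lattice_frame_iff by blast
      then show "\<exists>k. w = frame s *v vector [of_int k, 0]" by (auto simp: frame_in_ell)
    next
      assume "\<exists>k. w = frame s *v vector [of_int k, 0]"
      then obtain k where "w = frame s *v vector [1 * of_int k + x * of_int 0, 0 * of_int k + 1 * of_int 0]" by auto
      then have "w \<in> circle_lattice s x" "w \<in> ell s"
        unfolding circle_lattice_def lattice_frame_iff by (blast, simp add: frame_in_ell)
      then show "w \<in> circle_lattice s x \<inter> ell s" by blast
    qed
    then show ?thesis unfolding kv by blast
  qed
  ultimately show ?thesis unfolding Y1_def using circle_lattice_X2 by blast
qed

text \<open>A generator of \<open>\<Lambda> \<inter> \<ell>\<close> is primitive in \<open>\<Lambda>\<close>, so Bezout's identity completes it to a basis.\<close>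

lemma Y1_eq: "Y1 s = range (circle_lattice s)"
proof
  show "range (circle_lattice s) \<subseteq> Y1 s" using circle_lattice_in_Y1 by blast
  show "Y1 s \<subseteq> range (circle_lattice s)"
  proof
    fix \<Lambda> assume "\<Lambda> \<in> Y1 s"
    then obtain v where \<Lambda>: "\<Lambda> \<in> topspace X2" and v: "norm v = 1" "\<Lambda> \<inter> ell s = {of_int k *\<^sub>R v | k :: int. True}"
      unfolding Y1_def by blast
    obtain g where g: "\<Lambda> = lattice_of_mat g" "det g = 1"
      using \<Lambda> unfolding topspace_X2 unimodular_lattices_eq SL2_def by auto
    define M where "M = frame_inv s ** g"
    have gM: "g = frame s ** mat2 (M $ 1 $ 1) (M $ 1 $ 2) (M $ 2 $ 1) (M $ 2 $ 2)"
      unfolding mat2_collapse M_def by simp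
    have detM: "det M = 1" unfolding M_def using g by (simp add: det_mul det_frame_inv)
    have "v = of_int 1 *\<^sub>R v" by simp
    then have vin: "v \<in> \<Lambda>" "v \<in> ell s" using v(2) by blast+
    obtain p q :: int where pq: "v = frame s *v vector [M $ 1 $ 1 * of_int p + M $ 1 $ 2 * of_int q,
        M $ 2 $ 1 * of_int p + M $ 2 $ 2 * of_int q]"
      using vin(1) lattice_frame_iff unfolding g(1) gM by blast
    define \<alpha> where "\<alpha> = M $ 1 $ 1 * of_int p + M $ 1 $ 2 * of_int q"
    have z: "M $ 2 $ 1 * of_int p + M $ 2 $ 2 * of_int q = 0"
      using vin(2) unfolding pq frame_in_ell by simp
    have v': "v = frame s *v vector [\<alpha>, 0]" unfolding pq z \<alpha>_def ..
    have "\<bar>\<alpha>\<bar> = 1" using v(1) unfolding v' norm_frame by (simp add: norm_vec_def L2_set_def sum_2)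
    have "v \<noteq> 0" using v(1) by auto
    have "\<bar>gcd p q\<bar> = 1"
    proof -
      define e where "e = gcd p q"
      have "e \<noteq> 0"
      proof
        assume "e = 0"
        then have "\<alpha> = 0" unfolding e_def \<alpha>_def by simp
        then show False using \<open>\<bar>\<alpha>\<bar> = 1\<close> by simp
      qed
      obtain p' q' where p': "p = e * p'" "q = e * q'" unfolding e_def by (meson dvdE gcd_dvd1 gcd_dvd2)
      define w where "w = frame s *v vector [M $ 1 $ 1 * of_int p' + M $ 1 $ 2 * of_int q',
        M $ 2 $ 1 * of_int p' + M $ 2 $ 2 * of_int q']"
      have "w \<in> \<Lambda>" unfolding w_def g(1) gM lattice_frame_iff mat2_nth by blast
      have "of_int e * (M $ 2 $ 1 * of_int p' + M $ 2 $ 2 * of_int q') = 0"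
        using z unfolding p' by (simp add: algebra_simps)
      then have "w \<in> ell s" using \<open>e \<noteq> 0\<close> unfolding w_def frame_in_ell by simp
      then obtain k :: int where k: "w = of_int k *\<^sub>R v" using \<open>w \<in> \<Lambda>\<close> v(2) by blast
      have "of_int e *\<^sub>R w = v"
        unfolding w_def pq p' by (simp add: frame_def mat2_vec vec_eq_iff forall_2 algebra_simps)
      then have "(of_int (e * k) - 1) *\<^sub>R v = 0" unfolding k by (simp add: algebra_simps)
      then have "real_of_int (e * k) = 1" using \<open>v \<noteq> 0\<close> by simp
      then have "e * k = 1" by linarith
      then show ?thesis unfolding e_def by (metis zmult_eq_1_iff abs_minus_cancel abs_one)
    qed
    then obtain i j where ij: "i * p + j * q = 1" using bezout_int[of p q] by auto
    define A where "A = mat2 (\<alpha> * of_int p) (- \<alpha> * of_int j) (\<alpha> * of_int q) (\<alpha> * of_int i)"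
    have "\<alpha> = 1 \<or> \<alpha> = -1" using \<open>\<bar>\<alpha>\<bar> = 1\<close> by auto
    then have "\<alpha> \<in> \<int>" and \<alpha>2: "\<alpha> * \<alpha> = 1" by auto
    then have Aint: "A $ a $ b \<in> \<int>" for a b
      using exhaust_2[of a] exhaust_2[of b] unfolding A_def by (auto intro!: Ints_mult)
    have "det A = (\<alpha> * \<alpha>) * of_int (i * p + j * q)" by (simp add: A_def det_mat2 algebra_simps)
    then have detA: "det A = 1" using ij \<alpha>2 by simp
    define x where "x = (M ** A) $ 1 $ 2"
    have 11: "(M ** A) $ 1 $ 1 = 1"
      using \<alpha>2 by (simp add: A_def matrix_matrix_mult_def sum_2 \<alpha>_def algebra_simps)
    have "(M ** A) $ 2 $ 1 = \<alpha> * (M $ 2 $ 1 * of_int p + M $ 2 $ 2 * of_int q)"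
      by (simp add: A_def matrix_matrix_mult_def sum_2 algebra_simps)
    then have 21: "(M ** A) $ 2 $ 1 = 0" unfolding z by simp
    have "det (M ** A) = 1" using detM detA by (simp add: det_mul)
    then have 22: "(M ** A) $ 2 $ 2 = 1" using 11 21 by (simp add: det_2)
    have "M ** A = mat2 1 x 0 1" unfolding mat2_eq_iff x_def using 11 21 22 by simp
    moreover have "g ** A = frame s ** (M ** A)" unfolding M_def by (simp add: matrix_mul_assoc frame_inverse)
    ultimately have "\<Lambda> = circle_lattice s x"
      unfolding g(1) circle_lattice_def using lattice_of_mat_unimodular[OF Aint, of g] detA by simp
    then show "\<Lambda> \<in> range (circle_lattice s)" by blast
  qed
qed

section \<open>The deformation\<close>

lemma span_frame: "span {frame s *v vector [c, 1]} = {frame s *v vector [k * c, k] | k. True}"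
  unfolding span_singleton by (auto simp: frame_def mat2_vec vec_eq_iff forall_2 algebra_simps image_iff)

text \<open>The second coordinate of a spanning vector cannot vanish, so it can be scaled to \<open>1\<close>.\<close>

lemma line_eq_span:
  assumes "subspace E" "dim E = 1" "E \<noteq> ell s"
  obtains c where "E = span {frame s *v vector [c, 1]}"
proof -
  obtain B where B: "B \<subseteq> E" "independent B" "E \<subseteq> span B" "card B = dim E"
    by (rule basis_exists)
  then obtain v where v: "B = {v}" using assms(2) by (auto simp: card_1_singleton_iff)
  have Ev: "E = span {v}" using B v assms(1) by (metis span_minimal subset_antisym)
  have v0: "v \<noteq> 0" using B(2) v by (metis dependent_zero singletonI)
  define x where "x = frame_inv s *v v"
  have vx: "v = frame s *v x" by (simp add: x_def)
  have "x $ 2 \<noteq> 0"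
  proof
    assume x2: "x $ 2 = 0"
    have "x $ 1 \<noteq> 0" using v0 x2 vx by (auto simp: matrix_vector_mult_def vec_eq_iff forall_2 sum_2)
    have "E = ell s"
      unfolding Ev span_singleton ell_frame
    proof (intro equalityI subsetI)
      fix w assume "w \<in> range (\<lambda>k. k *\<^sub>R v)"
      then obtain k where "w = k *\<^sub>R v" by blast
      then have "w = frame s *v vector [k * x $ 1, 0]"
        unfolding vx using x2 by (simp add: frame_def mat2_vec vec_eq_iff forall_2)
      then show "w \<in> {frame s *v vector [k, 0] | k. True}" by blast
    next
      fix w assume "w \<in> {frame s *v vector [k, 0] | k. True}"
      then obtain k where "w = frame s *v vector [k, 0]" by blast
      then have "w = (k / x $ 1) *\<^sub>R v"
        unfolding vx using x2 \<open>x $ 1 \<noteq> 0\<close> by (simp add: frame_def mat2_vec vec_eq_iff forall_2)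
      then show "w \<in> range (\<lambda>k. k *\<^sub>R v)" by blast
    qed
    then show False using assms(3) by blast
  qed
  define c where "c = x $ 1 / x $ 2"
  have vc: "v = x $ 2 *\<^sub>R (frame s *v vector [c, 1])"
    unfolding vx c_def using \<open>x $ 2 \<noteq> 0\<close> by (simp add: frame_def mat2_vec vec_eq_iff forall_2 field_simps)
  have "E = span {frame s *v vector [c, 1]}"
    unfolding Ev span_singleton
  proof (intro equalityI subsetI)
    fix w assume "w \<in> range (\<lambda>k. k *\<^sub>R v)"
    then show "w \<in> range (\<lambda>k. k *\<^sub>R (frame s *v vector [c, 1]))" unfolding vc by auto
  next
    fix w assume "w \<in> range (\<lambda>k. k *\<^sub>R (frame s *v vector [c, 1]))"
    then obtain k where "w = k *\<^sub>R (frame s *v vector [c, 1])" by blast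
    then have "w = (k / x $ 2) *\<^sub>R v" unfolding vc using \<open>x $ 2 \<noteq> 0\<close> by simp
    then show "w \<in> range (\<lambda>k. k *\<^sub>R v)" by blast
  qed
  then show ?thesis by (rule that)
qed

lemma V0_eq_span: "V0 s = span {frame s *v vector [0, 1]}"
proof -
  have "v \<in> V0 s \<longleftrightarrow> v \<in> span {frame s *v vector [0, 1]}" for v
  proof -
    define x where "x = frame_inv s *v v"
    have vx: "v = frame s *v x" by (simp add: x_def)
    have "v \<in> V0 s \<longleftrightarrow> (\<forall>k. (frame s *v vector [k, 0]) \<bullet> (frame s *v x) = 0)"
      unfolding V0_def orthogonal_comp_def ell_frame orthogonal_def vx by blast
    also have "\<dots> \<longleftrightarrow> (\<forall>k. k * x $ 1 = 0)"
      unfolding inner_frame by (simp add: inner_vec_def sum_2)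
    also have "\<dots> \<longleftrightarrow> x $ 1 = 0" by (metis mult_1 mult_zero_right)
    also have "\<dots> \<longleftrightarrow> v \<in> span {frame s *v vector [0, 1]}"
      unfolding span_frame vx mem_Collect_eq frame_vec_eq_iff by (auto simp: vec_eq_iff forall_2)
    finally show ?thesis .
  qed
  then show ?thesis by blast
qed

lemma deform_eq:
  "deform s (span {frame s *v vector [c, 1]}) t =
     frame s ** mat2 (exp (- t)) (c * (exp t - exp (- t))) 0 (exp t) ** frame_inv s" (is "_ = ?G")
  unfolding deform_def
proof (rule the_equality)
  have G: "?G *v (frame s *v x) = frame s *v vector [exp (- t) * x $ 1 + c * (exp t - exp (- t)) * x $ 2, exp t * x $ 2]" for x
    by (simp add: mat2_vec flip: matrix_vector_mul_assoc)
  have sc: "k *\<^sub>R (frame s *v x) = frame s *v (k *\<^sub>R x)" for k x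
    by (simp add: matrix_vector_mult_scaleR)
  have GE: "?G *v (frame s *v vector [k * c, k]) = exp t *\<^sub>R (frame s *v vector [k * c, k])" for k
    unfolding G sc frame_vec_eq_iff by (simp add: vec_eq_iff forall_2 algebra_simps)
  have Gl: "?G *v (frame s *v vector [k, 0]) = exp (- t) *\<^sub>R (frame s *v vector [k, 0])" for k
    unfolding G sc frame_vec_eq_iff by (simp add: vec_eq_iff forall_2)
  show "(\<forall>v\<in>span {frame s *v vector [c, 1]}. ?G *v v = exp t *\<^sub>R v) \<and> (\<forall>v\<in>ell s. ?G *v v = exp (- t) *\<^sub>R v)"
    unfolding span_frame ell_frame using GE Gl by blast
  fix g assume g: "(\<forall>v\<in>span {frame s *v vector [c, 1]}. g *v v = exp t *\<^sub>R v) \<and> (\<forall>v\<in>ell s. g *v v = exp (- t) *\<^sub>R v)"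
  show "g = ?G"
  proof (rule matrix_eq[THEN iffD2], rule allI)
    fix v
    define x where "x = frame_inv s *v v"
    have "v = frame s *v x" by (simp add: x_def)
    also have "x = vector [x $ 2 * c, x $ 2] + vector [x $ 1 - x $ 2 * c, 0]"
      by (simp add: vec_eq_iff forall_2)
    finally have v: "v = frame s *v vector [x $ 2 * c, x $ 2] + frame s *v vector [x $ 1 - x $ 2 * c, 0]"
      by (simp add: matrix_vector_right_distrib)
    have "frame s *v vector [x $ 2 * c, x $ 2] \<in> span {frame s *v vector [c, 1]}" unfolding span_frame by blast
    moreover have "frame s *v vector [x $ 1 - x $ 2 * c, 0] \<in> ell s" unfolding ell_frame by blast
    ultimately show "g *v v = ?G *v v"
      unfolding v matrix_vector_right_distrib using g GE Gl by simp
  qed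
qed

text \<open>The lattice meets the line in the multiples of its first basis vector, of length \<open>a\<close>.\<close>

lemma Y1_upper_triangular:
  assumes "lattice_of_mat (frame s ** mat2 a b 0 d) \<in> Y1 s" "a > 0" "d \<noteq> 0"
  shows "a = 1"
proof -
  obtain v where v: "norm v = 1" "lattice_of_mat (frame s ** mat2 a b 0 d) \<inter> ell s = {of_int k *\<^sub>R v | k :: int. True}"
    using assms(1) unfolding Y1_def by blast
  define w where "w = frame s *v vector [a, 0]"
  have "w = frame s *v vector [a * of_int 1 + b * of_int 0, 0 * of_int 1 + d * of_int 0]"
    unfolding w_def by simp
  then have "w \<in> lattice_of_mat (frame s ** mat2 a b 0 d)" unfolding lattice_frame_iff by blast
  moreover have "w \<in> ell s" unfolding w_def ell_frame by blast
  ultimately obtain k where k: "w = of_int k *\<^sub>R v" using v(2) by blast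
  have nw: "norm w = a" unfolding w_def norm_frame using assms(2) by (simp add: norm_vec_def L2_set_def sum_2)
  have "v = of_int 1 *\<^sub>R v" by simp
  then have "v \<in> lattice_of_mat (frame s ** mat2 a b 0 d) \<inter> ell s" using v(2) by blast
  then obtain m n where mn: "v = frame s *v vector [a * of_int m + b * of_int n, 0 * of_int m + d * of_int n]" "v \<in> ell s"
    using lattice_frame_iff by blast
  then have "n = 0" using assms(3) by (simp add: frame_in_ell)
  then have "norm v = a * \<bar>of_int m\<bar>"
    unfolding mn(1) norm_frame using assms(2) by (simp add: norm_vec_def L2_set_def sum_2 abs_mult)
  then have am: "a * of_int \<bar>m\<bar> = 1" using v(1) by simp
  have ak: "a = of_int \<bar>k\<bar>" using nw k v(1) by simp
  have "real_of_int (\<bar>k\<bar> * \<bar>m\<bar>) = 1" using am unfolding ak by simp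
  then have "\<bar>k\<bar> * \<bar>m\<bar> = 1" by linarith
  then have "\<bar>k\<bar> = 1" by (metis abs_ge_zero zmult_eq_1_iff abs_of_nonneg abs_minus_cancel abs_one)
  then show ?thesis using ak by simp
qed

text \<open>The covolume is \<open>\<rho>\<^sup>2 h\<close>.\<close>

lemma normalize_upper_triangular:
  assumes "\<rho> > 0" "h > 0"
  shows "normalize_lattice (lattice_of_mat (frame s ** mat2 \<rho> (\<rho> * b) 0 (\<rho> * h))) =
     lattice_of_mat (frame s ** mat2 (1 / sqrt h) (b / sqrt h) 0 (sqrt h))"
proof -
  define g where "g = frame s ** mat2 \<rho> (\<rho> * b) 0 (\<rho> * h)"
  have det: "det g = \<rho> * (\<rho> * h)" unfolding g_def by (simp add: det_mul det_frame det_mat2)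
  then have "invertible g" using assms by (simp add: invertible_det_nz)
  then have "covol (lattice_of_mat g) = \<rho> * (\<rho> * h)"
    using covol_lattice_of_mat det assms by simp
  also have "\<dots> = (\<rho> * sqrt h) powr 2"
    using assms by (simp add: powr_realpow power_mult_distrib power2_eq_square algebra_simps)
  finally have "covol (lattice_of_mat g) powr (-1/2) = (\<rho> * sqrt h) powr (-1)"
    by (simp add: powr_powr)
  also have "\<dots> = 1 / (\<rho> * sqrt h)" using assms by (simp add: powr_minus_divide)
  finally have c: "covol (lattice_of_mat g) powr (-1/2) = 1 / (\<rho> * sqrt h)" .
  have "(1 / (\<rho> * sqrt h)) *\<^sub>R g = frame s ** mat2 (1 / sqrt h) (b / sqrt h) 0 (sqrt h)"
  proof -
    have "(1 / (\<rho> * sqrt h)) *\<^sub>R g = frame s ** ((1 / (\<rho> * sqrt h)) *\<^sub>R mat2 \<rho> (\<rho> * b) 0 (\<rho> * h))"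
      unfolding g_def by (simp add: matrix_scaleR scalar_matrix_assoc matrix_scalar_ac)
    also have "(1 / (\<rho> * sqrt h)) *\<^sub>R mat2 \<rho> (\<rho> * b) 0 (\<rho> * h) = mat2 (1 / sqrt h) (b / sqrt h) 0 (sqrt h)"
      unfolding mat2_eq_iff using assms by (simp add: field_simps)
    finally show ?thesis .
  qed
  then show ?thesis
    unfolding normalize_lattice_def g_def[symmetric] scale_lattice_of_mat c by simp
qed

text \<open>The matrix \<open>(1, b; 0, h)\<close> has covolume \<open>h\<close>; normalizing and then scaling the line by
  \<open>\<surd>h\<close> returns its first vector to length one, and the corresponding expansion along \<open>E\<close> moves
  the second one by the multiple \<open>c (1 - h)\<close> of the first.\<close>

lemma q_E_eq:
  assumes "field_lattice s em K = lattice_of_mat (frame s ** mat2 \<rho> (\<rho> * b) 0 (\<rho> * h))" "\<rho> > 0" "h > 0"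
  shows "q_E s em (span {frame s *v vector [c, 1]}) K = circle_lattice s (b + c - c * h)"
proof -
  define k where "k = sqrt h"
  have k: "k > 0" "k * k = h" unfolding k_def using assms(3) by auto
  define E where "E = span {frame s *v vector [c, 1]}"
  define \<Lambda> where "\<Lambda> = normalize_lattice (field_lattice s em K)"
  have \<Lambda>: "\<Lambda> = lattice_of_mat (frame s ** mat2 (1 / k) (b / k) 0 k)"
    unfolding \<Lambda>_def assms(1) normalize_upper_triangular[OF assms(2,3)] k_def ..
  have act: "act (deform s E t) \<Lambda> = lattice_of_mat (frame s **
      mat2 (exp (- t) / k) (exp (- t) * b / k + c * (exp t - exp (- t)) * k) 0 (exp t * k))" for t
    unfolding \<Lambda> act_lattice_of_mat E_def deform_eq by (simp add: mat2_mult flip: matrix_mul_assoc)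
  define t0 where "t0 = - ln k"
  have et: "exp (- t0) = k" "exp t0 = 1 / k" unfolding t0_def using k(1) by (simp_all add: exp_minus divide_inverse)
  have "act (deform s E t0) \<Lambda> = circle_lattice s (b + c - c * h)"
  proof -
    have "(1 / k - k) * k = 1 - h" using k by (simp add: left_diff_distrib)
    then have "c * (1 / k - k) * k = c * (1 - h)" by (simp only: mult.assoc)
    moreover have "k * b / k = b" "k / k = 1" "1 / k * k = 1" using k(1) by simp_all
    moreover have "b + c * (1 - h) = b + c - c * h" by (simp add: right_diff_distrib)
    ultimately show ?thesis unfolding act et circle_lattice_def by (simp only:)
  qed
  moreover have "(THE t. act (deform s E t) \<Lambda> \<in> Y1 s) = t0"
  proof (rule the_equality)
    show "act (deform s E t0) \<Lambda> \<in> Y1 s"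
      unfolding calculation by (rule circle_lattice_in_Y1)
    fix t assume "act (deform s E t) \<Lambda> \<in> Y1 s"
    then have "exp (- t) / k = 1"
      unfolding act using k(1) by (intro Y1_upper_triangular) auto
    then have "exp (- t) = k" using k(1) by (simp add: field_simps)
    then show "t = t0" unfolding t0_def using ln_exp[of "- t"] by simp
  qed
  ultimately show ?thesis unfolding q_E_def Let_def E_def[symmetric] \<Lambda>_def[symmetric] by simp
qed



section \<open>The invariant measure on the circle of lattices\<close>

lemma space_borel_X2: "space borel_X2 = topspace X2"
  unfolding borel_X2_def by (simp add: space_measure_of_conv)

lemma openin_sets_borel_X2:
  assumes "openin X2 U"
  shows "U \<in> sets borel_X2"
proof -
  have "{U. openin X2 U} \<subseteq> Pow (topspace X2)" using openin_subset by blast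
  then show ?thesis unfolding borel_X2_def using assms by (simp add: sets_measure_of sigma_sets.Basic)
qed

lemma closedin_sets_borel_X2:
  assumes "closedin X2 C"
  shows "C \<in> sets borel_X2"
proof -
  have "topspace X2 - C \<in> sets borel_X2"
    using assms by (intro openin_sets_borel_X2) (simp add: closedin_def)
  then have "space borel_X2 - (topspace X2 - C) \<in> sets borel_X2" by (rule sets.compl_sets)
  moreover have "C \<subseteq> topspace X2" using assms by (rule closedin_subset)
  ultimately show ?thesis unfolding space_borel_X2 by (simp add: double_diff)
qed

lemma measurable_into_borel_X2:
  assumes "f \<in> space M \<rightarrow> topspace X2" "\<And>U. openin X2 U \<Longrightarrow> f -` U \<inter> space M \<in> sets M"
  shows "f \<in> M \<rightarrow>\<^sub>M borel_X2"
  unfolding borel_X2_def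
proof (rule measurable_measure_of)
  show "{U. openin X2 U} \<subseteq> Pow (topspace X2)" using openin_subset by blast
  show "f \<in> space M \<rightarrow> topspace X2" by (rule assms(1))
  show "f -` U \<inter> space M \<in> sets M" if "U \<in> {U. openin X2 U}" for U
    using that assms(2) by simp
qed

lemma continuous_map_borel_X2:
  assumes "continuous_map X2 euclideanreal f"
  shows "f \<in> borel_measurable borel_X2"
proof (rule borel_measurableI)
  fix S :: "real set" assume "open S"
  then have "openin X2 {x \<in> topspace X2. f x \<in> S}"
    using openin_continuous_map_preimage[OF assms] by simp
  moreover have "f -` S \<inter> space borel_X2 = {x \<in> topspace X2. f x \<in> S}"
    unfolding space_borel_X2 by auto
  ultimately show "f -` S \<inter> space borel_X2 \<in> sets borel_X2" using openin_sets_borel_X2 by simp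
qed

lemma continuous_map_lattice_of_mat: "continuous_map (top_of_set SL2) X2 lattice_of_mat"
  by (rule quotient_imp_continuous_map[OF quotient_map_X2])

lemma continuous_map_circle_lattice: "continuous_map euclideanreal X2 (circle_lattice s)"
proof -
  have "continuous_on UNIV (\<lambda>x. frame s ** mat2 1 x 0 1)"
    unfolding continuous_on_def by (intro ballI tendsto_matrix_mult tendsto_mat2 tendsto_intros)
  then have "continuous_map euclideanreal (top_of_set SL2) (\<lambda>x. frame s ** mat2 1 x 0 1)"
    by (simp add: continuous_map_in_subtopology frame_shear_SL2 image_subset_iff)
  from continuous_map_compose[OF this continuous_map_lattice_of_mat] show ?thesis
    by (simp add: o_def circle_lattice_def[abs_def])
qed

lemma measurable_circle_lattice [measurable]: "circle_lattice s \<in> borel \<rightarrow>\<^sub>M borel_X2"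
proof (rule measurable_into_borel_X2)
  show "circle_lattice s \<in> space borel \<rightarrow> topspace X2" using circle_lattice_X2 by simp
  fix U assume "openin X2 U"
  then have "open {x. circle_lattice s x \<in> U}"
    using openin_continuous_map_preimage[OF continuous_map_circle_lattice[of s]] by simp
  then show "circle_lattice s -` U \<inter> space borel \<in> sets borel"
    by (simp add: vimage_def)
qed

lemma SL2_mult: "g \<in> SL2 \<Longrightarrow> h \<in> SL2 \<Longrightarrow> g ** h \<in> SL2"
  by (simp add: SL2_def det_mul)

lemma measurable_act:
  assumes "h \<in> SL2"
  shows "act h \<in> borel_X2 \<rightarrow>\<^sub>M borel_X2"
proof (rule measurable_into_borel_X2)
  show into: "act h \<in> space borel_X2 \<rightarrow> topspace X2"
    using assms SL2_mult unfolding space_borel_X2 topspace_X2 unimodular_lattices_eq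
    by (auto simp: act_lattice_of_mat)
  fix U assume U: "openin X2 U"
  have "continuous_on SL2 (\<lambda>g. h ** g)"
    unfolding continuous_on_def by (intro ballI tendsto_matrix_mult tendsto_intros)
  then have "continuous_map (top_of_set SL2) (top_of_set SL2) (\<lambda>g. h ** g)"
    using assms SL2_mult by (auto simp: continuous_map_in_subtopology)
  from continuous_map_compose[OF this continuous_map_lattice_of_mat]
  have "openin (top_of_set SL2) {g \<in> SL2. act h (lattice_of_mat g) \<in> U}"
    using openin_continuous_map_preimage[OF _ U] by (fastforce simp: o_def act_lattice_of_mat)
  moreover have "act h -` U \<inter> space borel_X2 \<subseteq> unimodular_lattices"
    unfolding space_borel_X2 topspace_X2 by blast
  moreover have "{g \<in> SL2. lattice_of_mat g \<in> act h -` U \<inter> space borel_X2} = {g \<in> SL2. act h (lattice_of_mat g) \<in> U}"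
    unfolding space_borel_X2 topspace_X2 unimodular_lattices_eq by blast
  ultimately have "openin X2 (act h -` U \<inter> space borel_X2)" unfolding openin_X2 by simp
  then show "act h -` U \<inter> space borel_X2 \<in> sets borel_X2" by (rule openin_sets_borel_X2)
qed

text \<open>Let \<open>g\<^sub>n \<rightarrow> g\<close> and \<open>g\<^sub>n = f U(x\<^sub>n) A\<^sub>n\<close>, where \<open>f\<close> is the frame, \<open>U(x)\<close> the unipotent matrix with entry
  \<open>x\<close>, \<open>x\<^sub>n\<close> lies in a compact set and \<open>A\<^sub>n\<close> is integral.  Then along
  a subsequence \<open>x\<^sub>n\<close>, and with it \<open>A\<^sub>n\<close>, converges; limits of integer matrices are integral.\<close>

lemma closedin_circle_lattice_image:
  assumes "compact K"
  shows "closedin X2 (circle_lattice s ` K)"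
proof -
  define C where "C = {g \<in> SL2. lattice_of_mat g \<in> circle_lattice s ` K}"
  have "closed C"
    unfolding closed_sequential_limits
  proof (intro allI impI, elim conjE)
    fix G g assume G: "\<forall>n. G n \<in> C" and lim: "G \<longlonglongrightarrow> g"
    have "\<exists>x\<in>K. lattice_of_mat (G n) = circle_lattice s x" for n
      using G unfolding C_def by auto
    then obtain x where x: "\<And>n. x n \<in> K" "\<And>n. lattice_of_mat (G n) = circle_lattice s (x n)" by metis
    have detG: "det (G n) = 1" for n using G unfolding C_def SL2_def by auto
    obtain l r where l: "l \<in> K" and r: "strict_mono r" and xl: "(x \<circ> r) \<longlonglongrightarrow> l"
      using assms x(1) unfolding compact_def by metis
    have "\<exists>A. G n = (frame s ** mat2 1 (x n) 0 1) ** A \<and> (\<forall>i j. A $ i $ j \<in> \<int>)" for n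
      using x(2)[of n] unfolding circle_lattice_def by (intro lattice_subset_factor) simp
    then obtain A where A: "\<And>n. G n = (frame s ** mat2 1 (x n) 0 1) ** A n" "\<And>n i j. A n $ i $ j \<in> \<int>"
      by metis
    have An: "A n = mat2 1 (- x n) 0 1 ** (frame_inv s ** G n)" for n
    proof -
      have "mat2 1 (- x n) 0 1 ** mat2 1 (x n) 0 1 = mat 1" by (simp add: mat2_mult mat2_one)
      then show ?thesis unfolding A(1)
        by (metis frame_inverse_mult(2) matrix_mul_assoc matrix_mul_lid)
    qed
    define B where "B = mat2 1 (- l) 0 1 ** (frame_inv s ** g)"
    have "(\<lambda>n. G (r n)) \<longlonglongrightarrow> g" using LIMSEQ_subseq_LIMSEQ[OF lim r] by (simp add: o_def)
    then have "(\<lambda>n. A (r n)) \<longlonglongrightarrow> B"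
      unfolding An B_def using xl
      by (intro tendsto_matrix_mult tendsto_mat2 tendsto_intros) (simp_all add: o_def)
    then have "(\<lambda>n. A (r n) $ i $ j) \<longlonglongrightarrow> B $ i $ j" for i j by (intro tendsto_vec_nth)
    then have Bint: "B $ i $ j \<in> \<int>" for i j
      using A(2) closed_sequentially[OF closed_Ints, of "\<lambda>n. A (r n) $ i $ j" "B $ i $ j"] by blast
    have "(\<lambda>n. det (G n)) \<longlonglongrightarrow> det g"
      unfolding det_2 using lim by (intro tendsto_intros tendsto_vec_nth)
    then have detg: "det g = 1" unfolding detG by (simp add: LIMSEQ_const_iff)
    have g: "g = (frame s ** mat2 1 l 0 1) ** B"
    proof -
      have "mat2 1 l 0 1 ** mat2 1 (- l) 0 1 = mat 1" by (simp add: mat2_mult mat2_one)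
      then show ?thesis unfolding B_def
        by (metis frame_inverse_mult(1) matrix_mul_assoc matrix_mul_lid)
    qed
    have "det B = 1" using arg_cong[OF g, of det] detg by (simp add: det_mul det_frame det_mat2)
    then have "lattice_of_mat g = circle_lattice s l"
      unfolding g circle_lattice_def using lattice_of_mat_unimodular[OF Bint] by blast
    then show "g \<in> C" unfolding C_def SL2_def using detg l by blast
  qed
  moreover have "{g \<in> SL2. lattice_of_mat g \<in> topspace X2 - circle_lattice s ` K} = SL2 - C"
    unfolding C_def topspace_X2 unimodular_lattices_eq by blast
  moreover have "C \<subseteq> SL2" unfolding C_def by blast
  ultimately have "openin (top_of_set SL2) {g \<in> SL2. lattice_of_mat g \<in> topspace X2 - circle_lattice s ` K}"
    by (metis closed_subset openin_diff openin_subtopology_self topspace_euclidean_subtopology)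
  then have "openin X2 (topspace X2 - circle_lattice s ` K)"
    unfolding openin_X2 topspace_X2 by blast
  then show ?thesis unfolding closedin_def using circle_lattice_X2 by blast
qed

lemma circle_lattice_frac: "circle_lattice s (frac x) = circle_lattice s x"
  unfolding circle_lattice_eq_iff by (simp add: frac_def)

lemma Y1_eq_image: "Y1 s = circle_lattice s ` {0..1}"
proof -
  have "circle_lattice s x \<in> circle_lattice s ` {0..1}" for x
    by (rule image_eqI[of _ _ "frac x"]) (simp_all add: circle_lattice_frac frac_lt_1 less_imp_le)
  then show ?thesis unfolding Y1_eq by blast
qed

lemma Y1_sets: "Y1 s \<in> sets borel_X2"
  unfolding Y1_eq_image by (intro closedin_sets_borel_X2 closedin_circle_lattice_image) simp

text \<open>The position of a lattice on the circle; outside \<open>Y\<^sub>1\<close> the value \<open>0\<close> is a default.\<close>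

definition circle_coord :: "nat \<Rightarrow> (real^2) set \<Rightarrow> real" where
  "circle_coord s \<Lambda> = (if \<Lambda> \<in> Y1 s then frac (SOME x. \<Lambda> = circle_lattice s x) else 0)"

lemma circle_coord:
  assumes "\<Lambda> \<in> Y1 s"
  shows "circle_lattice s (circle_coord s \<Lambda>) = \<Lambda>"
proof -
  have "\<exists>x. \<Lambda> = circle_lattice s x" using assms unfolding Y1_eq by blast
  then have "\<Lambda> = circle_lattice s (SOME x. \<Lambda> = circle_lattice s x)" by (rule someI_ex)
  then show ?thesis unfolding circle_coord_def using assms by (simp add: circle_lattice_frac)
qed

lemma circle_coord_range: "0 \<le> circle_coord s \<Lambda>" "circle_coord s \<Lambda> < 1"
  unfolding circle_coord_def by (simp_all add: frac_lt_1)

lemma circle_coord_circle_lattice: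
  assumes "0 \<le> x" "x < 1"
  shows "circle_coord s (circle_lattice s x) = x"
proof -
  define y where "y = circle_coord s (circle_lattice s x)"
  have "circle_lattice s y = circle_lattice s x"
    unfolding y_def by (rule circle_coord[OF circle_lattice_in_Y1])
  then have "y - x \<in> \<int>" unfolding circle_lattice_eq_iff .
  then obtain k where k: "y - x = of_int k" by (elim Ints_cases)
  have "0 \<le> y" "y < 1" unfolding y_def by (rule circle_coord_range)+
  then have "k = 0" using k assms by linarith
  then show ?thesis using k unfolding y_def by simp
qed

text \<open>The sublevel sets are, up to the complement of \<open>Y\<^sub>1\<close>, images of compact intervals, hence closed.\<close>

lemma measurable_circle_coord: "circle_coord s \<in> borel_measurable borel_X2"
  unfolding borel_measurable_iff_le
proof
  fix a :: real
  show "{\<Lambda> \<in> space borel_X2. circle_coord s \<Lambda> \<le> a} \<in> sets borel_X2"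
  proof (cases "0 \<le> a \<and> a < 1")
    case True
    have "{\<Lambda> \<in> space borel_X2. circle_coord s \<Lambda> \<le> a} = (space borel_X2 - Y1 s) \<union> circle_lattice s ` {0..a}"
    proof (intro equalityI subsetI)
      fix \<Lambda> assume *: "\<Lambda> \<in> {\<Lambda> \<in> space borel_X2. circle_coord s \<Lambda> \<le> a}"
      show "\<Lambda> \<in> (space borel_X2 - Y1 s) \<union> circle_lattice s ` {0..a}"
      proof (cases "\<Lambda> \<in> Y1 s")
        case True
        then show ?thesis using * circle_coord[OF True] circle_coord_range(1)[of s \<Lambda>]
          by (intro UnI2 image_eqI[of _ _ "circle_coord s \<Lambda>"]) auto
      qed (use * in auto)
    next
      fix \<Lambda> assume *: "\<Lambda> \<in> (space borel_X2 - Y1 s) \<union> circle_lattice s ` {0..a}"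
      then show "\<Lambda> \<in> {\<Lambda> \<in> space borel_X2. circle_coord s \<Lambda> \<le> a}"
      proof
        assume "\<Lambda> \<in> space borel_X2 - Y1 s"
        then show ?thesis using True by (simp add: circle_coord_def)
      next
        assume "\<Lambda> \<in> circle_lattice s ` {0..a}"
        then obtain x where "\<Lambda> = circle_lattice s x" "0 \<le> x" "x \<le> a" by auto
        then show ?thesis using True circle_coord_circle_lattice[of x s] circle_lattice_X2
          by (simp add: space_borel_X2)
      qed
    qed
    moreover have "circle_lattice s ` {0..a} \<in> sets borel_X2"
      by (intro closedin_sets_borel_X2 closedin_circle_lattice_image) simp
    ultimately show ?thesis using Y1_sets by auto
  next
    case False
    then consider "a < 0" | "a \<ge> 1" by linarith
    then show ?thesis
    proof cases
      case 1
      then have "\<not> circle_coord s \<Lambda> \<le> a" for \<Lambda> using circle_coord_range(1)[of s \<Lambda>] by linarith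
      then show ?thesis by simp
    next
      case 2
      then have "circle_coord s \<Lambda> \<le> a" for \<Lambda> using circle_coord_range(2)[of s \<Lambda>] by linarith
      then show ?thesis by simp
    qed
  qed
qed

abbreviation unit_interval :: "real measure" where
  "unit_interval \<equiv> restrict_space lborel {0..<1}"

lemma prob_space_unit_interval: "prob_space unit_interval"
  by (rule prob_spaceI) (simp add: emeasure_restrict_space space_restrict_space)

lemma emeasure_unit_interval:
  assumes "B \<in> sets borel"
  shows "emeasure unit_interval ({0..<1} \<inter> B) = emeasure lborel ({0..<1} \<inter> B)"
  by (rule emeasure_restrict_space) auto

lemma emeasure_lborel_translate:
  fixes S :: "real set"
  assumes "S \<in> sets borel"
  shows "emeasure lborel {x. x + y \<in> S} = emeasure lborel S"
proof -
  have "emeasure lborel S = emeasure (distr lborel borel ((+) y)) S" by (simp add: lborel_distr_plus)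
  also have "\<dots> = emeasure lborel ((+) y -` S \<inter> space lborel)"
    using assms by (intro emeasure_distr) auto
  finally show ?thesis by (simp add: vimage_def add.commute)
qed

text \<open>Rotation invariance of Lebesgue measure on \<open>\<real>/\<int>\<close>: cut the interval where the rotation wraps.\<close>

lemma emeasure_rotate:
  fixes B :: "real set"
  assumes B: "B \<in> sets borel" and per: "\<And>x. x + 1 \<in> B \<longleftrightarrow> x \<in> B"
  shows "emeasure lborel ({0..<1} \<inter> {x. x + y \<in> B}) = emeasure lborel ({0..<1} \<inter> B)"
proof -
  define f where "f = frac y"
  have f: "0 \<le> f" "f < 1" unfolding f_def by (simp_all add: frac_lt_1)
  have "x + y \<in> B \<longleftrightarrow> x + f \<in> B" for x
    using periodic_int[of "\<lambda>x. x \<in> B", OF per, of "x + f" "\<lfloor>y\<rfloor>"] by (simp add: f_def frac_def)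
  then have "{0..<1} \<inter> {x. x + y \<in> B} = {x. x + f \<in> {f..<1} \<inter> B} \<union> {x. x + (f - 1) \<in> {0..<f} \<inter> B}"
    using per[of "_ + (f - 1)"] f by (auto simp: algebra_simps)
  moreover have "emeasure lborel ({x. x + f \<in> {f..<1} \<inter> B} \<union> {x. x + (f - 1) \<in> {0..<f} \<inter> B}) =
      emeasure lborel {x. x + f \<in> {f..<1} \<inter> B} + emeasure lborel {x. x + (f - 1) \<in> {0..<f} \<inter> B}"
  proof (rule plus_emeasure[symmetric])
    have "(\<lambda>x. x + c) -` S \<inter> space borel \<in> sets borel" if "S \<in> sets borel" for c :: real and S
      using that by (intro measurable_sets[of _ borel borel]) auto
    then show "{x. x + f \<in> {f..<1} \<inter> B} \<in> sets lborel" "{x. x + (f - 1) \<in> {0..<f} \<inter> B} \<in> sets lborel"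
      using B by (force simp: vimage_def)+
    show "{x. x + f \<in> {f..<1} \<inter> B} \<inter> {x. x + (f - 1) \<in> {0..<f} \<inter> B} = {}"
      using f by auto
  qed
  moreover have "emeasure lborel {x. x + f \<in> {f..<1} \<inter> B} = emeasure lborel ({f..<1} \<inter> B)"
    "emeasure lborel {x. x + (f - 1) \<in> {0..<f} \<inter> B} = emeasure lborel ({0..<f} \<inter> B)"
    using B by (intro emeasure_lborel_translate; simp)+
  moreover have "emeasure lborel ({f..<1} \<inter> B) + emeasure lborel ({0..<f} \<inter> B) = emeasure lborel (({f..<1} \<inter> B) \<union> ({0..<f} \<inter> B))"
    using B by (intro plus_emeasure) auto
  moreover have "({f..<1} \<inter> B) \<union> ({0..<f} \<inter> B) = {0..<1} \<inter> B" using f by auto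
  ultimately show ?thesis by simp
qed


definition circle_measure :: "nat \<Rightarrow> (real^2) set measure" where
  "circle_measure s = distr unit_interval borel_X2 (circle_lattice s)"

lemma measurable_circle_lattice_unit_interval:
  "circle_lattice s \<in> unit_interval \<rightarrow>\<^sub>M borel_X2"
  by (intro measurable_restrict_space1) simp

lemma circle_preimage_sets:
  assumes "A \<in> sets borel_X2"
  shows "{x. circle_lattice s x \<in> A} \<in> sets borel"
  using measurable_sets[OF measurable_circle_lattice assms, of s] by (simp add: vimage_def)

lemma circle_preimage_periodic:
  "x + 1 \<in> {x. circle_lattice s x \<in> A} \<longleftrightarrow> x \<in> {x. circle_lattice s x \<in> A}"
proof -
  have "circle_lattice s (x + 1) = circle_lattice s x" unfolding circle_lattice_eq_iff by simp
  then show ?thesis by simp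
qed

lemma emeasure_circle_measure:
  assumes "A \<in> sets borel_X2"
  shows "emeasure (circle_measure s) A = emeasure lborel ({0..<1} \<inter> {x. circle_lattice s x \<in> A})"
proof -
  have "emeasure (circle_measure s) A = emeasure unit_interval (circle_lattice s -` A \<inter> space unit_interval)"
    unfolding circle_measure_def by (rule emeasure_distr[OF measurable_circle_lattice_unit_interval assms])
  also have "circle_lattice s -` A \<inter> space unit_interval = {0..<1} \<inter> {x. circle_lattice s x \<in> A}"
    by (auto simp: space_restrict_space)
  finally show ?thesis using emeasure_unit_interval[OF circle_preimage_sets[OF assms]] by simp
qed

lemma shear_SL2: "shear s y \<in> SL2"
  by (simp add: SL2_def shear_def det_mul det_mat2 det_frame det_frame_inv)

lemma shear_conj: "frame_inv s ** shear s y ** frame s = mat2 1 y 0 1"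
  unfolding shear_def
  by (metis frame_inverse(2) frame_inverse_mult(2) matrix_mul_assoc matrix_mul_rid)

lemma shear_eqI:
  assumes "frame_inv s ** g ** frame s = mat2 1 y 0 1"
  shows "g = shear s y"
  unfolding shear_def assms[symmetric]
  by (metis frame_inverse(1) frame_inverse_mult(1) matrix_mul_assoc matrix_mul_rid)

text \<open>In the adapted coordinates an element of the group has first column \<open>(1, 0)\<close>, and determinant
  \<open>1\<close> makes it unipotent.\<close>

lemma line_stabilizer: "{g \<in> SL2. \<forall>v \<in> ell s. g *v v = v} = range (shear s)"
proof (intro equalityI subsetI)
  fix g assume "g \<in> range (shear s)"
  then obtain y where g: "g = shear s y" by blast
  have "shear s y *v (frame s *v vector [k, 0]) = frame s *v vector [k, 0]" for k
    unfolding shear_def by (simp add: mat2_vec flip: matrix_vector_mul_assoc)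
  then show "g \<in> {g \<in> SL2. \<forall>v \<in> ell s. g *v v = v}"
    unfolding g ell_frame using shear_SL2 by auto
next
  fix g assume g: "g \<in> {g \<in> SL2. \<forall>v \<in> ell s. g *v v = v}"
  define M where "M = frame_inv s ** g ** frame s"
  have "g *v (frame s *v vector [1, 0]) = frame s *v vector [1, 0]"
    using g unfolding ell_frame by blast
  then have "M *v vector [1, 0] = vector [1, 0]"
    unfolding M_def by (simp flip: matrix_vector_mul_assoc)
  then have 1: "M $ 1 $ 1 = 1" "M $ 2 $ 1 = 0"
    by (simp_all add: vec_eq_iff forall_2 matrix_vector_mult_def sum_2)
  have "det M = 1" unfolding M_def using g by (simp add: det_mul det_frame det_frame_inv SL2_def)
  then have "M = mat2 1 (M $ 1 $ 2) 0 1" unfolding mat2_eq_iff using 1 by (simp add: det_2)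
  then show "g \<in> range (shear s)" using shear_eqI unfolding M_def by blast
qed

lemma invariant_circle_measure: "invariant_prob_on (range (shear s)) (Y1 s) (circle_measure s)"
  unfolding invariant_prob_on_def
proof (intro conjI ballI)
  show "sets (circle_measure s) = sets borel_X2" by (simp add: circle_measure_def)
  show "prob_space (circle_measure s)"
    unfolding circle_measure_def
    by (rule prob_space.prob_space_distr[OF prob_space_unit_interval measurable_circle_lattice_unit_interval])
  have "{\<Lambda> \<in> space borel_X2. \<Lambda> \<in> Y1 s} = Y1 s"
    using Y1_sets[of s] sets.sets_into_space by blast
  then show "AE \<Lambda> in circle_measure s. \<Lambda> \<in> Y1 s"
    unfolding circle_measure_def
    by (subst AE_distr_iff[OF measurable_circle_lattice_unit_interval]) (simp_all add: Y1_sets circle_lattice_in_Y1)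
  fix h assume "h \<in> range (shear s)"
  then obtain y where h: "h = shear s y" by blast
  show "distr (circle_measure s) borel_X2 (act h) = circle_measure s"
  proof (rule measure_eqI)
    show "sets (distr (circle_measure s) borel_X2 (act h)) = sets (circle_measure s)"
      by (simp add: circle_measure_def)
    fix A assume "A \<in> sets (distr (circle_measure s) borel_X2 (act h))"
    then have A: "A \<in> sets borel_X2" by simp
    have act: "act h \<in> circle_measure s \<rightarrow>\<^sub>M borel_X2"
      unfolding circle_measure_def h using measurable_act[OF shear_SL2] by simp
    have pre: "act h -` A \<inter> space borel_X2 \<in> sets borel_X2"
      unfolding h by (rule measurable_sets[OF measurable_act[OF shear_SL2] A])
    have "emeasure (distr (circle_measure s) borel_X2 (act h)) A = emeasure (circle_measure s) (act h -` A \<inter> space borel_X2)"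
      by (subst emeasure_distr[OF act A]) (simp add: circle_measure_def)
    also have "\<dots> = emeasure lborel ({0..<1} \<inter> {x. circle_lattice s x \<in> act h -` A \<inter> space borel_X2})"
      by (rule emeasure_circle_measure[OF pre])
    also have "{x. circle_lattice s x \<in> act h -` A \<inter> space borel_X2} = {x. x + y \<in> {x. circle_lattice s x \<in> A}}"
      by (simp add: h act_shear space_borel_X2 circle_lattice_X2)
    also have "emeasure lborel ({0..<1} \<inter> \<dots>) = emeasure lborel ({0..<1} \<inter> {x. circle_lattice s x \<in> A})"
      by (rule emeasure_rotate[OF circle_preimage_sets[OF A] circle_preimage_periodic])
    also have "\<dots> = emeasure (circle_measure s) A" by (rule emeasure_circle_measure[OF A, symmetric])
    finally show "emeasure (distr (circle_measure s) borel_X2 (act h)) A = emeasure (circle_measure s) A" .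
  qed
qed

text \<open>Uniqueness of Haar measure on the circle: average the invariance \<open>\<mu> A = \<mu> (h\<^sub>y\<inverse> A)\<close> over \<open>y\<close> in
  a period and exchange the integrals.  Working with the law \<open>\<nu>\<close> of the coordinate instead of \<open>\<mu>\<close>
  makes the joint measurability that Fubini's theorem asks for a fact about Borel sets of reals.\<close>

lemma invariant_prob_unique:
  assumes "invariant_prob_on (range (shear s)) (Y1 s) \<mu>"
  shows "\<mu> = circle_measure s"
proof (rule measure_eqI)
  have sets: "sets \<mu> = sets borel_X2" and prob: "prob_space \<mu>" and AE: "AE \<Lambda> in \<mu>. \<Lambda> \<in> Y1 s"
    and inv: "\<And>y. distr \<mu> borel_X2 (act (shear s y)) = \<mu>"
    using assms unfolding invariant_prob_on_def by auto
  have space: "space \<mu> = space borel_X2" by (rule sets_eq_imp_space_eq[OF sets])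
  show "sets \<mu> = sets (circle_measure s)" using sets by (simp add: circle_measure_def)
  fix A assume "A \<in> sets \<mu>"
  then have A: "A \<in> sets borel_X2" using sets by simp
  define B where "B = {x. circle_lattice s x \<in> A}"
  have B [measurable]: "B \<in> sets borel" unfolding B_def by (rule circle_preimage_sets[OF A])
  have coord: "circle_coord s \<in> \<mu> \<rightarrow>\<^sub>M borel"
    using measurable_circle_coord measurable_cong_sets[OF sets refl] by blast
  define \<nu> where "\<nu> = distr \<mu> borel (circle_coord s)"
  interpret \<nu>: prob_space \<nu> unfolding \<nu>_def by (rule prob_space.prob_space_distr[OF prob coord])
  interpret U: prob_space unit_interval by (rule prob_space_unit_interval)
  interpret P: pair_sigma_finite unit_interval \<nu> ..
  have shift [measurable]: "{x. x + y \<in> B} \<in> sets borel" for y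
    using measurable_sets[of "\<lambda>x. x + y" borel borel B] B by (simp add: vimage_def)
  have \<mu>A: "emeasure \<mu> A = (\<integral>\<^sup>+ x. indicator B (x + y) \<partial>\<nu>)" for y
  proof -
    have act: "act (shear s y) \<in> \<mu> \<rightarrow>\<^sub>M borel_X2"
      using measurable_act[OF shear_SL2] measurable_cong_sets[OF sets refl] by blast
    have "emeasure \<mu> A = emeasure (distr \<mu> borel_X2 (act (shear s y))) A" by (simp only: inv)
    also have "\<dots> = emeasure \<mu> (act (shear s y) -` A \<inter> space \<mu>)" by (rule emeasure_distr[OF act A])
    also have "\<dots> = emeasure \<mu> (circle_coord s -` {x. x + y \<in> B} \<inter> space \<mu>)"
    proof (rule emeasure_eq_AE)
      show "act (shear s y) -` A \<inter> space \<mu> \<in> sets \<mu>" by (rule measurable_sets[OF act A])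
      show "circle_coord s -` {x. x + y \<in> B} \<inter> space \<mu> \<in> sets \<mu>" by (rule measurable_sets[OF coord shift])
      show "AE \<Lambda> in \<mu>. \<Lambda> \<in> act (shear s y) -` A \<inter> space \<mu> \<longleftrightarrow> \<Lambda> \<in> circle_coord s -` {x. x + y \<in> B} \<inter> space \<mu>"
        using AE
      proof eventually_elim
        case (elim \<Lambda>)
        have "act (shear s y) \<Lambda> = circle_lattice s (circle_coord s \<Lambda> + y)"
          using act_shear[of s y "circle_coord s \<Lambda>"] circle_coord[OF elim] by simp
        then show ?case by (simp add: B_def)
      qed
    qed
    also have "\<dots> = emeasure \<nu> {x. x + y \<in> B}"
      unfolding \<nu>_def by (rule emeasure_distr[OF coord shift, symmetric])
    also have "\<dots> = (\<integral>\<^sup>+ x. indicator {x. x + y \<in> B} x \<partial>\<nu>)"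
      by (rule nn_integral_indicator[symmetric]) (simp add: \<nu>_def)
    also have "\<dots> = (\<integral>\<^sup>+ x. indicator B (x + y) \<partial>\<nu>)"
      by (intro nn_integral_cong) (simp add: indicator_def)
    finally show ?thesis .
  qed
  have "emeasure \<mu> A = (\<integral>\<^sup>+ y. emeasure \<mu> A \<partial>unit_interval)"
    using U.emeasure_space_1 by simp
  also have "\<dots> = (\<integral>\<^sup>+ y. \<integral>\<^sup>+ x. indicator B (x + y) \<partial>\<nu> \<partial>unit_interval)"
    by (intro nn_integral_cong \<mu>A)
  also have "\<dots> = (\<integral>\<^sup>+ x. \<integral>\<^sup>+ y. indicator B (x + y) \<partial>unit_interval \<partial>\<nu>)"
  proof (rule P.Fubini'[symmetric])
    have [measurable_cong]: "sets \<nu> = sets borel" by (simp add: \<nu>_def)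
    have [measurable]: "(\<lambda>y. y) \<in> unit_interval \<rightarrow>\<^sub>M borel" by (intro measurable_restrict_space1) simp
    have "(\<lambda>(y, x). x + y) \<in> unit_interval \<Otimes>\<^sub>M \<nu> \<rightarrow>\<^sub>M borel" by measurable
    then show "(\<lambda>(y, x). indicator B (x + y) :: ennreal) \<in> borel_measurable (unit_interval \<Otimes>\<^sub>M \<nu>)"
      using measurable_compose[OF _ borel_measurable_indicator[OF B]] by (simp add: case_prod_beta')
  qed
  also have "\<dots> = (\<integral>\<^sup>+ x. emeasure lborel ({0..<1} \<inter> B) \<partial>\<nu>)"
  proof (intro nn_integral_cong)
    fix x
    have "(\<integral>\<^sup>+ y. indicator B (x + y) \<partial>unit_interval) = (\<integral>\<^sup>+ y. indicator ({0..<1} \<inter> {y. y + x \<in> B}) y \<partial>unit_interval)"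
      by (intro nn_integral_cong) (auto simp: indicator_def space_restrict_space add.commute)
    also have "\<dots> = emeasure unit_interval ({0..<1} \<inter> {y. y + x \<in> B})"
      by (rule nn_integral_indicator) (simp add: sets_restrict_space_iff)
    also have "\<dots> = emeasure lborel ({0..<1} \<inter> {y. y + x \<in> B})" by (rule emeasure_unit_interval[OF shift])
    also have "\<dots> = emeasure lborel ({0..<1} \<inter> B)"
      by (rule emeasure_rotate[OF B]) (unfold B_def, rule circle_preimage_periodic)
    finally show "(\<integral>\<^sup>+ y. indicator B (x + y) \<partial>unit_interval) = emeasure lborel ({0..<1} \<inter> B)" .
  qed
  also have "\<dots> = emeasure lborel ({0..<1} \<inter> B)" using \<nu>.emeasure_space_1 by simp
  also have "\<dots> = emeasure (circle_measure s) A" unfolding B_def by (rule emeasure_circle_measure[OF A, symmetric])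
  finally show "emeasure \<mu> A = emeasure (circle_measure s) A" .
qed

lemma m_Y1_eq: "m_Y1 s = circle_measure s"
  unfolding m_Y1_def line_stabilizer
  by (rule the_equality, rule invariant_circle_measure, rule invariant_prob_unique)

lemma integral_m_Y1:
  assumes "continuous_map X2 euclideanreal f"
  shows "integral\<^sup>L (m_Y1 s) f = integral {0..1} (\<lambda>x. f (circle_lattice s x))"
proof -
  define g where "g x = f (circle_lattice s x)" for x
  have "continuous_on UNIV g"
    using continuous_map_compose[OF continuous_map_circle_lattice assms] by (simp add: g_def[abs_def] o_def)
  then have "set_integrable lborel {0..1} g"
    by (intro borel_integrable_atLeastAtMost') (auto intro: continuous_on_subset)
  then have int: "set_integrable lborel {0..<1} g" by (rule set_integrable_subset) auto
  have "integral\<^sup>L (m_Y1 s) f = (\<integral>x. g x \<partial>unit_interval)"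
    unfolding m_Y1_eq circle_measure_def g_def
    by (rule integral_distr[OF measurable_circle_lattice_unit_interval continuous_map_borel_X2[OF assms]])
  also have "\<dots> = (LINT x:{0..<1}|lborel. g x)"
    unfolding set_lebesgue_integral_def by (rule integral_restrict_space) simp
  also have "\<dots> = integral {0..<1} g" by (rule set_borel_integral_eq_integral(2)[OF int])
  also have "\<dots> = integral {0..1} g"
  proof (rule integral_spike_set)
    have "{x \<in> {0..<1} - {0..1}. g x \<noteq> 0} \<subseteq> {1}" "{x \<in> {0..1} - {0..<1}. g x \<noteq> 0} \<subseteq> {1}" by auto
    then show "negligible {x \<in> {0..<1} - {0..1}. g x \<noteq> 0}" "negligible {x \<in> {0..1} - {0..<1}. g x \<noteq> 0}"
      using negligible_subset[OF negligible_sing] by blast+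
  qed
  finally show ?thesis unfolding g_def .
qed

section \<open>The two-point orbit and averages of point masses\<close>

lemma sets_add_measure: "sets (add_measure \<mu> \<nu>) = sets \<mu>"
  unfolding add_measure_def by (rule sets.sets_measure_of_eq)

text \<open>Writing the combination as the law of a Bernoulli variable makes its integrals available.\<close>

lemma two_point_measure:
  assumes "0 \<le> t" "t \<le> 1" "p \<in> topspace X2" "q \<in> topspace X2"
  shows "add_measure (scale_measure (ennreal t) (return borel_X2 p)) (scale_measure (ennreal (1 - t)) (return borel_X2 q)) =
     distr (measure_pmf (bernoulli_pmf t)) borel_X2 (\<lambda>b. if b then p else q)" (is "?M = ?N")
proof (rule measure_eqI)
  have sets: "sets ?M = sets borel_X2" by (simp add: sets_add_measure)
  then show "sets ?M = sets ?N" by simp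
  fix A assume "A \<in> sets ?M"
  then have A: "A \<in> sets borel_X2" using sets by simp
  have m: "(\<lambda>b. if b then p else q) \<in> measure_pmf (bernoulli_pmf t) \<rightarrow>\<^sub>M borel_X2"
    using assms by (simp add: space_borel_X2)
  have "emeasure ?N A = emeasure (measure_pmf (bernoulli_pmf t)) {b. (if b then p else q) \<in> A}"
    using emeasure_distr[OF m A] by (simp add: vimage_def)
  also have "\<dots> = (\<integral>\<^sup>+ b. indicator {b. (if b then p else q) \<in> A} b \<partial>bernoulli_pmf t)"
    by (rule nn_integral_indicator[symmetric]) simp
  also have "\<dots> = indicator A p * ennreal t + indicator A q * ennreal (1 - t)"
    using assms by (simp add: indicator_def)
  also have "\<dots> = emeasure ?M A"
    using A by (subst emeasure_add_measure) (simp_all add: mult.commute)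
  finally show "emeasure ?M A = emeasure ?N A" ..
qed

lemma integral_two_point:
  assumes "0 \<le> t" "t \<le> 1" "p \<in> topspace X2" "q \<in> topspace X2" "f \<in> borel_measurable borel_X2"
  shows "integral\<^sup>L (add_measure (scale_measure (ennreal t) (return borel_X2 p)) (scale_measure (ennreal (1 - t)) (return borel_X2 q))) f
     = t * f p + (1 - t) * f q"
  unfolding two_point_measure[OF assms(1-4)]
  using assms by (subst integral_distr) (auto simp: space_borel_X2 mult.commute)

text \<open>Likewise the average of point masses is the law of a uniform random choice.\<close>

lemma integral_average:
  assumes "finite I" "I \<noteq> {}" "\<And>i. i \<in> I \<Longrightarrow> q i = circle_lattice s (x i)" "f \<in> borel_measurable borel_X2"
  shows "integral\<^sup>L (scale_measure (ennreal (1 / card I)) (sum_measure borel_X2 I (\<lambda>i. return borel_X2 (q i)))) f =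
     (\<Sum>i\<in>I. f (circle_lattice s (x i))) / card I"
proof -
  have m: "(\<lambda>i. circle_lattice s (x i)) \<in> measure_pmf (pmf_of_set I) \<rightarrow>\<^sub>M borel_X2"
    by (simp add: space_borel_X2 circle_lattice_X2)
  have "scale_measure (ennreal (1 / card I)) (sum_measure borel_X2 I (\<lambda>i. return borel_X2 (q i))) =
      distr (measure_pmf (pmf_of_set I)) borel_X2 (\<lambda>i. circle_lattice s (x i))" (is "?M = ?N")
  proof (rule measure_eqI)
    have sets: "sets ?M = sets borel_X2" by (simp add: sum_measure_def)
    then show "sets ?M = sets ?N" by simp
    fix A assume "A \<in> sets ?M"
    then have A: "A \<in> sets borel_X2" using sets by simp
    have "emeasure ?N A = emeasure (measure_pmf (pmf_of_set I)) {i. circle_lattice s (x i) \<in> A}"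
      using emeasure_distr[OF m A] by (simp add: vimage_def)
    also have "\<dots> = (\<integral>\<^sup>+ i. indicator {i. circle_lattice s (x i) \<in> A} i \<partial>pmf_of_set I)"
      by (rule nn_integral_indicator[symmetric]) simp
    also have "\<dots> = (\<Sum>i\<in>I. indicator {i. circle_lattice s (x i) \<in> A} i :: ennreal) / card I"
      by (rule nn_integral_pmf_of_set[OF assms(2,1)])
    also have "\<dots> = ennreal (1 / card I) * (\<Sum>i\<in>I. indicator A (q i))"
    proof -
      have "(\<Sum>i\<in>I. indicator {i. circle_lattice s (x i) \<in> A} i) = (\<Sum>i\<in>I. indicator A (q i) :: ennreal)"
        using assms(3) by (intro sum.cong) (auto simp: indicator_def)
      moreover have "ennreal (1 / card I) = 1 / of_nat (card I)"
        using assms(1,2) by (subst divide_ennreal[symmetric]) (auto simp: card_gt_0_iff ennreal_of_nat_eq_real_of_nat)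
      ultimately show ?thesis by (simp add: divide_ennreal_def mult.commute)
    qed
    also have "\<dots> = emeasure ?M A"
      using A by (simp add: emeasure_sum_measure)
    finally show "emeasure ?M A = emeasure ?N A" ..
  qed
  then show ?thesis
    using assms(1,2) by (simp add: integral_distr[OF m assms(4)] integral_pmf_of_set)
qed

lemma shear_mult: "shear s y ** shear s z = shear s (y + z)"
proof (rule shear_eqI)
  have "frame_inv s ** (shear s y ** shear s z) ** frame s =
      (frame_inv s ** shear s y ** frame s) ** (frame_inv s ** shear s z ** frame s)"
    by (metis frame_inverse_mult(1) matrix_mul_assoc)
  then show "frame_inv s ** (shear s y ** shear s z) ** frame s = mat2 1 (y + z) 0 1"
    unfolding shear_conj by (simp add: mat2_mult add.commute)
qed

lemma shear_zero: "shear s 0 = mat 1"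
  by (rule shear_eqI[symmetric]) (simp add: frame_inverse flip: mat2_one)

text \<open>The half-integral shears act on \<open>{L(0), L(1/2)}\<close> through \<open>\<int>/2\<close>, swapping the two points.\<close>

lemma periodic_orbit_two_point: "periodic_orbit {circle_lattice s 0, circle_lattice s (1 / 2)}"
proof -
  define H where "H = (\<lambda>k. shear s (of_int k / 2)) ` (UNIV :: int set)"
  define P where "P = {circle_lattice s 0, circle_lattice s (1 / 2)}"
  have act: "act (shear s (of_int k / 2)) (circle_lattice s x) = circle_lattice s (if even k then x else x + 1 / 2)" for k :: int and x
  proof -
    have "(x + of_int k / 2) - (if even k then x else x + 1 / 2) \<in> \<int>" by (auto elim!: evenE oddE simp: field_simps)
    then show ?thesis unfolding act_shear circle_lattice_eq_iff .
  qed
  have half: "circle_lattice s (1 / 2 + 1 / 2) = circle_lattice s 0" unfolding circle_lattice_eq_iff by simp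
  have "closed_subgroup_SL2 H"
    unfolding closed_subgroup_SL2_def
  proof (intro conjI ballI)
    show "H \<subseteq> SL2" unfolding H_def using shear_SL2 by blast
    define M where "M g = frame_inv s ** g ** frame s" for g :: "real^2^2"
    have cont: "continuous_on UNIV (\<lambda>g. M g $ i $ j)" for i j
      unfolding M_def continuous_on_def by (intro ballI tendsto_vec_nth tendsto_matrix_mult tendsto_intros)
    have "g \<in> H \<longleftrightarrow> M g $ 1 $ 1 = 1 \<and> M g $ 2 $ 1 = 0 \<and> M g $ 2 $ 2 = 1 \<and> 2 * M g $ 1 $ 2 \<in> \<int>" for g
    proof
      assume "g \<in> H"
      then obtain k where "g = shear s (of_int k / 2)" unfolding H_def by blast
      then have "M g = mat2 1 (of_int k / 2) 0 1" unfolding M_def by (simp add: shear_conj)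
      then show "M g $ 1 $ 1 = 1 \<and> M g $ 2 $ 1 = 0 \<and> M g $ 2 $ 2 = 1 \<and> 2 * M g $ 1 $ 2 \<in> \<int>" by simp
    next
      assume *: "M g $ 1 $ 1 = 1 \<and> M g $ 2 $ 1 = 0 \<and> M g $ 2 $ 2 = 1 \<and> 2 * M g $ 1 $ 2 \<in> \<int>"
      then obtain k :: int where "2 * M g $ 1 $ 2 = of_int k" by (auto elim: Ints_cases)
      then have "M g = mat2 1 (of_int k / 2) 0 1" unfolding mat2_eq_iff using * by simp
      then show "g \<in> H" unfolding H_def M_def using shear_eqI by blast
    qed
    then have "H = {g. M g $ 1 $ 1 = 1} \<inter> {g. M g $ 2 $ 1 = 0} \<inter> {g. M g $ 2 $ 2 = 1} \<inter> (\<lambda>g. 2 * M g $ 1 $ 2) -` \<int>"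
      by auto
    moreover have "closed \<dots>"
      by (intro closed_Int closed_Collect_eq closed_vimage closed_Ints continuous_intros cont)
    ultimately have "closed H" by simp
    then show "closedin (top_of_set SL2) H" using \<open>H \<subseteq> SL2\<close> by (rule closed_subset[rotated])
    show "mat 1 \<in> H" unfolding H_def using shear_zero[of s] by (intro image_eqI[of _ _ 0]) auto
    show "g ** h \<in> H" if "g \<in> H" "h \<in> H" for g h
    proof -
      obtain k where "g = shear s (of_int k / 2)" using \<open>g \<in> H\<close> unfolding H_def by blast
      moreover obtain l where "h = shear s (of_int l / 2)" using \<open>h \<in> H\<close> unfolding H_def by blast
      ultimately have "g ** h = shear s (of_int (k + l) / 2)" by (simp add: shear_mult add_divide_distrib)
      then show ?thesis unfolding H_def by blast
    qed
    show "matrix_inv g \<in> H" if "g \<in> H" for g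
    proof -
      obtain k :: int where k: "g = shear s (of_int k / 2)" using \<open>g \<in> H\<close> unfolding H_def by blast
      define g' where "g' = shear s (of_int (- k) / 2)"
      have gg': "g' ** g = mat 1" "g ** g' = mat 1"
        unfolding k g'_def by (simp_all add: shear_mult shear_zero)
      then have "g ** matrix_inv g = mat 1"
        unfolding matrix_inv_def using someI_ex[of "\<lambda>A'. g ** A' = mat 1 \<and> A' ** g = mat 1"] by blast
      then have "matrix_inv g = g'" by (metis gg'(1) matrix_mul_assoc matrix_mul_lid matrix_mul_rid)
      then have "matrix_inv g = shear s (of_int (- k) / 2)" unfolding g'_def .
      then show ?thesis unfolding H_def by blast
    qed
  qed
  moreover have "P = (\<lambda>h. act h (circle_lattice s 0)) ` H"
  proof -
    have "(\<lambda>h. act h (circle_lattice s 0)) ` H = range (\<lambda>k :: int. circle_lattice s (if even k then 0 else 1 / 2))"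
      by (simp only: H_def image_image act add_0_left)
    also have "\<dots> = P"
    proof
      show "range (\<lambda>k :: int. circle_lattice s (if even k then 0 else 1 / 2)) \<subseteq> P"
      proof (rule image_subsetI)
        show "circle_lattice s (if even k then 0 else 1 / 2) \<in> P" for k :: int
          by (cases "even k") (simp_all add: P_def)
      qed
      have "circle_lattice s 0 \<in> range (\<lambda>k :: int. circle_lattice s (if even k then 0 else 1 / 2))"
        by (rule image_eqI[of _ _ 0]) simp_all
      moreover have "circle_lattice s (1 / 2) \<in> range (\<lambda>k :: int. circle_lattice s (if even k then 0 else 1 / 2))"
        by (rule image_eqI[of _ _ 1]) simp_all
      ultimately show "P \<subseteq> range (\<lambda>k :: int. circle_lattice s (if even k then 0 else 1 / 2))"
        unfolding P_def by (simp only: insert_subset empty_subsetI simp_thms)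
    qed
    finally show ?thesis ..
  qed
  moreover have "\<exists>\<mu>. invariant_prob_on H P \<mu>"
  proof
    define f where "f b = circle_lattice s (if b then 0 else 1 / 2)" for b
    define p where "p = bernoulli_pmf (1 / 2)"
    have f: "f \<in> measure_pmf p \<rightarrow>\<^sub>M borel_X2" by (simp add: space_borel_X2 circle_lattice_X2 f_def)
    show "invariant_prob_on H P (distr (measure_pmf p) borel_X2 f)"
      unfolding invariant_prob_on_def
    proof (intro conjI ballI)
      show "sets (distr (measure_pmf p) borel_X2 f) = sets borel_X2" by simp
      show "prob_space (distr (measure_pmf p) borel_X2 f)"
        by (rule prob_space.prob_space_distr[OF measure_pmf.prob_space_axioms f])
      have "closedin X2 P"
      proof -
        have "P = circle_lattice s ` {0, 1 / 2}" unfolding P_def by simp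
        then show ?thesis using closedin_circle_lattice_image[of "{0, 1 / 2}" s] by simp
      qed
      then have P: "P \<in> sets borel_X2" by (rule closedin_sets_borel_X2)
      then have "{\<Lambda> \<in> space borel_X2. \<Lambda> \<in> P} = P" using sets.sets_into_space by blast
      then show "AE \<Lambda> in distr (measure_pmf p) borel_X2 f. \<Lambda> \<in> P"
        using P by (subst AE_distr_iff[OF f]) (simp_all add: f_def P_def)
      fix h assume "h \<in> H"
      then obtain k :: int where h: "h = shear s (of_int k / 2)" unfolding H_def by blast
      have "distr (distr (measure_pmf p) borel_X2 f) borel_X2 (act h) = distr (measure_pmf p) borel_X2 (act h \<circ> f)"
        using measurable_act[OF shear_SL2] f unfolding h by (intro distr_distr) auto
      also have "act h \<circ> f = f \<circ> (if even k then id else Not)"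
        unfolding h f_def o_def act using half by (auto simp: fun_eq_iff)
      also have "distr (measure_pmf p) borel_X2 \<dots> = distr (measure_pmf (map_pmf (if even k then id else Not) p)) borel_X2 f"
        unfolding map_pmf_rep_eq using f by (subst distr_distr) (auto simp: space_borel_X2 circle_lattice_X2 f_def)
      also have "map_pmf (if even k then id else Not) p = p"
      proof (cases "even k")
        case False
        have "map_pmf Not p = p"
        proof (rule pmf_eqI)
          fix b
          have "pmf (map_pmf Not p) (\<not> (\<not> b)) = pmf p (\<not> b)"
            by (rule pmf_map_inj') (simp add: inj_def)
          then show "pmf (map_pmf Not p) b = pmf p b" by (cases b) (simp_all add: p_def)
        qed
        then show ?thesis using False by simp
      qed (simp add: pmf.map_id)
      finally show "distr (distr (measure_pmf p) borel_X2 f) borel_X2 (act h) = distr (measure_pmf p) borel_X2 f" .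
    qed
  qed
  ultimately show ?thesis unfolding periodic_orbit_def P_def using circle_lattice_X2 by blast
qed


section \<open>The lattice of a quadratic field\<close>

text \<open>The coordinates \<open>b\<close> and \<open>h\<close> of the second basis vector of the field lattice.\<close>

definition qshift :: "int \<Rightarrow> real" where
  "qshift d = (if d mod 4 = 1 then 1 / 2 else 0)"

definition qheight :: "int \<Rightarrow> real" where
  "qheight d = sqrt \<bar>of_int (qdisc d)\<bar> / 2"

lemma qheight_eq: "qheight d = (if d mod 4 = 1 then sqrt \<bar>of_int d\<bar> / 2 else sqrt \<bar>of_int d\<bar>)"
  by (simp add: qheight_def qdisc_def abs_mult real_sqrt_mult)

lemma qomega_real:
  assumes "d > 0"
  shows "qomega d = of_real (qshift d + qheight d)" "qconj d = of_real (qshift d - qheight d)"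
  using assms by (simp_all add: qomega_def qconj_def qshift_def qheight_eq rt_pos add_divide_distrib diff_divide_distrib)

lemma qomega_imaginary:
  assumes "d < 0"
  shows "Re (qomega d) = qshift d" "Im (qomega d) = qheight d" "Re (qconj d) = qshift d" "Im (qconj d) = - qheight d"
  using assms by (simp_all add: qomega_def qconj_def qshift_def qheight_eq rt_neg)

text \<open>Interchanging the embeddings reflects the lattice in the line; since \<open>2 b\<close> is an integer this
  reflection preserves it, so the choice made by \<open>em\<close> is immaterial.\<close>

lemma field_lattice_qfield:
  assumes d: "radicand d" and s: "s = 0 \<and> d > 0 \<or> s = 1 \<and> d < 0" and em: "ordered_embeddings em"
  defines "\<rho> \<equiv> if s = 0 then sqrt 2 else 1"
  shows "field_lattice s em (qfield d) =
     lattice_of_mat (frame s ** mat2 \<rho> (\<rho> * qshift d) 0 (\<rho> * qheight d))"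
proof -
  obtain \<sigma>1 \<sigma>2 where \<sigma>: "em (qfield d) = (\<sigma>1, \<sigma>2)" by (cases "em (qfield d)")
  have "\<sigma>1 \<noteq> \<sigma>2 \<and> {qemb d 1, qemb d (-1)} = {\<sigma>1, \<sigma>2}"
    using em quadratic_qfield[OF d] embeddings_qfield(1)[OF d] \<sigma> unfolding ordered_embeddings_def by force
  then consider "\<sigma>1 = qemb d 1" "\<sigma>2 = qemb d (-1)" | "\<sigma>1 = qemb d (-1)" "\<sigma>2 = qemb d 1"
    by (auto simp: doubleton_eq_iff)
  then obtain \<delta> :: real where \<delta>: "\<delta> = 1 \<or> \<delta> = -1" and lat: "\<And>m n.
      vector (if s = 0 then [Re (\<sigma>1 (of_int m + of_int n * qomega d)), Re (\<sigma>2 (of_int m + of_int n * qomega d))]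
        else [Re (\<sigma>1 (of_int m + of_int n * qomega d)), Im (\<sigma>1 (of_int m + of_int n * qomega d))]) =
      frame s *v vector [\<rho> * of_int m + \<rho> * qshift d * of_int n, 0 * of_int m + \<rho> * (\<delta> * qheight d) * of_int n]"
  proof cases
    case 1
    show ?thesis
      by (rule that[of "if s = 0 then -1 else 1"], simp, unfold 1 qemb_integer[OF d])
        (use s in \<open>auto simp: qomega_real qomega_imaginary frame_def mat2_vec frame_cos_def
          frame_sin_def \<rho>_def vec_eq_iff forall_2 algebra_simps\<close>)
  next
    case 2
    show ?thesis
      by (rule that[of "if s = 0 then 1 else -1"], simp, unfold 2 qemb_integer[OF d])
        (use s in \<open>auto simp: qomega_real qomega_imaginary frame_def mat2_vec frame_cos_def
          frame_sin_def \<rho>_def vec_eq_iff forall_2 algebra_simps\<close>)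
  qed
  have "field_lattice s em (qfield d) = (\<lambda>\<alpha>. vector (if s = 0 then [Re (\<sigma>1 \<alpha>), Re (\<sigma>2 \<alpha>)] else [Re (\<sigma>1 \<alpha>), Im (\<sigma>1 \<alpha>)])) `
      {of_int m + of_int n * qomega d | m n. True}"
    unfolding field_lattice_def \<sigma> ring_of_integers_qfield[OF d] by simp
  also have "\<dots> = {frame s *v vector [\<rho> * of_int m + \<rho> * qshift d * of_int n, 0 * of_int m + \<rho> * (\<delta> * qheight d) * of_int n] | m n. True}"
    unfolding lat[symmetric] by blast
  also have "\<dots> = lattice_of_mat (frame s ** mat2 \<rho> (\<rho> * qshift d) 0 (\<rho> * (\<delta> * qheight d)))"
    by (intro set_eqI) (simp only: lattice_frame_iff mem_Collect_eq simp_thms)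
  also have "\<dots> = lattice_of_mat (frame s ** mat2 \<rho> (\<rho> * qshift d) 0 (\<rho> * qheight d))"
  proof (cases "\<delta> = 1")
    case False
    define A where "A = mat2 1 (2 * qshift d) 0 (-1)"
    have "A $ i $ j \<in> \<int>" for i j
      using exhaust_2[of i] exhaust_2[of j] unfolding A_def qshift_def by auto
    moreover have "det A = -1" by (simp add: A_def det_mat2)
    ultimately have "lattice_of_mat (frame s ** mat2 \<rho> (\<rho> * qshift d) 0 (\<rho> * qheight d) ** A) =
        lattice_of_mat (frame s ** mat2 \<rho> (\<rho> * qshift d) 0 (\<rho> * qheight d))"
      by (intro lattice_of_mat_unimodular) auto
    moreover have "\<delta> = -1" using \<delta> False by blast
    then have "frame s ** mat2 \<rho> (\<rho> * qshift d) 0 (\<rho> * qheight d) ** A =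
        frame s ** mat2 \<rho> (\<rho> * qshift d) 0 (\<rho> * (\<delta> * qheight d))"
      unfolding A_def by (simp add: mat2_mult flip: matrix_mul_assoc)
    ultimately show ?thesis by simp
  qed simp
  finally show ?thesis .
qed

lemma q_E_qfield:
  assumes "radicand d" "s = 0 \<and> d > 0 \<or> s = 1 \<and> d < 0" "ordered_embeddings em"
  shows "q_E s em (span {frame s *v vector [c, 1]}) (qfield d) =
     circle_lattice s (qshift d + c - c * qheight d)"
proof (rule q_E_eq[OF field_lattice_qfield[OF assms]])
  show "(if s = 0 then sqrt 2 else 1 :: real) > 0" by simp
  show "qheight d > 0" using radicand_nonzero[OF assms(1)] by (simp add: qheight_eq)
qed

section \<open>Counting quadratic fields\<close>

text \<open>Radicands of signature \<open>(2, 0)\<close> are positive, those of signature \<open>(0, 1)\<close> negative.\<close>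

definition fsign :: "nat \<Rightarrow> int" where
  "fsign s = (if s = 0 then 1 else -1)"

definition radicands :: "nat \<Rightarrow> real \<Rightarrow> int set" where
  "radicands s T = {d. radicand d \<and> fsign s * d > 0 \<and> \<bar>real_of_int (qdisc d)\<bar> \<le> T}"

lemma fsign_cases:
  assumes "s \<in> {0, 1}" "fsign s * d > 0"
  shows "s = 0 \<and> d > 0 \<or> s = 1 \<and> d < 0"
  using assms by (auto simp: fsign_def)

text \<open>Isomorphism classes are singletons, by \<open>field_iso_eq\<close>.\<close>

lemma F2_eq:
  assumes "s \<in> {0, 1}"
  shows "F2 s T = (\<lambda>d. {qfield d}) ` radicands s T"
proof -
  define A where "A = {K. quadratic_field K \<and> signature K = (2 - 2 * s, s) \<and> \<bar>real_of_int (field_disc K)\<bar> \<le> T}"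
  have sig: "signature (qfield d) = (2 - 2 * s, s) \<longleftrightarrow> fsign s * d > 0" if "radicand d" for d
    using assms signature_qfield[OF that] radicand_nonzero[OF that] by (auto simp: fsign_def)
  have "A = qfield ` radicands s T"
  proof (intro equalityI subsetI)
    fix K assume K: "K \<in> A"
    then obtain d where "radicand d" "K = qfield d"
      unfolding A_def using quadratic_field_cases by blast
    then show "K \<in> qfield ` radicands s T"
      using K sig field_disc_qfield unfolding A_def radicands_def by auto
  next
    fix K assume "K \<in> qfield ` radicands s T"
    then obtain d where "K = qfield d" "d \<in> radicands s T" by blast
    then show "K \<in> A"
      using sig field_disc_qfield quadratic_qfield unfolding A_def radicands_def by auto
  qed
  moreover have "A // field_iso = (\<lambda>K. {K}) ` A"
  proof -
    have "A // field_iso = (\<lambda>K. field_iso `` {K}) ` A" unfolding quotient_def by blast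
    also have "\<dots> = (\<lambda>K. {K}) ` A" using field_iso_Image unfolding A_def by (intro image_cong) auto
    finally show ?thesis .
  qed
  ultimately show ?thesis unfolding F2_def A_def[symmetric] by (simp add: image_image)
qed

lemma qfield_inj: "inj_on (\<lambda>d. {qfield d}) (radicands s T)"
proof (rule inj_onI)
  fix d e assume *: "d \<in> radicands s T" "e \<in> radicands s T" "{qfield d} = {qfield e}"
  have "rt d \<in> qfield d" using qfieldI[of 0 1 d] by simp
  then show "d = e" using * radicand_eqI[of d e] unfolding radicands_def by auto
qed

lemma squarefree_int_iff: "squarefree (int n) \<longleftrightarrow> squarefree n"
proof
  assume *: "squarefree (int n)"
  show "squarefree n"
  proof (rule squarefreeI)
    fix x assume "x\<^sup>2 dvd n"
    then have "(int x)\<^sup>2 dvd int n" by (metis int_dvd_int_iff of_nat_power)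
    then have "int x dvd 1" using * by (rule squarefreeD[rotated])
    then show "x dvd 1" by simp
  qed
next
  assume *: "squarefree n"
  show "squarefree (int n)"
  proof (rule squarefreeI)
    fix x :: int assume "x\<^sup>2 dvd int n"
    then have "int ((nat \<bar>x\<bar>)\<^sup>2) dvd int n" by simp
    then have "(nat \<bar>x\<bar>)\<^sup>2 dvd n" by (simp only: int_dvd_int_iff)
    then have "nat \<bar>x\<bar> dvd 1" using * by (rule squarefreeD[rotated])
    then show "x dvd 1" by (simp add: nat_eq_iff)
  qed
qed

text \<open>The class modulo \<open>4\<close> of \<open>\<bar>d\<bar>\<close> for \<open>d \<equiv> 1\<close>, that is, for odd discriminant.\<close>

definition odd_class :: "nat \<Rightarrow> nat" where
  "odd_class s = (if s = 0 then 1 else 3)"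

text \<open>Fundamental discriminants up to \<open>T\<close>, split by residue: \<open>d \<equiv> 1\<close> has discriminant \<open>d\<close>, the other
  classes have \<open>4 d\<close>.  The number \<open>1\<close> is squarefree but its square root generates no field.\<close>

lemma radicands_eq:
  assumes "s \<in> {0, 1}"
  shows "radicands s T = (\<lambda>n. fsign s * int n) `
     ({n. 1 * real n \<le> T \<and> squarefree n \<and> n mod 4 = odd_class s} \<union>
      {n. 4 * real n \<le> T \<and> squarefree n \<and> n mod 4 = 2} \<union>
      {n. 4 * real n \<le> T \<and> squarefree n \<and> n mod 4 = 4 - odd_class s} - (if s = 0 then {1} else {}))"
    (is "_ = _ ` (?A \<union> ?B \<union> ?C - ?D)")
proof -
  have mem: "fsign s * int n \<in> radicands s T \<longleftrightarrow> n \<in> ?A \<union> ?B \<union> ?C - ?D" for n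
  proof (cases "squarefree n")
    case False
    then have "\<not> radicand (fsign s * int n)"
      by (auto simp: radicand_def fsign_def squarefree_int_iff squarefree_minus)
    then show ?thesis using False unfolding radicands_def by auto
  next
    case True
    have n0: "n > 0" using True by (cases n) auto
    have rad: "radicand (fsign s * int n) \<longleftrightarrow> n \<notin> ?D"
      using True assms by (auto simp: radicand_def fsign_def squarefree_int_iff squarefree_minus)
    have "n mod 4 \<noteq> 0"
    proof
      assume "n mod 4 = 0"
      then have "2\<^sup>2 dvd n" by auto
      then have "(2 :: nat) dvd 1" using True by (rule squarefreeD[rotated])
      then show False by simp
    qed
    then have m: "n mod 4 = 1 \<or> n mod 4 = 2 \<or> n mod 4 = 3" by linarith
    have md: "(fsign s * int n) mod 4 = 1 \<longleftrightarrow> n mod 4 = odd_class s"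
      using assms by (auto simp: fsign_def odd_class_def) presburger+
    have "\<bar>real_of_int (qdisc (fsign s * int n))\<bar> = (if n mod 4 = odd_class s then real n else 4 * real n)"
      unfolding qdisc_def md by (simp add: fsign_def)
    moreover have "fsign s * (fsign s * int n) > 0" using n0 by (simp add: fsign_def)
    ultimately show ?thesis
      unfolding radicands_def using rad True m assms by (auto simp: odd_class_def)
  qed
  have "d \<in> (\<lambda>n. fsign s * int n) ` (?A \<union> ?B \<union> ?C - ?D)" if "d \<in> radicands s T" for d
  proof -
    have "fsign s * d > 0" using that unfolding radicands_def by simp
    then have "d = fsign s * int (nat \<bar>d\<bar>)" by (auto simp: fsign_def split: if_splits)
    then show ?thesis using that mem[of "nat \<bar>d\<bar>"] by (intro image_eqI[of _ _ "nat \<bar>d\<bar>"]) auto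
  qed
  then show ?thesis using mem by blast
qed

lemma finite_real_bound: "c > 0 \<Longrightarrow> finite {n. c * real n \<le> T \<and> P n}"
proof (rule finite_subset)
  assume "c > 0"
  show "{n. c * real n \<le> T \<and> P n} \<subseteq> {..nat \<lceil>T / c\<rceil>}"
  proof
    fix n assume "n \<in> {n. c * real n \<le> T \<and> P n}"
    then have "real n \<le> T / c" using \<open>c > 0\<close> by (simp add: field_simps)
    then show "n \<in> {..nat \<lceil>T / c\<rceil>}" by simp linarith
  qed
qed simp

lemma finite_radicands: "s \<in> {0, 1} \<Longrightarrow> finite (radicands s T)"
  unfolding radicands_eq by (intro finite_imageI finite_Diff finite_UnI finite_real_bound) simp_all

section \<open>Limits of the averages\<close>

text \<open>Dividing by \<open>T\<close> makes the contribution of the excluded number \<open>1\<close> disappear.\<close>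

lemma sum_radicands_limit:
  assumes s: "s \<in> {0, 1}"
    and 1: "((\<lambda>T. (\<Sum>n | 1 * real n \<le> T \<and> squarefree n \<and> n mod 4 = odd_class s. G (fsign s * int n)) / T) \<longlongrightarrow> l1) at_top"
    and 2: "((\<lambda>T. (\<Sum>n | 4 * real n \<le> T \<and> squarefree n \<and> n mod 4 = 2. G (fsign s * int n)) / T) \<longlongrightarrow> l2) at_top"
    and 3: "((\<lambda>T. (\<Sum>n | 4 * real n \<le> T \<and> squarefree n \<and> n mod 4 = 4 - odd_class s. G (fsign s * int n)) / T) \<longlongrightarrow> l3) at_top"
  shows "((\<lambda>T. (\<Sum>d\<in>radicands s T. G d) / T) \<longlongrightarrow> l1 + l2 + l3) at_top"
proof -
  define g where "g n = G (fsign s * int n)" for n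
  define A where "A T = {n. 1 * real n \<le> T \<and> squarefree n \<and> n mod 4 = odd_class s}" for T
  define B where "B T = {n. 4 * real n \<le> T \<and> squarefree n \<and> n mod 4 = 2}" for T
  define C where "C T = {n. 4 * real n \<le> T \<and> squarefree n \<and> n mod 4 = 4 - odd_class s}" for T
  define e where "e = (if s = 0 then g 1 else 0)"
  have fin: "finite (A T)" "finite (B T)" "finite (C T)" for T
    unfolding A_def B_def C_def by (rule finite_real_bound, simp)+
  have disj: "A T \<inter> B T = {}" "(A T \<union> B T) \<inter> C T = {}" for T
    unfolding A_def B_def C_def odd_class_def by auto
  have eq: "(\<Sum>d\<in>radicands s T. G d) = sum g (A T) + sum g (B T) + sum g (C T) - e" if T: "T \<ge> 1" for T
  proof -
    have inj: "inj_on (\<lambda>n. fsign s * int n) X" for X by (auto simp: inj_on_def fsign_def)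
    have "(\<Sum>d\<in>radicands s T. G d) = sum g (A T \<union> B T \<union> C T - (if s = 0 then {1} else {}))"
      unfolding radicands_eq[OF s] A_def B_def C_def by (simp add: sum.reindex[OF inj] o_def g_def)
    also have "\<dots> = sum g (A T \<union> B T \<union> C T) - e"
    proof (cases "s = 0")
      case True
      have "1 \<in> A T" using T True by (simp add: A_def odd_class_def)
      then show ?thesis using True fin by (simp add: sum_diff1 e_def)
    qed (simp add: e_def)
    also have "sum g (A T \<union> B T \<union> C T) = sum g (A T) + sum g (B T) + sum g (C T)"
      using fin disj by (simp add: sum.union_disjoint)
    finally show ?thesis .
  qed
  have "((\<lambda>T. e / T) \<longlongrightarrow> 0) at_top" by real_asymp
  then have "((\<lambda>T. sum g (A T) / T + sum g (B T) / T + sum g (C T) / T - e / T) \<longlongrightarrow> l1 + l2 + l3 - 0) at_top"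
    using 1 2 3 unfolding A_def B_def C_def g_def by (intro tendsto_intros)
  moreover have "\<forall>\<^sub>F T in at_top. sum g (A T) / T + sum g (B T) / T + sum g (C T) / T - e / T =
      (\<Sum>d\<in>radicands s T. G d) / T"
    using eventually_ge_at_top[of 1] by eventually_elim (simp add: eq add_divide_distrib diff_divide_distrib)
  ultimately have "((\<lambda>T. (\<Sum>d\<in>radicands s T. G d) / T) \<longlongrightarrow> l1 + l2 + l3 - 0) at_top"
    by (rule Lim_transform_eventually)
  then show ?thesis by simp
qed

text \<open>The integral over any period is the same: \<open>F\<close> minus its mean has a periodic primitive.\<close>

lemma circle_fun_shift:
  assumes "circle_fun F"
  shows "circle_fun (\<lambda>x. F (a + x))" "integral {0..1} (\<lambda>x. F (a + x)) = integral {0..1} F"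
proof -
  have cont: "continuous_on UNIV F" and per: "\<And>x. F (x + 1) = F x"
    using assms by (auto simp: circle_fun_def)
  have cont': "continuous_on UNIV (\<lambda>x. F (a + x))"
    by (rule continuous_on_compose2[OF cont]) (auto intro!: continuous_intros)
  show c: "circle_fun (\<lambda>x. F (a + x))"
    unfolding circle_fun_def using cont' per[of "a + _"] by (simp add: add.assoc)
  define I where "I = integral {0..1} F"
  obtain G where G: "circle_fun G" "\<And>x. (G has_real_derivative (F x - I)) (at x)"
    using circle_fun_primitive[OF assms] unfolding I_def by blast
  have "((\<lambda>x. a + x) has_real_derivative 1) (at x)" for x
    by (auto intro!: derivative_eq_intros)
  then have "((\<lambda>x. G (a + x)) has_real_derivative (F (a + x) - I) * 1) (at x)" for x
    by (rule DERIV_chain2[OF G(2)])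
  then have "((\<lambda>x. G (a + x)) has_real_derivative (F (a + x) - I)) (at x)" for x by simp
  then have "((\<lambda>x. F (a + x) - I) has_integral (G (a + 1) - G (a + 0))) {0..1}"
    by (intro fundamental_theorem_of_calculus)
      (auto simp: has_real_derivative_iff_has_vector_derivative intro: has_vector_derivative_at_within)
  then have "integral {0..1} (\<lambda>x. F (a + x) - I) = 0"
    using G(1) by (simp add: integral_unique circle_fun_def)
  moreover have "integral {0..1} (\<lambda>x. F (a + x) - I) = integral {0..1} (\<lambda>x. F (a + x)) - I"
    by (subst integral_diff) (auto intro!: integrable_continuous_interval continuous_on_subset[OF cont'])
  ultimately show "integral {0..1} (\<lambda>x. F (a + x)) = integral {0..1} F" unfolding I_def by simp
qed

lemma circle_fun_lattice:
  assumes "continuous_map X2 euclideanreal f"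
  shows "circle_fun (\<lambda>x. f (circle_lattice s x))"
proof -
  have "continuous_on UNIV (\<lambda>x. f (circle_lattice s x))"
    using continuous_map_compose[OF continuous_map_circle_lattice assms] by (simp add: o_def)
  moreover have "circle_lattice s (x + 1) = circle_lattice s x" for x
    unfolding circle_lattice_eq_iff by simp
  ultimately show ?thesis unfolding circle_fun_def by simp
qed

definition radicand_of :: "complex set \<Rightarrow> int" where
  "radicand_of K = (THE d. radicand d \<and> K = qfield d)"

lemma radicand_of_qfield:
  assumes "radicand d"
  shows "radicand_of (qfield d) = d"
  unfolding radicand_of_def
proof (rule the_equality)
  show "radicand d \<and> qfield d = qfield d" using assms by simp
  fix e assume "radicand e \<and> qfield d = qfield e"
  moreover have "rt e \<in> qfield e" using qfieldI[of 0 1 e] by simp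
  ultimately show "e = d" using radicand_eqI[of e d] assms by simp
qed

lemma integral_q_average:
  assumes s: "s \<in> {0, 1}" and rep: "class_representatives rep" and em: "ordered_embeddings em"
    and f: "continuous_map X2 euclideanreal f" and ne: "radicands s T \<noteq> {}"
  shows "integral\<^sup>L (q_average s rep em (span {frame s *v vector [c, 1]}) T) f =
     (\<Sum>d\<in>radicands s T. f (circle_lattice s (qshift d + c - c * qheight d))) / real (card (radicands s T))"
proof -
  define x where "x d = qshift d + c - c * qheight d" for d
  have fin: "finite (F2 s T)" "F2 s T \<noteq> {}"
    unfolding F2_eq[OF s] using finite_radicands[OF s] ne by auto
  have rep': "rep {qfield d} = qfield d" if "radicand d" for d
  proof -
    have "qfield d \<in> {K. quadratic_field K}" using quadratic_qfield[OF that] by simp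
    then have "field_iso `` {qfield d} \<in> {K. quadratic_field K} // field_iso" by (rule quotientI)
    then have "{qfield d} \<in> {K. quadratic_field K} // field_iso"
      by (simp only: field_iso_Image[OF quadratic_qfield[OF that]])
    then have "rep {qfield d} \<in> {qfield d}" by (rule rep[unfolded class_representatives_def, rule_format])
    then show ?thesis by (rule singletonD)
  qed
  have "q_E s em (span {frame s *v vector [c, 1]}) (rep C) = circle_lattice s (x (radicand_of (rep C)))"
    if "C \<in> F2 s T" for C
  proof -
    obtain d where d: "C = {qfield d}" "d \<in> radicands s T" using \<open>C \<in> F2 s T\<close> unfolding F2_eq[OF s] by blast
    then have rad: "radicand d" and sgn: "fsign s * d > 0" unfolding radicands_def by auto
    show ?thesis
      unfolding d(1) rep'[OF rad] radicand_of_qfield[OF rad] x_def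
      by (rule q_E_qfield[OF rad fsign_cases[OF s sgn] em])
  qed
  then have "integral\<^sup>L (q_average s rep em (span {frame s *v vector [c, 1]}) T) f =
      (\<Sum>C\<in>F2 s T. f (circle_lattice s (x (radicand_of (rep C))))) / card (F2 s T)"
    unfolding q_average_def by (rule integral_average[OF fin _ continuous_map_borel_X2[OF f]])
  also have "(\<Sum>C\<in>F2 s T. f (circle_lattice s (x (radicand_of (rep C))))) =
      (\<Sum>d\<in>radicands s T. f (circle_lattice s (x d)))"
    unfolding F2_eq[OF s] sum.reindex[OF qfield_inj]
    by (rule sum.cong) (auto simp: radicands_def rep' radicand_of_qfield)
  also have "card (F2 s T) = card (radicands s T)"
    unfolding F2_eq[OF s] by (rule card_image[OF qfield_inj])
  finally show ?thesis unfolding x_def .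
qed

text \<open>Divide the sum and the number of fields by \<open>T\<close>; that \<open>\<Delta>\<close> is positive also shows that there are
  fields for all large \<open>T\<close>, so that the averages are probability measures.\<close>

lemma q_average_limit:
  assumes s: "s \<in> {0, 1}" and rep: "class_representatives rep" and em: "ordered_embeddings em"
    and f: "continuous_map X2 euclideanreal f"
    and S: "((\<lambda>T. (\<Sum>d\<in>radicands s T. f (circle_lattice s (qshift d + c - c * qheight d))) / T) \<longlongrightarrow> l) at_top"
    and N: "((\<lambda>T. (\<Sum>d\<in>radicands s T. 1) / T) \<longlongrightarrow> \<Delta>) at_top" and "\<Delta> > 0"
  shows "((\<lambda>T. integral\<^sup>L (q_average s rep em (span {frame s *v vector [c, 1]}) T) f) \<longlongrightarrow> l / \<Delta>) at_top"
proof (rule Lim_transform_eventually)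
  show "((\<lambda>T. ((\<Sum>d\<in>radicands s T. f (circle_lattice s (qshift d + c - c * qheight d))) / T) /
      ((\<Sum>d\<in>radicands s T. 1) / T)) \<longlongrightarrow> l / \<Delta>) at_top"
    using \<open>\<Delta> > 0\<close> by (intro tendsto_divide S N) simp
  have "\<forall>\<^sub>F T in at_top. (\<Sum>d\<in>radicands s T. 1) / T > (0 :: real)"
    by (rule order_tendstoD(1)[OF N \<open>\<Delta> > 0\<close>])
  then show "\<forall>\<^sub>F T in at_top. ((\<Sum>d\<in>radicands s T. f (circle_lattice s (qshift d + c - c * qheight d))) / T) /
      ((\<Sum>d\<in>radicands s T. 1) / T) = integral\<^sup>L (q_average s rep em (span {frame s *v vector [c, 1]}) T) f"
    using eventually_gt_at_top[of 0]
  proof eventually_elim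
    case (elim T)
    then have "radicands s T \<noteq> {}" by auto
    then show ?case using integral_q_average[OF s rep em f, of T c] elim(2) by simp
  qed
qed

theorem theorem1p7:
  fixes r s :: nat
    and rep :: "complex set set \<Rightarrow> complex set"
    and em :: "complex set \<Rightarrow> (complex \<Rightarrow> complex) \<times> (complex \<Rightarrow> complex)"
  assumes "(r, s) \<in> {(2, 0), (0, 1)}"
    and "class_representatives rep"
    and "ordered_embeddings em"
  shows "(\<forall>E. subspace E \<and> dim E = 1 \<and> E \<noteq> ell s \<and> E \<noteq> V0 s \<longrightarrow>
            weakly_converges X2 (q_average s rep em E) (m_Y1 s) at_top) \<and>
         (\<exists>p1 p2 t. p1 \<noteq> p2 \<and> periodic_orbit {p1, p2} \<and> {p1, p2} \<subseteq> Y1 s \<and> t \<in> {0<..<1} \<and>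
            weakly_converges X2 (q_average s rep em (V0 s))
              (add_measure (scale_measure (ennreal t) (return borel_X2 p1))
                           (scale_measure (ennreal (1 - t)) (return borel_X2 p2))) at_top)"
proof -
  have s: "s \<in> {0, 1}" using assms(1) by auto
  have odd: "odd_class s \<in> {1, 2, 3}" "4 - odd_class s \<in> {1, 2, 3}" and two: "2 \<in> {1, 2, 3 :: nat}"
    by (auto simp: odd_class_def)
  obtain \<delta>1 where \<delta>1: "\<delta>1 > 0" "\<And>F \<alpha>. circle_fun F \<Longrightarrow> \<alpha> \<noteq> 0 \<Longrightarrow>
       (\<lambda>N. (\<Sum>n | n < N \<and> squarefree n \<and> n mod 4 = odd_class s. F (\<alpha> * sqrt (real n))) / real N)
         \<longlonglongrightarrow> \<delta>1 * integral {0..1} F"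
    using sqrt_squarefree_equidistributed[OF odd(1)] by blast
  obtain \<delta>2 where \<delta>2: "\<delta>2 > 0" "\<And>F \<alpha>. circle_fun F \<Longrightarrow> \<alpha> \<noteq> 0 \<Longrightarrow>
       (\<lambda>N. (\<Sum>n | n < N \<and> squarefree n \<and> n mod 4 = 2. F (\<alpha> * sqrt (real n))) / real N)
         \<longlonglongrightarrow> \<delta>2 * integral {0..1} F"
    using sqrt_squarefree_equidistributed[OF two] by blast
  obtain \<delta>3 where \<delta>3: "\<delta>3 > 0" "\<And>F \<alpha>. circle_fun F \<Longrightarrow> \<alpha> \<noteq> 0 \<Longrightarrow>
       (\<lambda>N. (\<Sum>n | n < N \<and> squarefree n \<and> n mod 4 = 4 - odd_class s. F (\<alpha> * sqrt (real n))) / real N)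
         \<longlonglongrightarrow> \<delta>3 * integral {0..1} F"
    using sqrt_squarefree_equidistributed[OF odd(2)] by blast
  define \<Delta> where "\<Delta> = \<delta>1 + \<delta>2 / 4 + \<delta>3 / 4"
  have "\<Delta> > 0" unfolding \<Delta>_def using \<delta>1(1) \<delta>2(1) \<delta>3(1) by simp
  have dmod: "(fsign s * int n) mod 4 = 1 \<longleftrightarrow> n mod 4 = odd_class s" for n
    using s by (auto simp: fsign_def odd_class_def) presburger+
  have absd: "\<bar>real_of_int (fsign s) * real n\<bar> = real n" for n by (simp add: fsign_def)
  \<comment> \<open>A function of \<open>d\<close> that is \<open>F (\<alpha> \<surd>\<bar>d\<bar>)\<close> on odd and \<open>F' (\<alpha>' \<surd>\<bar>d\<bar>)\<close> on even discriminants.\<close>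
  have limit: "((\<lambda>T. (\<Sum>d\<in>radicands s T. G d) / T) \<longlongrightarrow>
      \<delta>1 * integral {0..1} F + (\<delta>2 + \<delta>3) / 4 * integral {0..1} F') at_top"
    if F: "circle_fun F" "\<alpha> \<noteq> 0" "circle_fun F'" "\<alpha>' \<noteq> 0"
      and G: "\<And>n. n mod 4 = odd_class s \<Longrightarrow> G (fsign s * int n) = F (\<alpha> * sqrt (real n))"
        "\<And>n. n mod 4 \<noteq> odd_class s \<Longrightarrow> G (fsign s * int n) = F' (\<alpha>' * sqrt (real n))"
    for G F F' \<alpha> \<alpha>'
  proof -
    have "((\<lambda>T. (\<Sum>n | 1 * real n \<le> T \<and> squarefree n \<and> n mod 4 = odd_class s. G (fsign s * int n)) / T)
        \<longlongrightarrow> \<delta>1 * integral {0..1} F / 1) at_top"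
      by (rule sum_upto_real_limit) (use \<delta>1(2)[OF F(1,2)] G(1) in simp_all)
    moreover have "((\<lambda>T. (\<Sum>n | 4 * real n \<le> T \<and> squarefree n \<and> n mod 4 = 2. G (fsign s * int n)) / T)
        \<longlongrightarrow> \<delta>2 * integral {0..1} F' / 4) at_top"
      by (rule sum_upto_real_limit) (use \<delta>2(2)[OF F(3,4)] G(2) in \<open>simp_all add: odd_class_def\<close>)
    moreover have "((\<lambda>T. (\<Sum>n | 4 * real n \<le> T \<and> squarefree n \<and> n mod 4 = 4 - odd_class s. G (fsign s * int n)) / T)
        \<longlongrightarrow> \<delta>3 * integral {0..1} F' / 4) at_top"
      by (rule sum_upto_real_limit) (use \<delta>3(2)[OF F(3,4)] G(2) in \<open>simp_all add: odd_class_def\<close>)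
    ultimately have "((\<lambda>T. (\<Sum>d\<in>radicands s T. G d) / T) \<longlongrightarrow>
        \<delta>1 * integral {0..1} F / 1 + \<delta>2 * integral {0..1} F' / 4 + \<delta>3 * integral {0..1} F' / 4) at_top"
      by (rule sum_radicands_limit[OF s])
    then show ?thesis by (simp add: add_divide_distrib distrib_right add.assoc)
  qed
  have const: "circle_fun (\<lambda>_. k)" for k by (simp add: circle_fun_def)
  have N: "((\<lambda>T. (\<Sum>d\<in>radicands s T. 1) / T) \<longlongrightarrow> \<Delta>) at_top"
    using limit[OF const[of 1] one_neq_zero const[of 1] one_neq_zero, of "\<lambda>_. 1"] unfolding \<Delta>_def
    by (simp add: add_divide_distrib add.assoc)
  have "weakly_converges X2 (q_average s rep em E) (m_Y1 s) at_top"
    if E: "subspace E" "dim E = 1" "E \<noteq> ell s" "E \<noteq> V0 s" for E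
    unfolding weakly_converges_def
  proof (intro allI impI)
    fix f assume f: "continuous_map X2 euclideanreal f"
    obtain c where c: "E = span {frame s *v vector [c, 1]}" using line_eq_span[OF E(1-3)] .
    \<comment> \<open>Equidistribution needs a nonzero multiple of \<open>\<surd>\<bar>d\<bar>\<close>; this is where \<open>E \<noteq> V0 s\<close> enters.\<close>
    have "c \<noteq> 0" using E(4) c V0_eq_span by auto
    define \<phi> where "\<phi> x = f (circle_lattice s x)" for x
    have \<phi>: "circle_fun \<phi>" unfolding \<phi>_def by (rule circle_fun_lattice[OF f])
    define I where "I = integral {0..1} \<phi>"
    have "((\<lambda>T. (\<Sum>d\<in>radicands s T. \<phi> (qshift d + c - c * qheight d)) / T) \<longlongrightarrow>
        \<delta>1 * integral {0..1} (\<lambda>x. \<phi> ((1 / 2 + c) + x)) + (\<delta>2 + \<delta>3) / 4 * integral {0..1} (\<lambda>x. \<phi> (c + x))) at_top"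
      by (rule limit[OF circle_fun_shift(1)[OF \<phi>] _ circle_fun_shift(1)[OF \<phi>], of "- c / 2" "- c"])
        (use \<open>c \<noteq> 0\<close> in \<open>simp_all add: qshift_def qheight_eq dmod absd\<close>)
    moreover have "\<delta>1 * I + (\<delta>2 + \<delta>3) / 4 * I = \<Delta> * I"
      unfolding \<Delta>_def by (simp add: algebra_simps add_divide_distrib)
    ultimately have "((\<lambda>T. (\<Sum>d\<in>radicands s T. f (circle_lattice s (qshift d + c - c * qheight d))) / T) \<longlongrightarrow> \<Delta> * I) at_top"
      unfolding circle_fun_shift(2)[OF \<phi>] I_def[symmetric] unfolding \<phi>_def by simp
    from q_average_limit[OF s assms(2,3) f this N \<open>\<Delta> > 0\<close>]
    show "((\<lambda>T. integral\<^sup>L (q_average s rep em E T) f) \<longlongrightarrow> integral\<^sup>L (m_Y1 s) f) at_top"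
      unfolding integral_m_Y1[OF f] c using \<open>\<Delta> > 0\<close> by (simp add: I_def \<phi>_def[abs_def])
  qed
  moreover have "\<exists>p1 p2 t. p1 \<noteq> p2 \<and> periodic_orbit {p1, p2} \<and> {p1, p2} \<subseteq> Y1 s \<and> t \<in> {0<..<1} \<and>
            weakly_converges X2 (q_average s rep em (V0 s))
              (add_measure (scale_measure (ennreal t) (return borel_X2 p1))
                           (scale_measure (ennreal (1 - t)) (return borel_X2 p2))) at_top"
  proof (intro exI conjI)
    define p1 where "p1 = circle_lattice s 0"
    define p2 where "p2 = circle_lattice s (1 / 2)"
    \<comment> \<open>The limiting proportion of even discriminants.\<close>
    define t where "t = ((\<delta>2 + \<delta>3) / 4) / \<Delta>"
    have "1 - t = (\<Delta> - (\<delta>2 + \<delta>3) / 4) / \<Delta>"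
      unfolding t_def using \<open>\<Delta> > 0\<close> by (simp add: diff_divide_distrib)
    moreover have "\<Delta> - (\<delta>2 + \<delta>3) / 4 = \<delta>1" by (simp add: \<Delta>_def add_divide_distrib)
    ultimately have t1: "1 - t = \<delta>1 / \<Delta>" by simp
    have "t > 0" "1 - t > 0" unfolding t1 unfolding t_def using \<delta>1(1) \<delta>2(1) \<delta>3(1) \<open>\<Delta> > 0\<close> by simp_all
    then show t: "t \<in> {0<..<1}" by simp
    have "(0 :: real) - 1 / 2 \<notin> \<int>"
    proof
      assume "(0 :: real) - 1 / 2 \<in> \<int>"
      then obtain k :: int where "(0 :: real) - 1 / 2 = of_int k" by (elim Ints_cases)
      then have "of_int (2 * k) = (of_int (- 1) :: real)" by simp
      then have "2 * k = - 1" by (simp only: of_int_eq_iff)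
      then show False by presburger
    qed
    then show "p1 \<noteq> p2" unfolding p1_def p2_def circle_lattice_eq_iff .
    show "periodic_orbit {p1, p2}" unfolding p1_def p2_def by (rule periodic_orbit_two_point)
    show "{p1, p2} \<subseteq> Y1 s" unfolding p1_def p2_def using circle_lattice_in_Y1 by blast
    show "weakly_converges X2 (q_average s rep em (V0 s))
              (add_measure (scale_measure (ennreal t) (return borel_X2 p1))
                           (scale_measure (ennreal (1 - t)) (return borel_X2 p2))) at_top"
      unfolding weakly_converges_def
    proof (intro allI impI)
      fix f assume f: "continuous_map X2 euclideanreal f"
      \<comment> \<open>Constant functions: with \<open>c = 0\<close> the position depends on the parity of the discriminant alone.\<close>
      have "((\<lambda>T. (\<Sum>d\<in>radicands s T. f (circle_lattice s (qshift d + 0 - 0 * qheight d))) / T) \<longlongrightarrow>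
          \<delta>1 * integral {0..1} (\<lambda>_::real. f p2) + (\<delta>2 + \<delta>3) / 4 * integral {0..1} (\<lambda>_::real. f p1)) at_top"
        by (rule limit[OF const one_neq_zero const one_neq_zero])
          (simp_all add: qshift_def dmod p1_def p2_def)
      from q_average_limit[OF s assms(2,3) f this N \<open>\<Delta> > 0\<close>]
      have "((\<lambda>T. integral\<^sup>L (q_average s rep em (V0 s) T) f) \<longlongrightarrow>
          (\<delta>1 * f p2 + (\<delta>2 + \<delta>3) / 4 * f p1) / \<Delta>) at_top"
        unfolding V0_eq_span by simp
      moreover have "(\<delta>1 * f p2 + (\<delta>2 + \<delta>3) / 4 * f p1) / \<Delta> = t * f p1 + (1 - t) * f p2"
      proof -
        have "(a * y + k * x) / D = k / D * x + a / D * y" for a k x y D :: real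
          by (simp add: add_divide_distrib)
        then show ?thesis unfolding t1 unfolding t_def .
      qed
      ultimately show "((\<lambda>T. integral\<^sup>L (q_average s rep em (V0 s) T) f) \<longlongrightarrow>
          integral\<^sup>L (add_measure (scale_measure (ennreal t) (return borel_X2 p1))
                           (scale_measure (ennreal (1 - t)) (return borel_X2 p2))) f) at_top"
        using t integral_two_point[of t p1 p2 f] continuous_map_borel_X2[OF f]
        by (simp add: p1_def p2_def circle_lattice_X2)
    qed
  qed
  ultimately show ?thesis by blast
qed


end
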